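(* Let $d\ge 1$, $m>0$. Let $W:\mathbb{R}^d\setminus\{0\}\to\mathbb{R}$ satisfy: (K1) $W\in C^1(\mathbb{R}^d\setminus\{0\})$ is radially symmetric, $W(x)=\omega(|x|)$, with $\omega'(r)>0$ for all $r>0$ and $\omega(1)=0$; (K2) there is $C_w>0$ such that $\omega'(r)\le C_w r^{1-d}$ for $0<r\le 1$; (K3) there is $C_w>0$ such that $\omega'(r)\le C_w$ for all $r>1$; (K4) either $\omega(r)$ is bounded for $r\ge 1$, or there is $C_w>0$ such that $\omega_+(a+b)\le C_w\,(1+\omega(1+a)+\omega(1+b))$ for all $a,b\ge 0$, where $\omega_+=\max\{\omega,0\}$. Let $\rho_s\in L^1_+(\mathbb{R}^d)\cap L^\infty(\mathbb{R}^d)$ with $\omega(1+|x|)\rho_s\in L^1(\mathbb{R}^d)$ be a stationary state of $$\partial_t\rho=\Delta\rho^m+\nabla\cdot(\rho\nabla(W*\rho)).$$ Then $\rho_s$ is radially decreasing up to a translation, i.e. there exists $x_0\in\mathbb{R}^d$ such that $\rho_s(\cdot-x_0)$ is radially symmetric about the origin and is non-increasing as a function of the distance to the origin.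
   Context: $L^1_+(\mathbb{R}^d)$ denotes the nonnegative functions in $L^1(\mathbb{R}^d)$; functions are identified when equal almost everywhere. A function $\rho_s\in L^1_+(\mathbb{R}^d)\cap L^\infty(\mathbb{R}^d)$ is a stationary state of the equation if $\rho_s^m\in H^1_{loc}(\mathbb{R}^d)$, $\nabla\psi_s:=\nabla W*\rho_s\in L^1_{loc}(\mathbb{R}^d)$, and $\nabla\rho_s^m=-\rho_s\nabla\psi_s$ in $\mathbb{R}^d$ in the sense of distributions. *)

theory Defs
  imports "HOL-Analysis.Analysis"
begin

definition gradient :: "('a::euclidean_space \<Rightarrow> real) \<Rightarrow> 'a \<Rightarrow> 'a" where
  "gradient f x = (\<Sum>b\<in>Basis. frechet_derivative f (at x) b *\<^sub>R b)"

text \<open>\<open>C\<close>-\<open>k\<close> functions on the whole space, by recursion on the partial derivatives.\<close>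

primrec Ck :: "nat \<Rightarrow> ('a::euclidean_space \<Rightarrow> real) \<Rightarrow> bool" where
  "Ck 0 f \<longleftrightarrow> continuous_on UNIV f"
| "Ck (Suc k) f \<longleftrightarrow>
     f differentiable_on UNIV \<and> (\<forall>b\<in>Basis. Ck k (\<lambda>x. frechet_derivative f (at x) b))"

definition test_function :: "('a::euclidean_space \<Rightarrow> real) \<Rightarrow> bool" where
  "test_function \<phi> \<longleftrightarrow> (\<forall>k. Ck k \<phi>) \<and> compact (closure {x. \<phi> x \<noteq> 0})"

text \<open>
  Elements of the function spaces below are represented by Lebesgue measurable functions,
  and every condition on them is invariant under modification on a null set.
\<close>

definition L1_plus :: "('a::euclidean_space \<Rightarrow> real) set" where
  "L1_plus = {f. integrable lebesgue f \<and> (AE x in lebesgue. 0 \<le> f x)}"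

definition L_infinity :: "('a::euclidean_space \<Rightarrow> real) set" where
  "L_infinity = {f. f \<in> borel_measurable lebesgue \<and> (\<exists>C. AE x in lebesgue. \<bar>f x\<bar> \<le> C)}"

definition L1_loc :: "('a::euclidean_space \<Rightarrow> 'b::euclidean_space) set" where
  "L1_loc = {f. \<forall>K. compact K \<longrightarrow> f absolutely_integrable_on K}"

definition L2_loc :: "('a::euclidean_space \<Rightarrow> 'b::euclidean_space) set" where
  "L2_loc = {f. f \<in> borel_measurable lebesgue \<and>
     (\<forall>K. compact K \<longrightarrow> (\<lambda>x. (norm (f x))\<^sup>2) absolutely_integrable_on K)}"

text \<open>The identity \<open>\<nabla>u = v\<close> in the sense of distributions, for locally integrable \<open>u\<close> and \<open>v\<close>.\<close>

definition has_distributional_gradient ::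
    "('a::euclidean_space \<Rightarrow> real) \<Rightarrow> ('a \<Rightarrow> 'a) \<Rightarrow> bool" where
  "has_distributional_gradient u v \<longleftrightarrow> u \<in> L1_loc \<and> v \<in> L1_loc \<and>
     (\<forall>\<phi>. test_function \<phi> \<longrightarrow> (\<forall>b\<in>Basis.
        (LINT x|lebesgue. u x * frechet_derivative \<phi> (at x) b)
          = - (LINT x|lebesgue. (v x \<bullet> b) * \<phi> x)))"

definition H1_loc :: "('a::euclidean_space \<Rightarrow> real) set" where
  "H1_loc = {u. u \<in> L2_loc \<and> (\<exists>v. v \<in> L2_loc \<and> has_distributional_gradient u v)}"

definition convolve :: "('a::euclidean_space \<Rightarrow> 'a) \<Rightarrow> ('a \<Rightarrow> real) \<Rightarrow> 'a \<Rightarrow> 'a" where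
  "convolve F f x = (LINT y|lebesgue. f y *\<^sub>R F (x - y))"

text \<open>
  The kernel \<open>W\<close> is only meaningful away from the origin; the value of \<open>gradient W\<close> at \<open>0\<close>
  does not affect the convolution, as it enters for a single \<open>y\<close> only. If \<open>gradient W x\<close> is
  bounded by a multiple of \<open>norm x powi (1 - d)\<close> near \<open>0\<close> and bounded away from \<open>0\<close>, the
  convolution integral converges absolutely at every point for every \<open>\<rho>\<close> in
  \<open>L1_plus \<inter> L_infinity\<close>.
\<close>

definition stationary_state ::
    "real \<Rightarrow> ('a::euclidean_space \<Rightarrow> real) \<Rightarrow> ('a \<Rightarrow> real) \<Rightarrow> bool" where
  "stationary_state m W \<rho> \<longleftrightarrow>
     \<rho> \<in> L1_plus \<inter> L_infinity \<and>
     (\<lambda>x. \<rho> x powr m) \<in> H1_loc \<and>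
     convolve (gradient W) \<rho> \<in> L1_loc \<and>
     has_distributional_gradient (\<lambda>x. \<rho> x powr m)
       (\<lambda>x. - (\<rho> x *\<^sub>R convolve (gradient W) \<rho> x))"

definition radially_decreasing :: "('a::euclidean_space \<Rightarrow> real) \<Rightarrow> bool" where
  "radially_decreasing f \<longleftrightarrow>
     (\<exists>g. antimono_on {0..} g \<and> (AE x in lebesgue. f x = g (norm x)))"

end

theory Submission
  imports Defs
begin

text \<open>
  Fix a unit vector \<open>e\<close> and look at the profile \<open>\<rho>\<close> along a line in direction \<open>e\<close>. Where
  \<open>\<rho> > 0\<close>, the equation \<open>\<nabla>\<rho>\<^sup>m = - \<rho> \<nabla>\<psi>\<close> with \<open>\<nabla>\<psi> = \<nabla>W * \<rho>\<close> says that \<open>\<psi> + \<Phi>(\<rho>\<^sup>m)\<close> is constant,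
  \<open>\<Phi>'(y) = y\<close> to the power \<open>-1/m\<close>. A component of \<open>{\<rho> > h}\<close> on the line, here called a chord,
  has \<open>\<rho> = h\<close> at both ends, so the integral of the force \<open>\<partial>\<^sub>e\<psi>\<close> over every chord is \<open>0\<close>
  (\<open>mean_force_zero\<close>). By the layer-cake formula \<open>\<rho>\<close> is a superposition of chords, at all heights and
  on all lines in direction \<open>e\<close>. Hence the chords exert forces on each other in such a way that the
  total force on each single chord vanishes.

  Because \<open>W\<close> is radial and increasing, the force between two chords has the sign of the
  difference of their centers (\<open>interval_pair_force\<close>). Multiplying the vanishing total force on a
  chord by a bounded strictly increasing function \<open>V\<close> of its center, integrating over all chords and
  antisymmetrising gives the integral of \<open>V(c) - V(c')\<close> times the mutual force over all pairs of
  chords. It is \<open>0\<close> and its integrand is nonnegative, and positive unless \<open>c = c'\<close>. Therefore all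
  chords in direction \<open>e\<close> have the same center (\<open>chord_centers_agree\<close>): \<open>\<rho>\<close> is symmetric about
  a hyperplane orthogonal to \<open>e\<close> and decreasing away from it
  (\<open>decreasing_about_hyperplane\<close>). No decomposition of space into lines is needed for this: the
  pairs (point, height) below the graph of \<open>\<rho>\<close> carry Lebesgue measure, and replacing a function by its
  average over the chord through each such pair does not change its integral
  (\<open>nn_integral_chord_average\<close>).

  After a translation the hyperplanes of the coordinate directions pass through the origin. Then \<open>\<rho>\<close>
  is even, and a hyperplane that misses the origin would make \<open>\<rho>\<close> periodic, which a continuous
  integrable function cannot be unless it vanishes. So all hyperplanes pass through the origin, and \<open>\<rho>\<close> is radially
  decreasing (\<open>radial_if_decreasing_in_all_directions\<close>).

  The level sets have to be those of a continuous function. The force is a bounded function, so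
  \<open>\<rho>\<^sup>m\<close> has a bounded weak gradient and hence a Lipschitz representative, which satisfies
  the equation in integrated form along almost every line (\<open>stationary_representative\<close>).
\<close>

section \<open>Smooth bump functions\<close>

text \<open>
  The case \<open>n = 0\<close> is the classical smooth function that is flat at \<open>0\<close>. The other members are there
  because the linear span of the family is closed under differentiation.
\<close>

definition flat :: "nat \<Rightarrow> real \<Rightarrow> real" where
  "flat n t = (if 0 < t then (1 / t) ^ n * exp (- (1 / t)) else 0)"

lemma flat_has_derivative:
  "(flat n has_real_derivative flat (n + 2) t - real n * flat (n + 1) t) (at t)"
proof -
  consider "t > 0" | "t < 0" | "t = 0" by linarith
  then show ?thesis
  proof cases
    case 1
    have "((\<lambda>t. (1 / t) ^ n * exp (- (1 / t))) has_real_derivative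
            real n * (1 / t) ^ (n - 1) * - (1 / t)\<^sup>2 * exp (- (1 / t))
            + (1 / t)\<^sup>2 * exp (- (1 / t)) * (1 / t) ^ n) (at t)"
      using 1 by (auto intro!: derivative_eq_intros simp: power2_eq_square)
    moreover have "real n * (1 / t) ^ (n - 1) * - (1 / t)\<^sup>2 * exp (- (1 / t))
            + (1 / t)\<^sup>2 * exp (- (1 / t)) * (1 / t) ^ n = flat (n + 2) t - real n * flat (n + 1) t"
      using 1 by (cases n) (simp_all add: flat_def power2_eq_square mult_ac)
    ultimately have "((\<lambda>t. (1 / t) ^ n * exp (- (1 / t))) has_real_derivative
            flat (n + 2) t - real n * flat (n + 1) t) (at t)"
      by simp
    then show ?thesis
      by (rule has_field_derivative_transform_within_open[where S = "{0<..}"])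
         (use 1 in \<open>auto simp: flat_def\<close>)
  next
    case 2
    have "((\<lambda>t. 0) has_real_derivative flat (n + 2) t - real n * flat (n + 1) t) (at t)"
      using 2 by (simp add: flat_def)
    then show ?thesis
      by (rule has_field_derivative_transform_within_open[where S = "{..<0}"])
         (use 2 in \<open>auto simp: flat_def\<close>)
  next
    case 3
    have lim: "((\<lambda>t. (1 / t) ^ Suc n / exp (1 / t)) \<longlongrightarrow> (0::real)) (at_right 0)"
      by (rule filterlim_compose[OF tendsto_power_div_exp_0])
         (use filterlim_inverse_at_top_right in \<open>simp add: inverse_eq_divide\<close>)
    have "((\<lambda>y. flat n y / y) \<longlongrightarrow> 0) (at_right 0)"
      by (rule Lim_transform_eventually[OF lim])
         (auto simp: eventually_at_right_field flat_def exp_minus field_simps intro!: exI[of _ 1])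
    moreover have "((\<lambda>y. flat n y / y) \<longlongrightarrow> 0) (at_left 0)"
      by (rule tendsto_eventually) (auto simp: eventually_at_left_field flat_def intro!: exI[of _ "-1"])
    ultimately have "((\<lambda>y. flat n y / y) \<longlongrightarrow> 0) (at 0)"
      by (simp add: filterlim_split_at)
    then show ?thesis
      using 3 by (simp add: has_field_derivative_iff flat_def)
  qed
qed

text \<open>
  A class of functions that contains the bumps below and is closed under partial derivatives, so that
  being \<open>Ck\<close> for every \<open>k\<close> follows by a single induction.
\<close>

inductive smooth_expr :: "('a::euclidean_space \<Rightarrow> real) \<Rightarrow> bool" where
  const: "smooth_expr (\<lambda>x. c)"
| coord: "smooth_expr (\<lambda>x. x \<bullet> b)"
| add: "smooth_expr f \<Longrightarrow> smooth_expr g \<Longrightarrow> smooth_expr (\<lambda>x. f x + g x)"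
| mult: "smooth_expr f \<Longrightarrow> smooth_expr g \<Longrightarrow> smooth_expr (\<lambda>x. f x * g x)"
| flat: "smooth_expr g \<Longrightarrow> smooth_expr (\<lambda>x. flat n (g x))"

lemma smooth_expr_has_derivative:
  assumes "smooth_expr f"
  shows "\<exists>f'. (\<forall>x. (f has_derivative f' x) (at x)) \<and> (\<forall>v. smooth_expr (\<lambda>x. f' x v))"
  using assms
proof induction
  case (const c)
  show ?case by (rule exI[of _ "\<lambda>x v. 0"]) (auto intro: smooth_expr.const)
next
  case (coord b)
  show ?case
    by (rule exI[of _ "\<lambda>x v. v \<bullet> b"]) (auto intro!: smooth_expr.const derivative_eq_intros)
next
  case (add f g)
  then obtain f' g' where "\<And>x. (f has_derivative f' x) (at x)" "\<And>v. smooth_expr (\<lambda>x. f' x v)"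
    "\<And>x. (g has_derivative g' x) (at x)" "\<And>v. smooth_expr (\<lambda>x. g' x v)" by blast
  then show ?case
    by (intro exI[of _ "\<lambda>x v. f' x v + g' x v"])
       (auto intro!: smooth_expr.add derivative_eq_intros)
next
  case (mult f g)
  then obtain f' g' where "\<And>x. (f has_derivative f' x) (at x)" "\<And>v. smooth_expr (\<lambda>x. f' x v)"
    "\<And>x. (g has_derivative g' x) (at x)" "\<And>v. smooth_expr (\<lambda>x. g' x v)" by blast
  then show ?case
    by (intro exI[of _ "\<lambda>x v. f x * g' x v + f' x v * g x"])
       (auto intro!: smooth_expr.add smooth_expr.mult has_derivative_mult mult.hyps)
next
  case (flat g n)
  then obtain g' where g': "\<And>x. (g has_derivative g' x) (at x)" "\<And>v. smooth_expr (\<lambda>x. g' x v)"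
    by blast
  have "((\<lambda>x. flat n (g x)) has_derivative
          (\<lambda>v. (flat (n + 2) (g x) + - real n * flat (n + 1) (g x)) * g' x v)) (at x)" for x
    using has_derivative_compose[OF g'(1) flat_has_derivative[unfolded has_field_derivative_def]]
    by simp
  then show ?case
    by (intro exI[of _ "\<lambda>x v. (flat (n + 2) (g x) + - real n * flat (n + 1) (g x)) * g' x v"]
          conjI allI smooth_expr.add smooth_expr.mult smooth_expr.flat smooth_expr.const g'(2) flat.hyps)
qed

lemma smooth_expr_Ck:
  assumes "smooth_expr f"
  shows "Ck k f"
  using assms
proof (induction k arbitrary: f)
  case 0
  obtain f' where "\<And>x. (f has_derivative f' x) (at x)"
    using smooth_expr_has_derivative[OF 0] by blast
  then show ?case
    by (auto intro!: continuous_at_imp_continuous_on has_derivative_continuous)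
next
  case (Suc k)
  obtain f' where f': "\<And>x. (f has_derivative f' x) (at x)" "\<And>v. smooth_expr (\<lambda>x. f' x v)"
    using smooth_expr_has_derivative[OF Suc.prems] by blast
  have "frechet_derivative f (at x) = f' x" for x
    using frechet_derivative_at[OF f'(1)] by simp
  with f' show ?case
    by (auto simp: differentiable_on_def differentiable_def Suc.IH)
qed

lemma smooth_expr_prod:
  assumes "\<And>i. i \<in> A \<Longrightarrow> smooth_expr (f i)"
  shows "smooth_expr (\<lambda>x. \<Prod>i\<in>A. f i x)"
  using assms
  by (induction A rule: infinite_finite_induct) (auto intro: smooth_expr.const smooth_expr.mult)

text \<open>
  Smooth approximations of the indicator of an open box; they increase to it as \<open>n\<close> grows.
\<close>

definition box_bump :: "'a::euclidean_space \<Rightarrow> 'a \<Rightarrow> nat \<Rightarrow> 'a \<Rightarrow> real" where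
  "box_bump a c n x =
     (\<Prod>b\<in>Basis. flat 0 (real (Suc n) * (x \<bullet> b - a \<bullet> b)) * flat 0 (real (Suc n) * (c \<bullet> b - x \<bullet> b)))"

lemma flat_bounds: "0 \<le> flat 0 t" "flat 0 t \<le> 1"
  by (auto simp: flat_def)

lemma box_bump_bounds: "0 \<le> box_bump a c n x" "box_bump a c n x \<le> 1"
  unfolding box_bump_def
  by (auto intro!: prod_nonneg prod_le_1 mult_nonneg_nonneg mult_le_one flat_bounds)

lemma box_bump_outside: "x \<notin> box a c \<Longrightarrow> box_bump a c n x = 0"
  by (force simp: box_bump_def mem_box flat_def zero_less_mult_iff not_less)

lemma box_bump_tendsto: "(\<lambda>n. box_bump a c n x) \<longlonglongrightarrow> indicator (box a c) x"
proof (cases "x \<in> box a c")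
  case True
  have lim: "(\<lambda>n. flat 0 (real (Suc n) * t)) \<longlonglongrightarrow> 1" if "t > 0" for t :: real
  proof -
    have "(\<lambda>n. exp (- ((1 / t) * inverse (real (Suc n))))) \<longlonglongrightarrow> exp (- ((1 / t) * 0))"
      by (intro tendsto_intros LIMSEQ_inverse_real_of_nat)
    then show ?thesis using that by (simp add: flat_def zero_less_mult_iff add_pos_nonneg inverse_eq_divide mult.commute)
  qed
  have "(\<lambda>n. box_bump a c n x) \<longlonglongrightarrow> (\<Prod>b\<in>(Basis::'a set). 1 * 1)"
    unfolding box_bump_def
    using True by (intro tendsto_prod tendsto_mult lim) (auto simp: mem_box)
  with True show ?thesis by simp
qed (simp add: box_bump_outside)

lemma smooth_expr_box_bump: "smooth_expr (box_bump a c n)"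
proof -
  have "smooth_expr (\<lambda>x. \<Prod>b\<in>Basis. flat 0 (- (real (Suc n) * (a \<bullet> b)) + x \<bullet> (real (Suc n) *\<^sub>R b))
            * flat 0 (real (Suc n) * (c \<bullet> b) + x \<bullet> (- (real (Suc n) *\<^sub>R b))))"
    by (intro smooth_expr_prod smooth_expr.intros)
  then show ?thesis
    unfolding box_bump_def by (simp add: algebra_simps)
qed

lemma test_function_box_bump: "test_function (box_bump a c n)"
proof -
  have "closure {x. box_bump a c n x \<noteq> 0} \<subseteq> cbox a c"
  proof (rule closure_minimal)
    show "{x. box_bump a c n x \<noteq> 0} \<subseteq> cbox a c"
      using box_bump_outside box_subset_cbox by blast
  qed (rule closed_cbox)
  then have "compact (closure {x. box_bump a c n x \<noteq> 0})"
    by (meson bounded_cbox bounded_subset closed_closure compact_eq_bounded_closed)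
  then show ?thesis
    by (simp add: test_function_def smooth_expr_Ck smooth_expr_box_bump)
qed

section \<open>Translations, null sets and the fundamental lemma\<close>

lemma integrable_bounded_support:
  fixes f :: "'b::euclidean_space \<Rightarrow> real"
  assumes [measurable]: "f \<in> borel_measurable borel"
    and "\<And>x. \<bar>f x\<bar> \<le> B" "\<And>x. x \<notin> A \<Longrightarrow> f x = 0" "bounded A"
  shows "integrable lborel f"
proof -
  obtain R where R: "A \<subseteq> cball 0 R"
    using bounded_subset_ballD[OF \<open>bounded A\<close>, of 0] ball_subset_cball by (meson order_trans)
  show ?thesis
  proof (rule integrableI_bounded_set[where A = "cball 0 R" and B = B])
    show "emeasure lborel (cball 0 R :: 'b set) < \<infinity>"
      by (rule emeasure_bounded_finite) simp
    show "AE x in lborel. x \<notin> cball 0 R \<longrightarrow> f x = 0"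
      using assms(3) R by blast
  qed (use assms in auto)
qed

lemma lborel_translate:
  fixes f :: "'b::euclidean_space \<Rightarrow> real"
  assumes [measurable]: "f \<in> borel_measurable borel"
  shows "(LBINT x. f (x + c)) = (LBINT x. f x)"
    and "integrable lborel (\<lambda>x. f (x + c)) = integrable lborel f"
proof -
  have d: "lborel = distr lborel borel (\<lambda>x. x + c)"
    using lborel_distr_plus[of c] by (simp add: add.commute[of c] cong: distr_cong)
  show "(LBINT x. f (x + c)) = (LBINT x. f x)"
    by (subst (2) d) (simp add: integral_distr)
  show "integrable lborel (\<lambda>x. f (x + c)) = integrable lborel f"
    by (subst (2) d) (simp add: integrable_distr_eq)
qed

lemma lborel_nn_translate:
  fixes f :: "'b::euclidean_space \<Rightarrow> ennreal"
  assumes [measurable]: "f \<in> borel_measurable borel"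
  shows "(\<integral>\<^sup>+x. f (x + c) \<partial>lborel) = (\<integral>\<^sup>+x. f x \<partial>lborel)"
proof -
  have d: "lborel = distr lborel borel (\<lambda>x. x + c)"
    using lborel_distr_plus[of c] by (simp add: add.commute[of c] cong: distr_cong)
  show ?thesis
    by (subst (2) d) (simp add: nn_integral_distr)
qed

lemma AE_lborel_translate:
  fixes c :: "'b::euclidean_space"
  assumes "AE x in lborel. P x"
  shows "AE x in lborel. P (x + c)"
proof -
  obtain N where N: "N \<in> null_sets lborel" "{x. \<not> P x} \<subseteq> N"
    using assms by (auto simp: eventually_ae_filter)
  have "{x. x - - c \<in> N} \<in> null_sets lborel"
    using N(1) by (rule null_sets_translation)
  then have "AE x in lborel. x \<notin> {x. x - - c \<in> N}"
    by (rule AE_not_in)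
  then show ?thesis
    by (rule AE_mp) (use N(2) in \<open>auto intro!: AE_I2\<close>)
qed

lemma box_bump_derivative:
  fixes a c :: "'a::euclidean_space"
  obtains \<phi>' B where "\<And>x. (box_bump a c n has_derivative \<phi>' x) (at x)"
    "\<And>v. continuous_on UNIV (\<lambda>x. \<phi>' x v)"
    "\<And>x v. x \<notin> cbox a c \<Longrightarrow> \<phi>' x v = 0"
    "\<And>x v. \<bar>\<phi>' x v\<bar> \<le> B v"
proof -
  obtain \<phi>' where d: "\<And>x. (box_bump a c n has_derivative \<phi>' x) (at x)"
    and s: "\<And>v. smooth_expr (\<lambda>x. \<phi>' x v)"
    using smooth_expr_has_derivative[OF smooth_expr_box_bump] by blast
  have cont: "continuous_on UNIV (\<lambda>x. \<phi>' x v)" for v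
    using smooth_expr_Ck[OF s, of 0 v] by simp
  have out: "\<phi>' x v = 0" if "x \<notin> cbox a c" for x v
  proof -
    have "(box_bump a c n has_derivative (\<lambda>v. 0)) (at x)"
    proof (rule has_derivative_transform_within_open)
      show "((\<lambda>x. 0) has_derivative (\<lambda>v. 0)) (at x)" by simp
      show "open (- cbox a c)" by (simp add: open_Compl closed_cbox)
      show "x \<in> - cbox a c" using that by simp
      show "0 = box_bump a c n y" if "y \<in> - cbox a c" for y
        using that box_subset_cbox[of a c] box_bump_outside[of y a c n] by auto
    qed
    then have "\<phi>' x = (\<lambda>v. 0)"
      using d has_derivative_unique by blast
    then show ?thesis by simp
  qed
  have "\<exists>B. \<forall>x. \<bar>\<phi>' x v\<bar> \<le> B" for v
  proof -
    have "bounded ((\<lambda>x. \<phi>' x v) ` cbox a c)"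
      by (intro compact_imp_bounded compact_continuous_image continuous_on_subset[OF cont]) auto
    then obtain B where "B > 0" "\<And>x. x \<in> cbox a c \<Longrightarrow> \<bar>\<phi>' x v\<bar> \<le> B"
      by (auto simp: bounded_pos)
    with out have "\<bar>\<phi>' x v\<bar> \<le> B" for x
      by (cases "x \<in> cbox a c") auto
    then show ?thesis by blast
  qed
  then obtain B where "\<And>x v. \<bar>\<phi>' x v\<bar> \<le> B v" by metis
  then show ?thesis using that d cont out by blast
qed

lemma box_bump_measurable[measurable]: "box_bump a c n \<in> borel_measurable borel"
  using smooth_expr_Ck[OF smooth_expr_box_bump, of 0 a c n]
  by (simp add: borel_measurable_continuous_onI)

lemma box_bump_translate: "box_bump a c n (x - w) = box_bump (a + w) (c + w) n x"
  by (simp add: box_bump_def algebra_simps)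

text \<open>
  The fundamental lemma of the calculus of variations. The bumps converge boundedly to indicators of
  boxes, so all box integrals of \<open>g\<close> vanish, and the Lebesgue differentiation theorem on cubes
  recovers \<open>g\<close> from them.
\<close>

lemma AE_zero_if_box_bumps_zero:
  fixes g :: "'a::euclidean_space \<Rightarrow> real"
  assumes [measurable]: "g \<in> borel_measurable borel" and bd: "\<And>x. \<bar>g x\<bar> \<le> B"
    and zero: "\<And>a c n. (LBINT x. g x * box_bump a c n x) = 0"
  shows "AE x in lborel. g x = 0"
proof -
  have B: "0 \<le> B" using bd[of 0] by linarith
  have box_zero: "(LBINT x. g x * indicator (box a c) x) = 0" for a c
  proof -
    have "(\<lambda>n. LBINT x. g x * box_bump a c n x) \<longlonglongrightarrow> (LBINT x. g x * indicator (box a c) x)"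
    proof (rule integral_dominated_convergence[where w = "\<lambda>x. B * indicator (cbox a c) x"])
      show "integrable lborel (\<lambda>x. B * indicator (cbox a c) x)"
        by (intro integrable_mult_right integrable_real_indicator) (auto simp: emeasure_lborel_cbox_eq)
      show "AE x in lborel. (\<lambda>n. g x * box_bump a c n x) \<longlonglongrightarrow> g x * indicator (box a c) x"
        by (intro AE_I2 tendsto_intros box_bump_tendsto)
      show "AE x in lborel. norm (g x * box_bump a c n x) \<le> B * indicator (cbox a c) x" for n
      proof (rule AE_I2)
        fix x
        show "norm (g x * box_bump a c n x) \<le> B * indicator (cbox a c) x"
          using mult_mono[OF bd[of x] box_bump_bounds(2)[of a c n x] B box_bump_bounds(1)[of a c n x]] B
            box_bump_bounds(1)[of a c n x] box_bump_outside[of x a c n] box_subset_cbox[of a c]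
          by (cases "x \<in> box a c") (auto simp: abs_mult)
      qed
    qed simp_all
    then show ?thesis
      using zero by (simp add: LIMSEQ_const_iff)
  qed
  have int: "integrable lborel (\<lambda>x. g x * indicator (cbox a c) x)" for a c
    by (rule integrable_bounded_support[where B = B and A = "cbox a c"])
       (use bd B in \<open>auto simp: indicator_def\<close>)
  have abs: "set_integrable lborel (cbox a c) g" for a c
    using int by (simp add: set_integrable_def mult.commute)
  have HK_zero: "integral (cbox a c) g = 0" for a c
  proof -
    have "integral (cbox a c) g = (LBINT x. indicator (cbox a c) x *\<^sub>R g x)"
      using set_borel_integral_eq_integral(2)[OF abs] by (simp add: set_lebesgue_integral_def)
    also have "\<dots> = (LBINT x. g x * indicator (box a c) x)"
    proof (rule integral_cong_AE)
      have "AE x in lborel. x \<notin> cbox a c - box a c"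
        by (intro AE_not_in null_sets_cbox_Diff_box)
      then show "AE x in lborel. indicator (cbox a c) x *\<^sub>R g x = g x * indicator (box a c) x"
        by eventually_elim (use box_subset_cbox[of a c] in \<open>auto simp: indicator_def\<close>)
    qed simp_all
    finally show ?thesis using box_zero by simp
  qed
  have "g integrable_on cbox a c" for a c
    using set_borel_integral_eq_integral(1)[OF abs] .
  then obtain N where "negligible N"
    and N: "\<And>x e. \<lbrakk>x \<notin> N; 0 < e\<rbrakk> \<Longrightarrow> \<exists>d>0. \<forall>h. 0 < h \<and> h < d \<longrightarrow>
              norm (integral (cbox x (x + h *\<^sub>R One)) g /\<^sub>R h ^ DIM('a) - g x) < e"
    using integrable_ccontinuous_explicit by blast
  have "g x = 0" if "x \<notin> N" for x
  proof (rule ccontr)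
    assume "g x \<noteq> 0"
    then have "0 < \<bar>g x\<bar>" by simp
    from N[OF that this] obtain d where "d > 0" "\<forall>h. 0 < h \<and> h < d \<longrightarrow>
        norm (integral (cbox x (x + h *\<^sub>R One)) g /\<^sub>R h ^ DIM('a) - g x) < \<bar>g x\<bar>"
      by blast
    from this(2)[rule_format, of "d / 2"] this(1) show False
      by (simp add: HK_zero)
  qed
  then have "{x. g x \<noteq> 0} \<subseteq> N" by blast
  then have "negligible {x. g x \<noteq> 0}"
    using \<open>negligible N\<close> negligible_subset by blast
  then have "{x. g x \<noteq> 0} \<in> null_sets lborel"
    by (simp add: negligible_iff_null_sets null_sets_completion_iff)
  then show ?thesis
    by (auto dest: AE_not_in)
qed

section \<open>Line integrals of a weak derivative\<close>

text \<open>
  Testing the difference of \<open>u (x + w) - u x\<close> and the line integral against \<open>\<phi>\<close> moves the translation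
  to \<open>\<phi>\<close>. The difference \<open>\<phi> (x - w) - \<phi> x\<close> is an integral of derivatives of translated test
  functions, to which the weak equation applies.
\<close>

lemma weak_derivative_imp_line_integral:
  fixes u f :: "'a::euclidean_space \<Rightarrow> real"
  assumes [measurable]: "u \<in> borel_measurable borel" "f \<in> borel_measurable borel"
    and bu: "\<And>x. \<bar>u x\<bar> \<le> B" and bf: "\<And>x. \<bar>f x\<bar> \<le> C"
    and weak: "\<And>a c n. (LBINT x. u x * frechet_derivative (box_bump a c n) (at x) w)
                 = - (LBINT x. f x * box_bump a c n x)"
  shows "AE x in lborel. u (x + w) - u x = (LBINT s. indicator {0..1} s * f (x + s *\<^sub>R w))"
proof -
  define L where "L x = (LBINT s. indicator {0..1} s * f (x + s *\<^sub>R w))" for x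
  have [measurable]: "L \<in> borel_measurable borel"
    unfolding L_def by measurable
  have B: "0 \<le> B" and C: "0 \<le> C"
    using bu[of 0] bf[of 0] by linarith+
  have seg_int: "integrable lborel (\<lambda>s. indicator {0..1} s * f (x + s *\<^sub>R w))" for x
    by (rule integrable_bounded_support[where B = C and A = "{0..1}"])
       (use bf C in \<open>auto simp: indicator_def\<close>)
  have L_le: "\<bar>L x\<bar> \<le> C" for x
  proof -
    have "\<bar>L x\<bar> \<le> (LBINT s. C * indicator {0..1::real} s)"
      unfolding L_def
    proof (rule integral_abs_bound_integral[OF seg_int])
      show "integrable lborel (\<lambda>s. C * indicator {0..1::real} s)"
        by (intro integrable_mult_right integrable_real_indicator) auto
    qed (use bf C in \<open>auto simp: indicator_def\<close>)
    then show ?thesis by simp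
  qed
  have "AE x in lborel. u (x + w) - u x - L x = 0"
  proof (rule AE_zero_if_box_bumps_zero)
    fix x
    show "\<bar>u (x + w) - u x - L x\<bar> \<le> 2 * B + C"
      using bu[of "x + w"] bu[of x] L_le[of x] by linarith
  next
    fix a c :: 'a and n
    define \<phi> where "\<phi> = box_bump a c n"
    have [measurable]: "\<phi> \<in> borel_measurable borel" by (simp add: \<phi>_def)
    obtain \<phi>' D where d: "\<And>x. (\<phi> has_derivative \<phi>' x) (at x)"
      and cont: "\<And>v. continuous_on UNIV (\<lambda>x. \<phi>' x v)"
      and out: "\<And>x v. x \<notin> cbox a c \<Longrightarrow> \<phi>' x v = 0"
      and bd: "\<And>x v. \<bar>\<phi>' x v\<bar> \<le> D v"
      using box_bump_derivative unfolding \<phi>_def by blast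
    have [measurable]: "(\<lambda>x. \<phi>' x w) \<in> borel_measurable borel"
      using cont by (rule borel_measurable_continuous_onI)
    have D: "0 \<le> D w" using bd[of 0 w] by linarith
    obtain R where R: "cbox a c \<subseteq> cball 0 R"
      using bounded_subset_ballD[OF bounded_cbox[of a c], of 0] ball_subset_cball by (meson order_trans)
    have notin: "x \<notin> cbox a c" "x \<notin> box a c" if "norm x > R" for x
      using that R box_subset_cbox[of a c] by auto
    have \<phi>1: "\<bar>\<phi> x\<bar> \<le> 1" for x
      using box_bump_bounds[of a c n x] by (simp add: \<phi>_def)
    have \<phi>0: "\<phi> x = 0" if "norm x > R" for x
      using notin(2)[OF that] by (simp add: \<phi>_def box_bump_outside)
    have \<phi>'0: "\<phi>' x v = 0" if "norm x > R" for x v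
      using notin(1)[OF that] by (rule out)
    have near: "norm (x - s *\<^sub>R w) > R" if "\<not> norm x \<le> R + norm w" "s \<in> {0..1}" for x s
    proof -
      have "norm (s *\<^sub>R w) \<le> norm w" using that by (auto intro: mult_left_le_one_le)
      then show ?thesis using that norm_triangle_ineq2[of x "s *\<^sub>R w"] by linarith
    qed
    define K where "K = cball (0::'a) (R + norm w) \<times> {0..1::real}"
    have bK: "bounded K" "bounded (cball (0::'a) (R + norm w))"
      unfolding K_def by (auto intro: bounded_Times)
    have int1: "integrable (lborel \<Otimes>\<^sub>M lborel) (\<lambda>(x, s). u x * (indicator {0..1} s * \<phi>' (x - s *\<^sub>R w) w))"
      unfolding lborel_prod
    proof (rule integrable_bounded_support[where B = "B * D w" and A = K])
      fix p :: "'a \<times> real"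
      show "\<bar>case p of (x, s) \<Rightarrow> u x * (indicator {0..1} s * \<phi>' (x - s *\<^sub>R w) w)\<bar> \<le> B * D w"
        using mult_mono[OF bu bd B] B D
        by (auto simp: abs_mult indicator_def split: prod.split)
      show "(case p of (x, s) \<Rightarrow> u x * (indicator {0..1} s * \<phi>' (x - s *\<^sub>R w) w)) = 0" if "p \<notin> K"
      proof (cases p)
        case (Pair x s)
        with that consider "\<not> norm x \<le> R + norm w" "s \<in> {0..1}" | "s \<notin> {0..1}"
          by (auto simp: K_def Pair)
        then show ?thesis
          by cases (simp_all add: Pair \<phi>'0 near)
      qed
      show "(\<lambda>(x, s). u x * (indicator {0..1} s * \<phi>' (x - s *\<^sub>R w) w)) \<in> borel_measurable borel"
        unfolding borel_prod[symmetric] by measurable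
    qed (rule bK)
    have int2: "integrable (lborel \<Otimes>\<^sub>M lborel) (\<lambda>(x, s). (indicator {0..1} s * f (x + s *\<^sub>R w)) * \<phi> x)"
      unfolding lborel_prod
    proof (rule integrable_bounded_support[where B = C and A = K])
      fix p :: "'a \<times> real"
      show "\<bar>case p of (x, s) \<Rightarrow> (indicator {0..1} s * f (x + s *\<^sub>R w)) * \<phi> x\<bar> \<le> C"
        using mult_mono[OF bf \<phi>1 C] C
        by (auto simp: abs_mult indicator_def split: prod.split)
      show "(case p of (x, s) \<Rightarrow> (indicator {0..1} s * f (x + s *\<^sub>R w)) * \<phi> x) = 0" if "p \<notin> K"
      proof (cases p)
        case (Pair x s)
        have "R < norm x" if "\<not> norm x \<le> R + norm w"
          using that norm_ge_zero[of w] by linarith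
        with that Pair consider "norm x > R" | "s \<notin> {0..1}"
          by (auto simp: K_def)
        then show ?thesis
          by cases (simp_all add: Pair \<phi>0)
      qed
      show "(\<lambda>(x, s). (indicator {0..1} s * f (x + s *\<^sub>R w)) * \<phi> x) \<in> borel_measurable borel"
        unfolding borel_prod[symmetric] by measurable
    qed (rule bK)
    have bump_s: "box_bump (a + s *\<^sub>R w) (c + s *\<^sub>R w) n = (\<lambda>x. \<phi> (x - s *\<^sub>R w))" for s
      unfolding \<phi>_def box_bump_translate ..
    have fd: "frechet_derivative (\<lambda>x. \<phi> (x - s *\<^sub>R w)) (at x) w = \<phi>' (x - s *\<^sub>R w) w" for s x
    proof -
      have "((\<lambda>x. \<phi> (x - s *\<^sub>R w)) has_derivative \<phi>' (x - s *\<^sub>R w)) (at x)"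
        by (rule has_derivative_compose[OF _ d]) (auto intro!: derivative_eq_intros)
      then show ?thesis by (simp add: frechet_derivative_at[symmetric])
    qed
    have ftc: "\<phi> x - \<phi> (x - w) = (LBINT s. indicator {0..1} s * \<phi>' (x - s *\<^sub>R w) w)" for x
    proof -
      have deriv: "((\<lambda>s. - \<phi> (x - s *\<^sub>R w)) has_real_derivative \<phi>' (x - s *\<^sub>R w) w) (at s)" for s
      proof -
        have lin: "linear (\<phi>' (x - s *\<^sub>R w))"
          using d by (rule has_derivative_linear)
        have scale: "\<phi>' (x - s *\<^sub>R w) (- (h *\<^sub>R w)) = - (h * \<phi>' (x - s *\<^sub>R w) w)" for h
          by (simp only: linear_neg[OF lin] linear_scale[OF lin] real_scaleR_def)
        have "((\<lambda>s. x - s *\<^sub>R w) has_derivative (\<lambda>h. - (h *\<^sub>R w))) (at s)"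
          by (auto intro!: derivative_eq_intros)
        from has_derivative_minus[OF has_derivative_compose[OF this d]]
        show ?thesis
          by (simp add: scale has_field_derivative_def mult.commute[of _ "\<phi>' _ _"])
      qed
      have cs: "continuous_on UNIV (\<lambda>s. \<phi>' (x - s *\<^sub>R w) w)"
        by (rule continuous_on_compose2[OF cont]) (auto intro!: continuous_intros)
      have "(LBINT s. \<phi>' (x - s *\<^sub>R w) w * indicator {0..1} s) = - \<phi> (x - 1 *\<^sub>R w) - - \<phi> (x - 0 *\<^sub>R w)"
        by (rule integral_FTC_Icc_real) (use deriv cs in \<open>auto simp: continuous_on_eq_continuous_at\<close>)
      then show ?thesis by (simp add: mult.commute)
    qed
    have "(LBINT x. (u (x + w) - u x) * \<phi> x) = (LBINT x. L x * \<phi> x)"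
    proof -
      have i1: "integrable lborel (\<lambda>x. u (x + w) * \<phi> x)" "integrable lborel (\<lambda>x. u x * \<phi> x)"
        "integrable lborel (\<lambda>x. u x * \<phi> (x - w))"
      proof -
        have "integrable lborel (\<lambda>x. v x * \<psi> x)"
          if [measurable]: "v \<in> borel_measurable borel" "\<psi> \<in> borel_measurable borel"
            and v: "\<And>x. \<bar>v x\<bar> \<le> B" and \<psi>: "\<And>x. \<bar>\<psi> x\<bar> \<le> 1"
              "\<And>x. x \<notin> cball 0 (R + norm w) \<Longrightarrow> \<psi> x = 0" for v \<psi> :: "'a \<Rightarrow> real"
        proof (rule integrable_bounded_support[where B = B and A = "cball 0 (R + norm w)"])
          show "\<bar>v x * \<psi> x\<bar> \<le> B" for x
            using mult_mono[OF v \<psi>(1) B, of x x] by (simp add: abs_mult)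
        qed (simp_all add: \<psi>)
        moreover have "\<phi> x = 0" "\<phi> (x - w) = 0" if "x \<notin> cball 0 (R + norm w)" for x
        proof -
          have *: "\<not> norm x \<le> R + norm w" using that by simp
          then show "\<phi> x = 0" using norm_ge_zero[of w] by (intro \<phi>0) linarith
          show "\<phi> (x - w) = 0" using near[OF *, of 1] by (intro \<phi>0) simp
        qed
        ultimately show "integrable lborel (\<lambda>x. u (x + w) * \<phi> x)"
          "integrable lborel (\<lambda>x. u x * \<phi> x)" "integrable lborel (\<lambda>x. u x * \<phi> (x - w))"
          using bu \<phi>1 by simp_all
      qed
      have "(LBINT x. (u (x + w) - u x) * \<phi> x)
          = (LBINT x. u (x + w) * \<phi> x) - (LBINT x. u x * \<phi> x)"
        using i1 by (simp add: left_diff_distrib)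
      also have "(LBINT x. u (x + w) * \<phi> x) = (LBINT x. u x * \<phi> (x - w))"
        using lborel_translate(1)[of "\<lambda>x. u x * \<phi> (x - w)" w] by simp
      also have "\<dots> - (LBINT x. u x * \<phi> x)
          = - (LBINT x. LBINT s. u x * (indicator {0..1} s * \<phi>' (x - s *\<^sub>R w) w))"
        using i1 by (simp add: ftc[symmetric] right_diff_distrib)
      also have "\<dots> = - (LBINT s. LBINT x. u x * (indicator {0..1} s * \<phi>' (x - s *\<^sub>R w) w))"
        using lborel_pair.Fubini_integral[OF int1] by simp
      also have "\<dots> = (LBINT s. LBINT x. (indicator {0..1} s * f (x + s *\<^sub>R w)) * \<phi> x)"
      proof -
        have "(LBINT x. u x * (indicator {0..1} s * \<phi>' (x - s *\<^sub>R w) w))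
           = - (LBINT x. (indicator {0..1} s * f (x + s *\<^sub>R w)) * \<phi> x)" for s
        proof -
          have "(LBINT x. u x * \<phi>' (x - s *\<^sub>R w) w) = - (LBINT x. f x * \<phi> (x - s *\<^sub>R w))"
            using weak[of "a + s *\<^sub>R w" "c + s *\<^sub>R w" n] by (simp add: bump_s fd)
          also have "(LBINT x. f x * \<phi> (x - s *\<^sub>R w)) = (LBINT x. f (x + s *\<^sub>R w) * \<phi> x)"
            using lborel_translate(1)[of "\<lambda>x. f x * \<phi> (x - s *\<^sub>R w)" "s *\<^sub>R w"] by simp
          finally show ?thesis by (simp add: indicator_def mult.commute[of "f _"])
        qed
        then show ?thesis by simp
      qed
      also have "\<dots> = (LBINT x. LBINT s. (indicator {0..1} s * f (x + s *\<^sub>R w)) * \<phi> x)"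
        using lborel_pair.Fubini_integral[OF int2] by simp
      also have "\<dots> = (LBINT x. L x * \<phi> x)"
        by (simp add: L_def)
      finally show ?thesis .
    qed
    moreover have "integrable lborel (\<lambda>x. (u (x + w) - u x) * \<phi> x)"
    proof (rule integrable_bounded_support[where B = "2 * B" and A = "cball 0 R"])
      show "\<bar>(u (x + w) - u x) * \<phi> x\<bar> \<le> 2 * B" for x
      proof -
        have "\<bar>u (x + w) - u x\<bar> \<le> 2 * B" using bu[of "x + w"] bu[of x] by linarith
        from mult_mono[OF this \<phi>1, of x] B show ?thesis by (simp add: abs_mult)
      qed
    qed (use \<phi>0 in \<open>auto simp: not_le\<close>)
    moreover have "integrable lborel (\<lambda>x. L x * \<phi> x)"
    proof (rule integrable_bounded_support[where B = C and A = "cball 0 R"])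
      show "\<bar>L x * \<phi> x\<bar> \<le> C" for x
        using mult_mono[OF L_le \<phi>1 C, of x x] by (simp add: abs_mult)
    qed (use \<phi>0 in \<open>auto simp: not_le\<close>)
    ultimately show "(LBINT x. (u (x + w) - u x - L x) * box_bump a c n x) = 0"
      by (simp add: \<phi>_def[symmetric] left_diff_distrib[of _ "L _"])
  qed simp
  then show ?thesis by (simp add: L_def)
qed

lemma AE_imp_ex_in_open:
  fixes U :: "'b::euclidean_space set"
  assumes "AE x in lborel. P x" "open U" "U \<noteq> {}"
  shows "\<exists>x\<in>U. P x"
proof (rule ccontr)
  assume "\<not> ?thesis"
  moreover obtain N where N: "N \<in> null_sets lborel" "{x. \<not> P x} \<subseteq> N"
    using assms(1) by (auto simp: eventually_ae_filter)
  ultimately have "U \<subseteq> N" by blast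
  moreover have "negligible N"
    using N(1) by (simp add: negligible_iff_null_sets null_sets_completionI)
  ultimately have "negligible U"
    using negligible_subset by blast
  then show False
    using open_not_negligible assms by blast
qed

lemma AE_lborel_commute:
  fixes P :: "'b::euclidean_space \<Rightarrow> 'c::euclidean_space \<Rightarrow> bool"
  assumes "AE x in lborel. AE y in lborel. P x y" "Measurable.pred (borel \<Otimes>\<^sub>M borel) (\<lambda>(x, y). P x y)"
  shows "AE y in lborel. AE x in lborel. P x y"
proof -
  have "{z \<in> space (lborel \<Otimes>\<^sub>M lborel). case z of (x, y) \<Rightarrow> P x y} \<in> sets (lborel \<Otimes>\<^sub>M lborel)"
    using assms(2) by (simp add: pred_def space_pair_measure cong: sets_pair_measure_cong)
  then show ?thesis
    using lborel_pair.AE_commute[of P] assms(1) by (simp add: case_prod_unfold)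
qed

text \<open>
  By Fubini, for almost all \<open>x\<close> the Lipschitz estimate holds between \<open>x\<close> and almost all other points.
  Two such points \<open>x\<close>, \<open>y\<close> can be compared through a third point arbitrarily close to \<open>x\<close>, so \<open>u\<close> is
  Lipschitz on a set of full measure and extends from there by uniform continuity.
\<close>

lemma continuous_representative:
  fixes u :: "'a::euclidean_space \<Rightarrow> real"
  assumes [measurable]: "u \<in> borel_measurable borel"
    and L: "0 \<le> L" and lip: "\<And>w. AE x in lborel. \<bar>u (x + w) - u x\<bar> \<le> L * norm w"
  shows "\<exists>v. continuous_on UNIV v \<and> (AE x in lborel. u x = v x)"
proof -
  define G where "G = {x. AE w in lborel. \<bar>u (x + w) - u x\<bar> \<le> L * norm w}"
  have AE_G: "AE x in lborel. x \<in> G"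
    unfolding G_def mem_Collect_eq
    by (rule AE_lborel_commute) (use lip in \<open>auto intro!: AE_I2\<close>)
  have lip_G: "\<bar>u x - u y\<bar> \<le> L * dist x y" if "x \<in> G" "y \<in> G" for x y
  proof (rule field_le_epsilon)
    fix \<epsilon> :: real assume "\<epsilon> > 0"
    define \<delta> where "\<delta> = \<epsilon> / (2 * (L + 1))"
    have "\<delta> > 0" using \<open>\<epsilon> > 0\<close> L by (simp add: \<delta>_def)
    have "AE w in lborel. \<bar>u (x + w) - u x\<bar> \<le> L * norm w"
      using that by (simp add: G_def)
    moreover have "AE w in lborel. \<bar>u (y + (w + (x - y))) - u y\<bar> \<le> L * norm (w + (x - y))"
      using that by (intro AE_lborel_translate) (simp add: G_def)
    ultimately have "AE w in lborel. \<bar>u x - u y\<bar> \<le> L * norm w + L * norm (w + (x - y))"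
      by eventually_elim (simp add: algebra_simps)
    from AE_imp_ex_in_open[OF this, of "ball 0 \<delta>"] \<open>\<delta> > 0\<close> obtain w
      where w: "norm w < \<delta>" "\<bar>u x - u y\<bar> \<le> L * norm w + L * norm (w + (x - y))"
      by auto
    have "L * norm (w + (x - y)) \<le> L * norm w + L * dist x y"
      using mult_left_mono[OF norm_triangle_ineq[of w "x - y"] L] by (simp add: dist_norm algebra_simps)
    moreover have "2 * (L * norm w) \<le> \<epsilon>"
    proof -
      have "2 * (L * norm w) \<le> 2 * ((L + 1) * \<delta>)"
        using w L by (intro mult_left_mono mult_mono) auto
      moreover have "2 * ((L + 1) * \<delta>) = \<epsilon>" using L by (simp add: \<delta>_def field_simps)
      ultimately show ?thesis by linarith
    qed
    ultimately show "\<bar>u x - u y\<bar> \<le> L * dist x y + \<epsilon>"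
      using w by linarith
  qed
  have "uniformly_continuous_on G u"
    by (rule lipschitz_on_uniformly_continuous[of L])
       (use lip_G L in \<open>auto simp: lipschitz_on_def dist_real_def\<close>)
  then obtain v where "uniformly_continuous_on (closure G) v" "\<And>x. x \<in> G \<Longrightarrow> u x = v x"
    using uniformly_continuous_on_extension_on_closure by metis
  moreover have "closure G = UNIV"
  proof (rule ccontr)
    assume "closure G \<noteq> UNIV"
    then have "open (- closure G)" "- closure G \<noteq> {}" by auto
    from AE_imp_ex_in_open[OF AE_G this] show False
      using closure_subset by blast
  qed
  ultimately show ?thesis
    using AE_G by (intro exI[of _ v]) (auto intro: uniformly_continuous_imp_continuous)
qed

lemma bounded_borel_interval_integral:
  fixes F :: "real \<Rightarrow> real"
  assumes [measurable]: "F \<in> borel_measurable borel" and bd: "\<And>s. s \<in> {a..b} \<Longrightarrow> \<bar>F s\<bar> \<le> B"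
  shows "F integrable_on {a..b}"
    and "integrable lborel (\<lambda>s. indicator {a..b} s * F s)"
    and "integral {a..b} F = (LBINT s. indicator {a..b} s * F s)"
    and "a \<le> b \<Longrightarrow> \<bar>integral {a..b} F\<bar> \<le> B * (b - a)"
proof -
  show i: "integrable lborel (\<lambda>s. indicator {a..b} s * F s)"
  proof (rule integrable_bounded_support[where B = "\<bar>B\<bar>" and A = "{a..b}"])
    show "\<bar>indicator {a..b} s * F s\<bar> \<le> \<bar>B\<bar>" for s
      using bd[of s] by (auto simp: indicator_def)
  qed auto
  then have si: "set_integrable lborel {a..b} F"
    by (simp add: set_integrable_def)
  show Fi: "F integrable_on {a..b}"
    by (rule set_borel_integral_eq_integral[OF si])
  show "\<bar>integral {a..b} F\<bar> \<le> B * (b - a)" if "a \<le> b"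
  proof -
    have "norm (integral {a..b} F) \<le> integral {a..b} (\<lambda>s. B)"
      using bd by (intro integral_norm_bound_integral Fi integrable_const_ivl) simp
    then show ?thesis using that by (simp add: mult.commute)
  qed
  show "integral {a..b} F = (LBINT s. indicator {a..b} s * F s)"
    using set_borel_integral_eq_integral(2)[OF si] by (simp add: set_lebesgue_integral_def)
qed

lemma bounded_borel_line_integral:
  fixes F :: "real \<Rightarrow> real"
  assumes "F \<in> borel_measurable borel" and "\<And>s. \<bar>F s\<bar> \<le> B"
  shows "F integrable_on {a..b}"
    and "integrable lborel (\<lambda>s. indicator {a..b} s * F s)"
    and "integral {a..b} F = (LBINT s. indicator {a..b} s * F s)"
    and "a \<le> b \<Longrightarrow> \<bar>integral {a..b} F\<bar> \<le> B * (b - a)"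
  using bounded_borel_interval_integral[of F a b B] assms by blast+

lemma AE_all_on_line:
  fixes e :: "'b::euclidean_space"
  assumes "AE x in lborel. P x" "Measurable.pred borel P"
  shows "AE x in lborel. AE s in lborel. P (x + s *\<^sub>R (e::'b))"
proof (rule AE_lborel_commute)
  show "AE s in lborel. AE x in lborel. P (x + s *\<^sub>R e)"
    by (intro AE_I2 AE_lborel_translate assms)
  note [measurable] = assms(2)
  show "Measurable.pred (borel \<Otimes>\<^sub>M borel) (\<lambda>(s, x). P (x + s *\<^sub>R e))"
    by measurable
qed

lemma integral_unit_rescale:
  fixes F :: "real \<Rightarrow> real"
  assumes [measurable]: "F \<in> borel_measurable borel" and bd: "\<And>s. \<bar>F s\<bar> \<le> B" and "0 \<le> t"
  shows "(LBINT s. indicator {0..1} s * (t * F (a + s * t))) = integral {a..a + t} F"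
proof (cases "t = 0")
  case False
  with \<open>0 \<le> t\<close> have "t > 0" by simp
  have "integral {a..a + t} F = (LBINT s. indicator {a..a + t} s * F s)"
    by (rule bounded_borel_line_integral(3)[OF _ bd]) simp
  also have "\<dots> = \<bar>t\<bar> *\<^sub>R (LBINT s. indicator {a..a + t} (a + t * s) * F (a + t * s))"
    using False by (rule lborel_integral_real_affine)
  also have "\<dots> = (LBINT s. indicator {0..1} s * (t * F (a + s * t)))"
  proof -
    have "indicator {a..a + t} (a + t * s) = (indicator {0..1} s :: real)" for s
      using \<open>t > 0\<close> by (auto simp: indicator_def zero_le_mult_iff mult_le_cancel_left1)
    then show ?thesis
      using \<open>t > 0\<close> by (simp add: mult.commute mult.left_commute)
  qed
  finally show ?thesis by simp
qed simp

lemma integral_interval_perturb: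
  fixes F :: "real \<Rightarrow> real"
  assumes [measurable]: "F \<in> borel_measurable borel" and bd: "\<And>s. \<bar>F s\<bar> \<le> B"
    and "a \<le> a'" "b \<le> b'" "a' \<le> b'" "a \<le> b"
  shows "\<bar>integral {a..b} F - integral {a'..b'} F\<bar> \<le> B * (a' - a) + B * (b' - b)"
proof -
  note i = bounded_borel_line_integral(1)[OF assms(1) bd]
  note l = bounded_borel_line_integral(4)[OF assms(1) bd]
  have "integral {a..b} F + integral {b..b'} F = integral {a..b'} F"
    using assms by (intro Henstock_Kurzweil_Integration.integral_combine i) auto
  moreover have "integral {a..a'} F + integral {a'..b'} F = integral {a..b'} F"
    using assms by (intro Henstock_Kurzweil_Integration.integral_combine i) auto
  ultimately have "integral {a..b} F - integral {a'..b'} F = integral {a..a'} F - integral {b..b'} F"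
    by linarith
  then show ?thesis
    using l[of a a'] l[of b b'] assms by linarith
qed

text \<open>
  The exceptional null set of the line identity depends on the two end points. Countably many
  rational end points share a null set, and both sides depend continuously on the end points, which
  gives all real ones.
\<close>

lemma stationary_representative:
  fixes \<rho>\<^sub>0 :: "'a::euclidean_space \<Rightarrow> real" and g :: "'a \<Rightarrow> 'a"
  assumes [measurable]: "\<rho>\<^sub>0 \<in> borel_measurable borel" "g \<in> borel_measurable borel"
    and \<rho>0: "\<And>x. 0 \<le> \<rho>\<^sub>0 x" "\<And>x. \<rho>\<^sub>0 x \<le> M" and g: "\<And>x. norm (g x) \<le> B" and "0 < m"
    and weak: "\<And>a c n w. (LBINT x. \<rho>\<^sub>0 x powr m * frechet_derivative (box_bump a c n) (at x) w)
                 = (LBINT x. \<rho>\<^sub>0 x * (g x \<bullet> w) * box_bump a c n x)"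
  shows "\<exists>\<rho>. continuous_on UNIV \<rho> \<and> (\<forall>x. 0 \<le> \<rho> x) \<and> (\<forall>x. \<rho> x \<le> M) \<and> (AE x in lborel. \<rho>\<^sub>0 x = \<rho> x) \<and>
    (\<forall>e. AE x in lborel. \<forall>a b. a \<le> b \<longrightarrow> \<rho> (x + b *\<^sub>R e) powr m - \<rho> (x + a *\<^sub>R e) powr m
        = - integral {a..b} (\<lambda>s. \<rho> (x + s *\<^sub>R e) * (g (x + s *\<^sub>R e) \<bullet> e)))"
proof -
  have M: "0 \<le> M" using \<rho>0[of 0] by linarith
  have B: "0 \<le> B" using g[of 0] norm_ge_zero[of "g 0"] by linarith
  have gw: "\<bar>r * (g x \<bullet> w)\<bar> \<le> M * (B * norm w)" if "0 \<le> r" "r \<le> M" for r x w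
  proof -
    have "\<bar>g x \<bullet> w\<bar> \<le> B * norm w"
      using Cauchy_Schwarz_ineq2[of "g x" w] mult_right_mono[OF g norm_ge_zero[of w]] by (rule order_trans)
    then show ?thesis using that M by (simp add: abs_mult mult_mono)
  qed
  have fund: "AE x in lborel. \<rho>\<^sub>0 (x + w) powr m - \<rho>\<^sub>0 x powr m
      = (LBINT s. indicator {0..1} s * - (\<rho>\<^sub>0 (x + s *\<^sub>R w) * (g (x + s *\<^sub>R w) \<bullet> w)))" for w
  proof (rule weak_derivative_imp_line_integral[where B = "M powr m" and C = "M * (B * norm w)"])
    show "\<bar>\<rho>\<^sub>0 x powr m\<bar> \<le> M powr m" for x
      using \<rho>0 \<open>0 < m\<close> by (simp add: powr_mono2)
    show "\<bar>- (\<rho>\<^sub>0 x * (g x \<bullet> w))\<bar> \<le> M * (B * norm w)" for x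
      using gw[OF \<rho>0] by simp
  qed (simp_all add: weak)
  have "AE x in lborel. \<bar>\<rho>\<^sub>0 (x + w) powr m - \<rho>\<^sub>0 x powr m\<bar> \<le> M * B * norm w" for w
    using fund[of w]
  proof eventually_elim
    case (elim x)
    have "\<bar>\<integral>s. indicator {0..1} s * - (\<rho>\<^sub>0 (x + s *\<^sub>R w) * (g (x + s *\<^sub>R w) \<bullet> w)) \<partial>lborel\<bar>
       = \<bar>integral {0..1} (\<lambda>s. - (\<rho>\<^sub>0 (x + s *\<^sub>R w) * (g (x + s *\<^sub>R w) \<bullet> w)))\<bar>"
      using gw[OF \<rho>0] by (subst bounded_borel_line_integral(3)[where B = "M * (B * norm w)"]) auto
    also have "\<dots> \<le> M * (B * norm w) * (1 - 0)"
      using gw[OF \<rho>0] by (intro bounded_borel_line_integral(4)) auto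
    finally show ?case using elim by simp
  qed
  then obtain v where v: "continuous_on UNIV v" "AE x in lborel. \<rho>\<^sub>0 x powr m = v x"
    using continuous_representative[of "\<lambda>x. \<rho>\<^sub>0 x powr m" "M * B"] M B by auto
  define \<rho> where "\<rho> x = min M (max 0 (v x) powr (1 / m))" for x
  have cont: "continuous_on UNIV \<rho>"
    unfolding \<rho>_def using v(1) \<open>0 < m\<close> by (auto intro!: continuous_intros continuous_on_powr')
  have [measurable]: "\<rho> \<in> borel_measurable borel"
    using cont by (rule borel_measurable_continuous_onI)
  have nonneg: "0 \<le> \<rho> x" and le_M: "\<rho> x \<le> M" for x
    using M by (simp_all add: \<rho>_def)
  have AE_eq: "AE x in lborel. \<rho>\<^sub>0 x = \<rho> x"
    using v(2)
  proof eventually_elim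
    case (elim x)
    then have "max 0 (v x) = \<rho>\<^sub>0 x powr m" by (metis max.absorb2 powr_ge_zero)
    then have "max 0 (v x) powr (1 / m) = \<rho>\<^sub>0 x"
      using \<rho>0(1) \<open>0 < m\<close> by (simp add: powr_powr)
    then show ?case using \<rho>0(2)[of x] by (simp add: \<rho>_def)
  qed
  have "AE x in lborel. \<forall>a b. a \<le> b \<longrightarrow> \<rho> (x + b *\<^sub>R e) powr m - \<rho> (x + a *\<^sub>R e) powr m
        = - integral {a..b} (\<lambda>s. \<rho> (x + s *\<^sub>R e) * (g (x + s *\<^sub>R e) \<bullet> e))" for e
  proof -
    define F where "F x s = \<rho> (x + s *\<^sub>R e) * (g (x + s *\<^sub>R e) \<bullet> e)" for x s
    define K where "K = M * (B * norm e)"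
    have [measurable]: "F x \<in> borel_measurable borel" for x
      unfolding F_def by measurable
    have F: "\<bar>F x s\<bar> \<le> K" for x s
      unfolding F_def K_def by (rule gw[OF nonneg le_M])
    have K: "0 \<le> K" using M B by (simp add: K_def)
    have line: "AE x in lborel. \<rho> (x + t *\<^sub>R e) powr m - \<rho> x powr m = - integral {0..t} (F x)"
      if "0 \<le> t" for t
    proof -
      have "AE x in lborel. AE s in lborel. \<rho>\<^sub>0 (x + s *\<^sub>R (t *\<^sub>R e)) = \<rho> (x + s *\<^sub>R (t *\<^sub>R e))"
        by (rule AE_all_on_line[OF AE_eq]) measurable
      moreover have "AE x in lborel. \<rho>\<^sub>0 (x + t *\<^sub>R e) = \<rho> (x + t *\<^sub>R e)"
        by (rule AE_lborel_translate[OF AE_eq])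
      ultimately show ?thesis
        using fund[of "t *\<^sub>R e"] AE_eq
      proof eventually_elim
        case (elim x)
        have "(LBINT s. indicator {0..1} s * - (\<rho>\<^sub>0 (x + s *\<^sub>R t *\<^sub>R e) * (g (x + s *\<^sub>R t *\<^sub>R e) \<bullet> t *\<^sub>R e)))
            = (LBINT s. - (indicator {0..1} s * (t * F x (0 + s * t))))"
        proof (rule integral_cong_AE)
          show "AE s in lborel. indicator {0..1} s * - (\<rho>\<^sub>0 (x + s *\<^sub>R t *\<^sub>R e) * (g (x + s *\<^sub>R t *\<^sub>R e) \<bullet> t *\<^sub>R e))
             = - (indicator {0..1} s * (t * F x (0 + s * t)))"
            using elim(1) by eventually_elim (simp add: F_def)
        qed simp_all
        also have "\<dots> = - integral {0..0 + t} (F x)"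
          using integral_unit_rescale[where F = "F x" and a = 0, OF _ F that] by simp
        finally show ?case using elim by simp
      qed
    qed
    have "AE x in lborel. \<forall>(a::rat) (t::rat). 0 \<le> t \<longrightarrow>
        \<rho> (x + of_rat (a + t) *\<^sub>R e) powr m - \<rho> (x + of_rat a *\<^sub>R e) powr m
          = - integral {of_rat a..of_rat (a + t)} (F x)"
    proof (intro AE_all_countable[THEN iffD2] allI)
      fix a t :: rat
      show "AE x in lborel. 0 \<le> t \<longrightarrow>
        \<rho> (x + of_rat (a + t) *\<^sub>R e) powr m - \<rho> (x + of_rat a *\<^sub>R e) powr m
          = - integral {of_rat a..of_rat (a + t)} (F x)"
      proof (cases "0 \<le> t")
        case True
        then have t: "0 \<le> (of_rat t :: real)" by simp
        from AE_lborel_translate[OF line[OF t], of "of_rat a *\<^sub>R e"]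
        show ?thesis
        proof eventually_elim
          case (elim x)
          have "integral {0..of_rat t} (F (x + of_rat a *\<^sub>R e))
              = (LBINT s. indicator {0..1} s * (of_rat t * F (x + of_rat a *\<^sub>R e) (0 + s * of_rat t)))"
            using integral_unit_rescale[where F = "F (x + of_rat a *\<^sub>R e)" and a = 0, OF _ F t] by simp
          also have "\<dots> = (LBINT s. indicator {0..1} s * (of_rat t * F x (of_rat a + s * of_rat t)))"
            by (simp add: F_def algebra_simps)
          also have "\<dots> = integral {of_rat a..of_rat a + of_rat t} (F x)"
            using integral_unit_rescale[where F = "F x", OF _ F t] by simp
          finally show ?case
            using elim by (simp add: of_rat_add algebra_simps)
        qed
      qed simp
    qed
    then show ?thesis
    proof eventually_elim
      case (elim x)
      define U where "U s = \<rho> (x + s *\<^sub>R e) powr m" for s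
      have "continuous_on UNIV (\<lambda>s. \<rho> (x + s *\<^sub>R e))"
        by (rule continuous_on_compose2[OF cont]) (auto intro!: continuous_intros)
      then have contU: "continuous_on UNIV U"
        unfolding U_def
        by (rule continuous_on_powr') (use nonneg \<open>0 < m\<close> in \<open>auto intro: continuous_on_const\<close>)
      have rat: "U (of_rat b) - U (of_rat a) = - integral {of_rat a..of_rat b} (F x)" if "a \<le> b" for a b :: rat
        using elim[rule_format, of "b - a" a] that by (simp add: U_def)
      have "U b - U a = - integral {a..b} (F x)" if "a < b" for a b
      proof -
        have "\<bar>U b - U a + integral {a..b} (F x)\<bar> \<le> 0 + \<epsilon>" if "\<epsilon> > 0" for \<epsilon>
        proof -
          define \<eta> where "\<eta> = \<epsilon> / (4 * (K + 1))"
          have \<eta>: "\<eta> > 0" "K * \<eta> \<le> \<epsilon> / 4"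
            using that K by (simp_all add: \<eta>_def field_simps)
          have "\<epsilon> / 4 > 0" using that by simp
          then obtain d1 d2 where d1: "d1 > 0" "\<And>s. \<bar>s - a\<bar> < d1 \<Longrightarrow> \<bar>U s - U a\<bar> < \<epsilon> / 4"
            and d2: "d2 > 0" "\<And>s. \<bar>s - b\<bar> < d2 \<Longrightarrow> \<bar>U s - U b\<bar> < \<epsilon> / 4"
            using contU unfolding continuous_on_iff dist_real_def by (metis UNIV_I)
          obtain a' where a': "a < of_rat a'" "of_rat a' < min b (a + min \<eta> d1)"
            using of_rat_dense[of a "min b (a + min \<eta> d1)"] \<eta> d1 \<open>a < b\<close> by auto
          obtain b' where b': "b < of_rat b'" "of_rat b' < b + min \<eta> d2"
            using of_rat_dense[of b "b + min \<eta> d2"] \<eta> d2 by auto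
          have ab: "(of_rat a' :: real) < of_rat b'" using a' b' by linarith
          then have "a' \<le> b'" by (simp add: of_rat_less)
          note rat[OF this]
          moreover have "\<bar>U (of_rat a') - U a\<bar> < \<epsilon> / 4"
            by (rule d1(2)) (use a' in linarith)
          moreover have "\<bar>U (of_rat b') - U b\<bar> < \<epsilon> / 4"
            by (rule d2(2)) (use b' in linarith)
          moreover have "\<bar>integral {a..b} (F x) - integral {of_rat a'..of_rat b'} (F x)\<bar>
              \<le> K * (of_rat a' - a) + K * (of_rat b' - b)"
            by (rule integral_interval_perturb[OF _ F]) (use a' b' ab \<open>a < b\<close> in auto)
          moreover have "K * (of_rat a' - a) \<le> K * \<eta>" "K * (of_rat b' - b) \<le> K * \<eta>"
            using a' b' K by (auto intro!: mult_left_mono)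
          ultimately show ?thesis using \<eta>(2) by linarith
        qed
        then have "\<bar>U b - U a + integral {a..b} (F x)\<bar> \<le> 0"
          by (rule field_le_epsilon)
        then show ?thesis by simp
      qed
      then have "U b - U a = - integral {a..b} (F x)" if "a \<le> b" for a b
        using that by (cases "a = b") auto
      then show ?case by (simp add: U_def F_def[abs_def])
    qed
  qed
  then show ?thesis
    using cont nonneg le_M AE_eq by blast
qed

section \<open>A stationary profile on one line\<close>

text \<open>
  Formally \<open>(f\<^sup>m)' = - f G\<close> means \<open>(\<Phi>(f\<^sup>m))' = - G\<close> for the primitive \<open>\<Phi>\<close> of \<open>y\<close> to the power
  \<open>-1/m\<close>, and \<open>f a = f b\<close> makes the integral of \<open>G\<close> vanish. As \<open>G\<close> is only measurable, the chain rule
  cannot be applied at every point. But the sum of \<open>\<Phi>(f\<^sup>m)\<close> and the primitive of \<open>G\<close> has derivative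
  \<open>0\<close> everywhere: by the mean value theorem its increments are integrals of
  \<open>(1 - f / z) G\<close>, where \<open>z\<close> lies between two values of \<open>f\<close> near by, and the factor \<open>1 - f / z\<close> is
  uniformly small on short intervals by continuity of \<open>f\<close>.
\<close>

lemma integral_log_derivative_zero:
  fixes f G :: "real \<Rightarrow> real"
  assumes "a \<le> b" "0 < m" "0 < h" and cont: "continuous_on {a..b} f"
    and pos: "\<And>t. t \<in> {a..b} \<Longrightarrow> h \<le> f t" and eq: "f a = f b"
    and [measurable]: "G \<in> borel_measurable borel" and bd: "\<And>t. \<bar>G t\<bar> \<le> B"
    and fG: "(\<lambda>r. f r * G r) integrable_on {a..b}"
    and incr: "\<And>s t. a \<le> s \<Longrightarrow> s \<le> t \<Longrightarrow> t \<le> b \<Longrightarrow>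
       f t powr m - f s powr m = - integral {s..t} (\<lambda>r. f r * G r)"
  shows "integral {a..b} G = 0"
proof -
  have B: "0 \<le> B" using bd[of 0] by linarith
  define \<Phi> where "\<Phi> y = (if m = 1 then ln y else y powr (1 - 1 / m) / (1 - 1 / m))" for y :: real
  have \<Phi>': "(\<Phi> has_real_derivative y powr (- 1 / m)) (at y)" if "y > 0" for y
  proof (cases "m = 1")
    case True
    then show ?thesis
      using that unfolding \<Phi>_def by (auto intro!: derivative_eq_intros simp: powr_minus_divide)
  next
    case False
    then have "1 - 1 / m \<noteq> 0" using \<open>0 < m\<close> by (simp add: field_simps)
    then have "((\<lambda>y. y powr (1 - 1 / m) / (1 - 1 / m)) has_real_derivative
        (1 - 1 / m) * y powr (1 - 1 / m - 1) / (1 - 1 / m)) (at y)"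
      by (intro DERIV_cdivide has_real_derivative_powr that)
    with False \<open>1 - 1 / m \<noteq> 0\<close> show ?thesis
      by (simp add: \<Phi>_def[abs_def])
  qed
  define D where "D t = \<Phi> (f t powr m) + integral {a..t} G" for t
  have step: "\<bar>D t - D s\<bar> \<le> 2 * \<eta> / h * B * (t - s)"
    if st: "a \<le> s" "s \<le> t" "t \<le> b" and near: "\<And>r. r \<in> {s..t} \<Longrightarrow> \<bar>f r - y0\<bar> \<le> \<eta>" for s t y0 \<eta>
  proof -
    have fpos: "0 < f r" if "r \<in> {a..b}" for r
      using pos[OF that] \<open>0 < h\<close> by linarith
    define y1 where "y1 = f s powr m"
    define y2 where "y2 = f t powr m"
    have y12: "0 < y1" "0 < y2" "y1 powr (1 / m) = f s" "y2 powr (1 / m) = f t"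
      using fpos[of s] fpos[of t] st \<open>0 < m\<close> by (auto simp: y1_def y2_def powr_powr)
    obtain y where y: "min y1 y2 \<le> y" "y \<le> max y1 y2" "\<Phi> y2 - \<Phi> y1 = y powr (- 1 / m) * (y2 - y1)"
    proof (cases "y1 = y2")
      case True
      then show ?thesis using that[of y1] by simp
    next
      case False
      have "\<exists>z>min y1 y2. z < max y1 y2 \<and>
        \<Phi> (max y1 y2) - \<Phi> (min y1 y2) = (max y1 y2 - min y1 y2) * z powr (- 1 / m)"
        using False y12 by (intro MVT2 \<Phi>') auto
      then obtain z where "z>min y1 y2" "z < max y1 y2"
        "\<Phi> (max y1 y2) - \<Phi> (min y1 y2) = (max y1 y2 - min y1 y2) * z powr (- 1 / m)" by blast
      then show ?thesis
        by (intro that[of z]) (auto simp: max_def min_def algebra_simps split: if_splits)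
    qed
    define z where "z = y powr (1 / m)"
    have ypos: "y > 0" using y y12 by linarith
    have zb: "min (f s) (f t) \<le> z" "z \<le> max (f s) (f t)"
    proof -
      have mono: "p powr (1 / m) \<le> q powr (1 / m)" if "0 < p" "p \<le> q" for p q :: real
        using that \<open>0 < m\<close> by (intro powr_mono2) auto
      show "min (f s) (f t) \<le> z"
        using y(1) mono[of y1 y] mono[of y2 y] y12 unfolding z_def by (cases "y1 \<le> y2") auto
      show "z \<le> max (f s) (f t)"
        using y(2) mono[of y y1] mono[of y y2] y12 ypos unfolding z_def by (cases "y1 \<le> y2") auto
    qed
    have zh: "h \<le> z" using zb pos[of s] pos[of t] st by (auto simp: min_def split: if_splits)
    have yz: "y powr (- 1 / m) = 1 / z"
      using ypos by (simp add: z_def powr_minus_divide)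
    have Gi: "G integrable_on {p..q}" for p q
      using bounded_borel_line_integral(1)[OF _ bd] by simp
    have fGi: "(\<lambda>r. f r * G r) integrable_on {s..t}"
      using fG st by (auto intro: integrable_subinterval_real)
    have "integral {a..t} G - integral {a..s} G = integral {s..t} G"
      using Henstock_Kurzweil_Integration.integral_combine[OF st(1,2) Gi] by simp
    then have "D t - D s = (1 / z) * (f t powr m - f s powr m) + integral {s..t} G"
      using y(3) using yz by (simp add: D_def y1_def[symmetric] y2_def[symmetric])
    also have "\<dots> = integral {s..t} (\<lambda>r. G r - (1 / z) * (f r * G r))"
      using incr[OF st] fGi Gi integrable_on_mult_right[OF fGi, of "1 / z"]
      by (simp add: integral_diff)
    also have "\<bar>\<dots>\<bar> \<le> 2 * \<eta> / h * B * (t - s)"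
    proof -
      have "norm (G r - (1 / z) * (f r * G r)) \<le> 2 * \<eta> / h * B" if r: "r \<in> {s..t}" for r
      proof -
        have "\<bar>z - f r\<bar> \<le> 2 * \<eta>"
          using near[OF r] near[of s] near[of t] zb st by (auto simp: min_def max_def split: if_splits)
        then have "\<bar>z - f r\<bar> / z \<le> 2 * \<eta> / h"
          using zh \<open>0 < h\<close> by (intro frac_le) auto
        moreover have "G r - (1 / z) * (f r * G r) = (z - f r) / z * G r"
          using zh \<open>0 < h\<close> by (simp add: field_simps)
        moreover have "0 \<le> 2 * \<eta> / h"
          using calculation(1) zh \<open>0 < h\<close> by (smt (verit) divide_nonneg_pos)
        ultimately show ?thesis
          using mult_mono[of "\<bar>z - f r\<bar> / z" "2 * \<eta> / h" "\<bar>G r\<bar>" B] bd[of r] zh \<open>0 < h\<close>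
          by (simp add: abs_mult)
      qed
      moreover have "(\<lambda>r. G r - (1 / z) * (f r * G r)) integrable_on {s..t}"
        using integrable_diff[OF Gi integrable_on_mult_right[OF fGi]] .
      ultimately have "norm (integral {s..t} (\<lambda>r. G r - (1 / z) * (f r * G r)))
          \<le> integral {s..t} (\<lambda>r. 2 * \<eta> / h * B)"
        by (intro integral_norm_bound_integral integrable_const_ivl)
      then show ?thesis
        using st by (simp add: mult_ac)
    qed
    finally show ?thesis .
  qed
  have "(D has_real_derivative 0) (at t within {a..b})" if t: "t \<in> {a..b}" for t
  proof -
    have "\<exists>d>0. \<forall>s\<in>{a..b}. \<bar>s - t\<bar> < d \<longrightarrow> \<bar>D s - D t\<bar> \<le> \<epsilon> * \<bar>s - t\<bar>" if "\<epsilon> > 0" for \<epsilon>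
    proof -
      \<comment> \<open>the increment is at most \<open>(2 \<eta> / h) B\<close> times the step, and this has to be below \<open>\<epsilon>\<close>\<close>
      define q where "q = B + 1"
      define \<eta> where "\<eta> = \<epsilon> * h / (2 * q)"
      have q: "0 < q" "B \<le> q" using B by (simp_all add: q_def)
      then have "\<eta> > 0" using that \<open>0 < h\<close> by (simp add: \<eta>_def)
      then obtain d where "d > 0" and d: "\<And>r. r \<in> {a..b} \<Longrightarrow> \<bar>r - t\<bar> < d \<Longrightarrow> \<bar>f r - f t\<bar> \<le> \<eta>"
        using cont t unfolding continuous_on_iff dist_real_def by (meson less_imp_le)
      have le: "2 * \<eta> / h * B \<le> \<epsilon>"
      proof -
        have "2 * \<eta> / h * B = \<epsilon> * (B / q)"
          using \<open>0 < h\<close> q by (simp add: \<eta>_def)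
        also have "\<dots> \<le> \<epsilon> * 1"
          using that q by (intro mult_left_mono) auto
        finally show ?thesis by simp
      qed
      have "\<bar>D s - D t\<bar> \<le> \<epsilon> * \<bar>s - t\<bar>" if s: "s \<in> {a..b}" "\<bar>s - t\<bar> < d" for s
      proof (cases "s \<le> t")
        case True
        have "\<bar>D t - D s\<bar> \<le> 2 * \<eta> / h * B * (t - s)"
          using s t True by (intro step[of s t "f t"] d) auto
        also have "\<dots> \<le> \<epsilon> * (t - s)" using le True by (intro mult_right_mono) auto
        finally show ?thesis using True by (simp add: abs_minus_commute)
      next
        case False
        have "\<bar>D s - D t\<bar> \<le> 2 * \<eta> / h * B * (s - t)"
          using s t False by (intro step[of t s "f t"] d) auto
        also have "\<dots> \<le> \<epsilon> * (s - t)" using le False by (intro mult_right_mono) auto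
        finally show ?thesis using False by simp
      qed
      with \<open>d > 0\<close> show ?thesis by blast
    qed
    then have "(D has_derivative (\<lambda>h. 0)) (at t within {a..b})"
      unfolding has_derivative_within_alt by (auto simp: bounded_linear_zero)
    then show ?thesis
      by (simp add: has_field_derivative_def mult_zero_left[abs_def])
  qed
  then obtain c where "\<And>t. t \<in> {a..b} \<Longrightarrow> D t = c"
    using has_field_derivative_zero_constant[of "{a..b}" D] by auto
  then have "D a = D b" using \<open>a \<le> b\<close> by simp
  then show ?thesis by (simp add: D_def eq)
qed

section \<open>Radial vector fields and their convolutions\<close>

text \<open>
  On the dyadic shell of radius about \<open>1/2\<^sup>n\<close> the integrand is of order \<open>2\<^sup>n\<close> to the power \<open>d - 1\<close>, and
  the volume is of order \<open>2\<^sup>n\<close> to the power \<open>- d\<close>. The shells therefore contribute a geometric series.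
\<close>

lemma nn_integral_riesz_finite:
  "(\<integral>\<^sup>+z. ennreal (indicator (cball 0 1) z * norm z powi (1 - int DIM('a))) \<partial>(lborel :: 'a::euclidean_space measure)) < \<infinity>"
proof -
  let ?d = "DIM('a)"
  define V where "V = unit_ball_vol (real ?d)"
  have V: "0 \<le> V" by (simp add: V_def)
  define c where "c n = (2::real) ^ (Suc n * (?d - 1))" for n
  have le: "ennreal (indicator (cball 0 1) z * norm z powi (1 - int ?d))
     \<le> (\<Sum>n. ennreal (c n * indicator (cball 0 ((1/2) ^ n)) z))" if nz: "z \<noteq> 0" for z :: 'a
  proof (cases "norm z \<le> 1")
    case True
    define n where "n = (LEAST n. (1/2) ^ Suc n < norm z)"
    have ex: "\<exists>n. (1/2) ^ Suc n < norm z"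
    proof -
      obtain n where "(1/2) ^ n < norm z" using real_arch_pow_inv[of "norm z" "1/2"] nz by auto
      moreover have "(1/2 :: real) ^ Suc n \<le> (1/2) ^ n" by simp
      ultimately show ?thesis by (intro exI[of _ n]) linarith
    qed
    have n1: "(1/2) ^ Suc n < norm z" using LeastI_ex[OF ex] by (simp add: n_def)
    have n2: "norm z \<le> (1/2) ^ n"
    proof (cases n)
      case (Suc k)
      then have "\<not> (1/2) ^ Suc k < norm z"
        using not_less_Least[of k "\<lambda>n. (1/2) ^ Suc n < norm z"] by (simp add: n_def)
      then show ?thesis by (simp add: Suc)
    qed (use True in simp)
    have "norm z powi (1 - int ?d) = inverse (norm z ^ (?d - 1))"
      using DIM_positive[where 'a = 'a] by (simp add: power_int_def nat_diff_distrib power_inverse)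
    also have "\<dots> \<le> inverse (((1/2) ^ Suc n) ^ (?d - 1))"
      using n1 by (intro le_imp_inverse_le power_mono) auto
    also have "\<dots> = c n"
      by (simp only: c_def power_mult[symmetric] power_one_over inverse_eq_divide) simp
    finally have "norm z powi (1 - int ?d) \<le> c n" .
    then have "ennreal (indicator (cball 0 1) z * norm z powi (1 - int ?d))
        \<le> ennreal (c n * indicator (cball 0 ((1/2) ^ n)) z)"
      using n2 True by (intro ennreal_leI) simp
    also have "\<dots> \<le> (\<Sum>n. ennreal (c n * indicator (cball 0 ((1/2) ^ n)) z))"
      using sum_le_suminf[of "\<lambda>n. ennreal (c n * indicator (cball 0 ((1/2) ^ n)) z)" "{n}"] by simp
    finally show ?thesis .
  qed simp
  have "(\<integral>\<^sup>+z. ennreal (indicator (cball (0::'a) 1) z * norm z powi (1 - int ?d)) \<partial>lborel)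
      \<le> (\<integral>\<^sup>+z. (\<Sum>n. ennreal (c n * indicator (cball (0::'a) ((1/2) ^ n)) z)) \<partial>lborel)"
  proof (rule nn_integral_mono_AE)
    have "AE z in lborel. z \<noteq> (0::'a)" by (rule AE_lborel_singleton)
    then show "AE z in lborel. ennreal (indicator (cball 0 1) z * norm z powi (1 - int ?d))
        \<le> (\<Sum>n. ennreal (c n * indicator (cball (0::'a) ((1/2) ^ n)) z))"
      by eventually_elim (rule le)
  qed
  also have "\<dots> = (\<Sum>n. \<integral>\<^sup>+z. ennreal (c n * indicator (cball (0::'a) ((1/2) ^ n)) z) \<partial>lborel)"
    by (intro nn_integral_suminf measurable_compose[OF _ measurable_ennreal] borel_measurable_times
          borel_measurable_const borel_measurable_indicator) simp
  also have "\<dots> = (\<Sum>n. ennreal (V * 2 ^ (?d - 1) * (1/2) ^ n))"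
  proof (rule suminf_cong)
    fix n
    have "(\<integral>\<^sup>+z. ennreal (c n * indicator (cball (0::'a) ((1/2) ^ n)) z) \<partial>lborel)
      = (\<integral>\<^sup>+z. ennreal (c n) * indicator (cball (0::'a) ((1/2) ^ n)) z \<partial>lborel)"
      by (intro nn_integral_cong) (auto simp: c_def indicator_def)
    also have "\<dots> = ennreal (c n) * emeasure lborel (cball (0::'a) ((1/2) ^ n))"
      by (subst nn_integral_cmult_indicator) auto
    also have "\<dots> = ennreal (c n * (V * ((1/2) ^ n) ^ ?d))"
      using V by (simp add: emeasure_cball V_def c_def flip: ennreal_mult'')
    also have "c n * (V * ((1/2) ^ n) ^ ?d) = V * 2 ^ (?d - 1) * (1/2) ^ n"
    proof -
      obtain k where k: "?d = Suc k" using DIM_positive[where 'a = 'a] gr0_implies_Suc by blast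
      have "(2::real) ^ (Suc n * k) * ((1/2) ^ n) ^ Suc k = 2 ^ k * (2 ^ (n * k) * (1/2) ^ (n * k)) * (1/2) ^ n"
        by (simp add: power_add power_mult[symmetric] mult_ac)
      also have "(2::real) ^ (n * k) * (1/2) ^ (n * k) = 1"
        by (simp add: power_one_over)
      finally show ?thesis by (simp add: c_def k mult_ac)
    qed
    finally show "(\<integral>\<^sup>+z. ennreal (c n * indicator (cball (0::'a) ((1/2) ^ n)) z) \<partial>lborel)
      = ennreal (V * 2 ^ (?d - 1) * (1/2) ^ n)" .
  qed
  also have "\<dots> < \<infinity>"
  proof -
    have "summable (\<lambda>n. V * 2 ^ (?d - 1) * (1/2) ^ n)"
      by (intro summable_mult summable_geometric) simp
    then show ?thesis
      using V by (subst suminf_ennreal2) auto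
  qed
  finally show ?thesis .
qed

definition radial_field :: "(real \<Rightarrow> real) \<Rightarrow> 'a::euclidean_space \<Rightarrow> 'a" where
  "radial_field f z = (f (norm z) / norm z) *\<^sub>R z"

lemma radial_field_minus: "radial_field f (- z) = - radial_field f z"
  by (simp add: radial_field_def)

lemma norm_radial_field: "z \<noteq> 0 \<Longrightarrow> norm (radial_field f z) = \<bar>f (norm z)\<bar>"
  by (simp add: radial_field_def)

lemma gradient_radial:
  fixes W :: "'a::euclidean_space \<Rightarrow> real"
  assumes diff: "\<And>x. x \<noteq> 0 \<Longrightarrow> W differentiable (at x)"
    and radial: "\<And>x. x \<noteq> 0 \<Longrightarrow> W x = \<omega> (norm x)"
    and z: "z \<noteq> 0"
  shows "gradient W z = radial_field (deriv \<omega>) z"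
proof -
  obtain b :: 'a where b: "b \<in> Basis" using nonempty_Basis by blast
  have "\<omega> field_differentiable (at r)" if r: "r > 0" for r
  proof -
    obtain W' where W': "(W has_derivative W') (at (r *\<^sub>R b))"
      using diff[of "r *\<^sub>R b"] r nonzero_Basis[OF b] unfolding differentiable_def by auto
    have "((\<lambda>s. s *\<^sub>R b) has_derivative (\<lambda>h. h *\<^sub>R b)) (at r)"
      by (auto intro!: derivative_eq_intros)
    from has_derivative_compose[OF this W']
    have d: "((\<lambda>s. W (s *\<^sub>R b)) has_derivative (\<lambda>h. W' b * h)) (at r)"
      using linear_scale[OF has_derivative_linear[OF W']] by (simp add: mult.commute)
    have "(\<omega> has_derivative (\<lambda>h. W' b * h)) (at r)"
    proof (rule has_derivative_transform_within_open[OF d])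
      show "open {0::real<..}" "r \<in> {0<..}" using r by auto
      show "W (s *\<^sub>R b) = \<omega> s" if "s \<in> {0<..}" for s
        using that radial[of "s *\<^sub>R b"] b nonzero_Basis[OF b] by simp
    qed
    then show ?thesis
      by (auto simp: field_differentiable_def has_field_derivative_def)
  qed
  then have \<omega>': "(\<omega> has_derivative (\<lambda>h. deriv \<omega> (norm z) * h)) (at (norm z))"
    using z by (simp add: DERIV_deriv_iff_field_differentiable flip: has_field_derivative_def)
  have "((\<lambda>x. \<omega> (norm x)) has_derivative (\<lambda>h. deriv \<omega> (norm z) * (sgn z \<bullet> h))) (at z)"
    using has_derivative_compose[OF has_derivative_norm[OF z] \<omega>'] by (simp add: inner_commute)
  then have "(W has_derivative (\<lambda>h. deriv \<omega> (norm z) * (sgn z \<bullet> h))) (at z)"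
  proof (rule has_derivative_transform_within_open)
    show "open (- {0::'a})" "z \<in> - {0}" using z by auto
    show "\<omega> (norm x) = W x" if "x \<in> - {0}" for x
      using that radial by simp
  qed
  then have "frechet_derivative W (at z) = (\<lambda>h. deriv \<omega> (norm z) * (sgn z \<bullet> h))"
    by (rule frechet_derivative_at[symmetric])
  then have "gradient W z = deriv \<omega> (norm z) *\<^sub>R (\<Sum>b\<in>Basis. (sgn z \<bullet> b) *\<^sub>R b)"
    by (simp add: gradient_def scaleR_sum_right)
  then show ?thesis
    by (simp only: euclidean_representation) (simp add: radial_field_def sgn_div_norm divide_inverse)
qed

text \<open>
  The singular part of the kernel is integrable and meets the bounded density; the bounded part
  meets the integrable density.
\<close>

lemma convolution_bound:
  fixes \<rho> :: "'a::euclidean_space \<Rightarrow> real" and F :: "'a \<Rightarrow> 'a"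
  assumes [measurable]: "F \<in> borel_measurable borel" "\<rho> \<in> borel_measurable borel"
    and \<rho>: "\<And>x. 0 \<le> \<rho> x" "\<And>x. \<rho> x \<le> M" "integrable lborel \<rho>"
    and F: "\<And>z. norm (F z) \<le> C * (1 + indicator (cball 0 1) z * norm z powi (1 - int DIM('a)))" and "0 \<le> C"
  shows "\<exists>B\<ge>0. \<forall>x. (\<integral>\<^sup>+y. ennreal (\<rho> y * norm (F (x - y))) \<partial>lborel) \<le> ennreal B"
proof -
  have M: "0 \<le> M" using \<rho>(1,2)[of 0] by linarith
  define s where "s z = indicator (cball 0 1) z * norm z powi (1 - int DIM('a))" for z :: 'a
  have [measurable]: "s \<in> borel_measurable borel"
    unfolding s_def power_int_def
    by (intro borel_measurable_times borel_measurable_indicator measurable_If) auto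
  have s0: "0 \<le> s z" for z by (simp add: s_def)
  obtain S where S: "(\<integral>\<^sup>+z. ennreal (s z) \<partial>lborel) = ennreal S" "0 \<le> S"
    using nn_integral_riesz_finite[where 'a = 'a] unfolding s_def[symmetric]
    by (metis ennreal_cases infinity_ennreal_def less_irrefl)
  define I where "I = (LBINT x. \<rho> x)"
  have I: "(\<integral>\<^sup>+x. ennreal (\<rho> x) \<partial>lborel) = ennreal I" "0 \<le> I"
    using \<rho> by (simp_all add: I_def nn_integral_eq_integral)
  have "(\<integral>\<^sup>+y. ennreal (\<rho> y * norm (F (x - y))) \<partial>lborel) \<le> ennreal (C * I + C * M * S)" for x
  proof -
    have "(\<integral>\<^sup>+y. ennreal (\<rho> y * norm (F (x - y))) \<partial>lborel)
        \<le> (\<integral>\<^sup>+y. ennreal C * ennreal (\<rho> y) + ennreal (C * M) * ennreal (s (y - x)) \<partial>lborel)"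
    proof (rule nn_integral_mono)
      fix y
      have "s (x - y) = s (y - x)" by (simp add: s_def norm_minus_commute indicator_def dist_norm)
      then have "\<rho> y * norm (F (x - y)) \<le> \<rho> y * (C * (1 + s (y - x)))"
        using F[of "x - y"] \<rho>(1)[of y] unfolding s_def[symmetric] by (intro mult_left_mono) auto
      also have "\<dots> = C * \<rho> y + \<rho> y * (C * s (y - x))" by (simp add: algebra_simps)
      also have "\<dots> \<le> C * \<rho> y + M * (C * s (y - x))"
        using \<rho>(2)[of y] \<open>0 \<le> C\<close> s0 by (intro add_left_mono mult_right_mono) auto
      finally have "ennreal (\<rho> y * norm (F (x - y))) \<le> ennreal (C * \<rho> y + C * M * s (y - x))"
        by (intro ennreal_leI) (simp add: mult_ac)
      then show "ennreal (\<rho> y * norm (F (x - y))) \<le> ennreal C * ennreal (\<rho> y) + ennreal (C * M) * ennreal (s (y - x))"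
        using \<rho>(1)[of y] s0[of "y - x"] \<open>0 \<le> C\<close> M by (simp add: ennreal_mult' ennreal_plus)
    qed
    also have "\<dots> = ennreal C * ennreal I + ennreal (C * M) * ennreal S"
      using lborel_nn_translate[of "\<lambda>z. ennreal (s z)" "- x"]
      by (simp add: nn_integral_add nn_integral_cmult I S)
    also have "\<dots> = ennreal (C * I + C * M * S)"
      using \<open>0 \<le> C\<close> M I S by (simp add: ennreal_mult' ennreal_plus)
    finally show ?thesis .
  qed
  then show ?thesis
    using \<open>0 \<le> C\<close> M I S by (intro exI[of _ "C * I + C * M * S"]) auto
qed

section \<open>The force between two intervals\<close>

text \<open>
  The part of the interval that is symmetric about \<open>0\<close> contributes nothing; what remains lies in the
  half-line on which \<open>\<phi>\<close> is positive.
\<close>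

lemma odd_integral_pos:
  fixes \<phi> :: "real \<Rightarrow> real"
  assumes int: "\<And>p q. \<phi> integrable_on {p..q}" and odd: "\<And>u. \<phi> (- u) = - \<phi> u"
    and pos: "\<And>u. 0 < u \<Longrightarrow> 0 < \<phi> u" and cont: "continuous_on {0<..} \<phi>"
    and "p < q" "0 < p + q"
  shows "0 < integral {p..q} \<phi>"
proof -
  have pos_int: "0 < integral {\<alpha>..\<beta>} \<phi>" if "0 \<le> \<alpha>" "\<alpha> < \<beta>" for \<alpha> \<beta>
  proof -
    define \<gamma> where "\<gamma> = (\<alpha> + \<beta>) / 2"
    have \<gamma>: "\<alpha> < \<gamma>" "\<gamma> < \<beta>" using that by (auto simp: \<gamma>_def)
    have nn: "0 \<le> \<phi> u" if "0 \<le> u" for u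
      using pos[of u] odd[of 0] that by (cases "u = 0") auto
    have "0 \<le> integral {\<alpha>..\<gamma>} \<phi>" "0 \<le> integral {\<gamma>..\<beta>} \<phi>"
      using that \<gamma> by (auto intro!: integral_nonneg int nn)
    moreover have "integral {\<gamma>..\<beta>} \<phi> \<noteq> 0"
    proof
      assume "integral {\<gamma>..\<beta>} \<phi> = 0"
      moreover have "continuous_on {\<gamma>..\<beta>} \<phi>"
        using cont by (rule continuous_on_subset) (use that \<gamma> in auto)
      ultimately have "\<forall>x\<in>{\<gamma>..\<beta>}. \<phi> x = 0"
        using that \<gamma> nn by (subst (asm) integral_eq_0_iff) auto
      then show False using pos[of \<beta>] that \<gamma> by auto
    qed
    moreover have "integral {\<alpha>..\<gamma>} \<phi> + integral {\<gamma>..\<beta>} \<phi> = integral {\<alpha>..\<beta>} \<phi>"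
      using \<gamma> by (intro Henstock_Kurzweil_Integration.integral_combine int) auto
    ultimately show ?thesis by linarith
  qed
  show ?thesis
  proof (cases "0 \<le> p")
    case False
    have "integral {p..- p} \<phi> = - integral {p..- p} \<phi>"
      using Henstock_Kurzweil_Integration.integral_reflect_real[of "- p" p \<phi>] by (simp add: odd)
    moreover have "integral {p..- p} \<phi> + integral {- p..q} \<phi> = integral {p..q} \<phi>"
      using False assms by (intro Henstock_Kurzweil_Integration.integral_combine int) auto
    moreover have "0 < integral {- p..q} \<phi>"
      using False assms by (intro pos_int) auto
    ultimately show ?thesis by linarith
  qed (use pos_int assms in auto)
qed

text \<open>
  The inner integral, as a function of the distance of \<open>s\<close> from the midpoint of the second
  interval, is again odd and positive on the positive half-line. So \<open>odd_integral_pos\<close> applies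
  twice: to \<open>\<kappa>\<close>, and then to the inner integral.
\<close>

lemma interval_pair_force:
  fixes \<kappa> :: "real \<Rightarrow> real"
  assumes [measurable]: "\<kappa> \<in> borel_measurable borel" and odd: "\<And>u. \<kappa> (- u) = - \<kappa> u"
    and pos: "\<And>u. 0 < u \<Longrightarrow> 0 < \<kappa> u" and cont: "continuous_on {0<..} \<kappa>"
    and bd: "\<And>R. \<exists>B. \<forall>u. \<bar>u\<bar> \<le> R \<longrightarrow> \<bar>\<kappa> u\<bar> \<le> B"
    and ab: "a < b" "a' < b'"
  defines "Q \<equiv> (LBINT s. indicator {a<..<b} s * (LBINT t. indicator {a'<..<b'} t * \<kappa> (s - t)))"
  shows "a' + b' < a + b \<Longrightarrow> 0 < Q" and "a + b < a' + b' \<Longrightarrow> Q < 0"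
proof -
  have \<kappa>_int: "\<kappa> integrable_on {p..q}" for p q
  proof -
    obtain B where "\<And>u. \<bar>u\<bar> \<le> max \<bar>p\<bar> \<bar>q\<bar> \<Longrightarrow> \<bar>\<kappa> u\<bar> \<le> B" using bd by blast
    then show ?thesis
      by (intro bounded_borel_interval_integral(1)[where B = B]) auto
  qed
  define c where "c = (a' + b') / 2"
  define r where "r = (b' - a') / 2"
  have r: "0 < r" using ab by (simp add: r_def)
  define \<phi> where "\<phi> \<sigma> = integral {\<sigma> - r..\<sigma> + r} \<kappa>" for \<sigma>
  have \<phi>_odd: "\<phi> (- \<sigma>) = - \<phi> \<sigma>" for \<sigma>
    using Henstock_Kurzweil_Integration.integral_reflect_real[of "\<sigma> + r" "\<sigma> - r" \<kappa>]
    by (simp add: \<phi>_def odd)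
  have \<phi>_pos: "0 < \<phi> \<sigma>" if "0 < \<sigma>" for \<sigma>
    unfolding \<phi>_def using that r by (intro odd_integral_pos \<kappa>_int odd pos cont) auto
  have \<phi>_cont: "continuous_on UNIV \<phi>"
  proof -
    have "isCont \<phi> \<sigma>" for \<sigma>
    proof -
      \<comment> \<open>a base point to the left of all intervals that occur for arguments near \<open>\<sigma>\<close>\<close>
      define N where "N = - (\<bar>\<sigma>\<bar> + r + 2)"
      have ind: "continuous_on {N..- N} (\<lambda>x. integral {N..x} \<kappa>)"
        by (rule indefinite_integral_continuous_1[OF \<kappa>_int])
      have eq: "\<phi> s = integral {N..s + r} \<kappa> - integral {N..s - r} \<kappa>" if "\<bar>s - \<sigma>\<bar> < 1" for s
      proof -
        have "integral {N..s - r} \<kappa> + integral {s - r..s + r} \<kappa> = integral {N..s + r} \<kappa>"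
          using that r by (intro Henstock_Kurzweil_Integration.integral_combine \<kappa>_int) (auto simp: N_def)
        then show ?thesis by (simp only: \<phi>_def)
      qed
      have "continuous_on (ball \<sigma> 1) (\<lambda>s. integral {N..s + r} \<kappa> - integral {N..s - r} \<kappa>)"
        by (intro continuous_on_diff continuous_on_compose2[OF ind] continuous_intros)
           (use r in \<open>auto simp: N_def dist_real_def\<close>)
      then have "continuous_on (ball \<sigma> 1) \<phi>"
        by (rule continuous_on_eq) (auto simp: eq dist_real_def)
      then show ?thesis
        by (simp add: continuous_on_eq_continuous_at)
    qed
    then show ?thesis by (simp add: continuous_on_eq_continuous_at)
  qed
  have [measurable]: "\<phi> \<in> borel_measurable borel"
    using \<phi>_cont by (rule borel_measurable_continuous_onI)
  have open_closed: "(LBINT s. indicator {p<..<q} s * f s) = (LBINT s. indicator {p..q} s * f s)"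
    if "f \<in> borel_measurable borel" for p q and f :: "real \<Rightarrow> real"
  proof (rule integral_cong_AE)
    note [measurable] = that
    have "AE s in lborel. s \<noteq> p" "AE s in lborel. s \<noteq> q" by (rule AE_lborel_singleton)+
    then show "AE s in lborel. indicator {p<..<q} s * f s = indicator {p..q} s * f s"
      by eventually_elim (auto simp: indicator_def)
  qed (use that in measurable)
  have inner: "(LBINT t. indicator {a'<..<b'} t * \<kappa> (s - t)) = \<phi> (s - c)" for s
  proof -
    obtain B where B: "\<And>u. \<bar>u\<bar> \<le> \<bar>s\<bar> + \<bar>a'\<bar> + \<bar>b'\<bar> \<Longrightarrow> \<bar>\<kappa> u\<bar> \<le> B" using bd by blast
    have "(LBINT t. indicator {a'<..<b'} t * \<kappa> (s - t)) = (LBINT t. indicator {a'..b'} t * \<kappa> (s - t))"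
      by (rule open_closed) measurable
    also have "\<dots> = integral {a'..b'} (\<lambda>t. \<kappa> (s - t))"
      by (rule bounded_borel_interval_integral(3)[symmetric, where B = B]) (auto intro!: B)
    also have "\<dots> = integral {- b'..- a'} (\<lambda>t. \<kappa> (t + s))"
      using Henstock_Kurzweil_Integration.integral_reflect_real[of b' a' "\<lambda>t. \<kappa> (s - t)"] by (simp add: add.commute)
    also have "\<dots> = integral {s - b'..s - a'} \<kappa>"
      using integral_shift_Icc_real[of "- b'" "- a'" \<kappa> s] by (simp add: o_def add.commute[of s])
    also have "\<dots> = \<phi> (s - c)"
    proof -
      have "s - c - r = s - b'" "s - c + r = s - a'" by (auto simp: c_def r_def field_simps)
      then show ?thesis by (simp only: \<phi>_def)
    qed
    finally show ?thesis .
  qed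
  have \<phi>_int: "\<phi> integrable_on {p..q}" for p q
    by (intro integrable_continuous_real continuous_on_subset[OF \<phi>_cont]) simp
  have Q: "Q = integral {a - c..b - c} \<phi>"
  proof -
    have "bounded (\<phi> ` {a - c..b - c})"
      by (intro compact_imp_bounded compact_continuous_image continuous_on_subset[OF \<phi>_cont]) auto
    then obtain B where "\<forall>v\<in>\<phi> ` {a - c..b - c}. norm v \<le> B"
      unfolding bounded_iff by blast
    then have B: "\<bar>\<phi> s\<bar> \<le> B" if "s \<in> {a - c..b - c}" for s
      using that by force
    have "Q = (LBINT s. indicator {a<..<b} s * \<phi> (s - c))"
      by (simp add: Q_def inner)
    also have "\<dots> = (LBINT s. indicator {a..b} s * \<phi> (s - c))"
      by (rule open_closed) measurable
    also have "\<dots> = (LBINT s. indicator {a - c..b - c} s * \<phi> s)"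
      using lborel_translate(1)[of "\<lambda>s. indicator {a - c..b - c} s * \<phi> s" "- c"]
      by (simp add: indicator_def cong: if_cong)
    also have "\<dots> = integral {a - c..b - c} \<phi>"
      by (rule bounded_borel_interval_integral(3)[symmetric, where B = B]) (use B in auto)
    finally show ?thesis .
  qed
  show "0 < Q" if "a' + b' < a + b"
    unfolding Q using that ab
    by (intro odd_integral_pos \<phi>_int \<phi>_odd \<phi>_pos continuous_on_subset[OF \<phi>_cont]) (auto simp: c_def)
  show "Q < 0" if "a + b < a' + b'"
  proof -
    have "0 < integral {c - b..c - a} \<phi>"
      using that ab
      by (intro odd_integral_pos \<phi>_int \<phi>_odd \<phi>_pos continuous_on_subset[OF \<phi>_cont]) (auto simp: c_def)
    also have "integral {c - b..c - a} \<phi> = integral {a - c..b - c} (\<lambda>s. \<phi> (- s))"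
      using Henstock_Kurzweil_Integration.integral_reflect_real[of "b - c" "a - c" "\<lambda>s. \<phi> (- s)"] by simp
    also have "\<dots> = - Q"
      by (simp add: Q \<phi>_odd)
    finally show ?thesis by simp
  qed
qed

section \<open>Level chords\<close>

lemma AE_fst_lborel:
  assumes "AE x in (lborel :: 'b::euclidean_space measure). P x"
  shows "AE p in (lborel :: ('b \<times> 'c::euclidean_space) measure). P (fst p)"
proof -
  obtain N where N: "N \<in> null_sets lborel" "{x. \<not> P x} \<subseteq> N"
    using assms by (auto simp: eventually_ae_filter)
  have [measurable]: "N \<in> sets lborel" and "emeasure lborel N = 0"
    using N(1) by blast+
  then have "emeasure (lborel \<Otimes>\<^sub>M lborel) (N \<times> (UNIV :: 'c set)) = 0"
    by (simp add: lborel.emeasure_pair_measure_Times)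
  moreover have "N \<times> (UNIV :: 'c set) \<in> sets (lborel \<Otimes>\<^sub>M lborel)"
    using N(1) by (intro pair_measureI) auto
  ultimately have "N \<times> (UNIV :: 'c set) \<in> null_sets lborel"
    unfolding lborel_prod[symmetric] by (simp only: null_sets_def) simp
  then have "AE p in (lborel :: ('b \<times> 'c) measure). p \<notin> N \<times> UNIV"
    by (rule AE_not_in)
  then show ?thesis
    by eventually_elim (use N(2) in auto)
qed

lemma nn_integral_lborel_fst:
  fixes f :: "'b::euclidean_space \<Rightarrow> 'c::euclidean_space \<Rightarrow> ennreal"
  assumes "case_prod f \<in> borel_measurable borel"
  shows "(\<integral>\<^sup>+x. \<integral>\<^sup>+y. f x y \<partial>lborel \<partial>lborel) = (\<integral>\<^sup>+p. case_prod f p \<partial>lborel)"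
  using lborel.nn_integral_fst[of "case_prod f" lborel] assms
  by (simp add: lborel_prod)

lemma nn_integral_lborel_swap:
  fixes f :: "'b::euclidean_space \<Rightarrow> 'c::euclidean_space \<Rightarrow> ennreal"
  assumes "case_prod f \<in> borel_measurable borel"
  shows "(\<integral>\<^sup>+x. \<integral>\<^sup>+y. f x y \<partial>lborel \<partial>lborel) = (\<integral>\<^sup>+y. \<integral>\<^sup>+x. f x y \<partial>lborel \<partial>lborel)"
  using lborel_pair.Fubini'[of f] assms by (simp add: borel_prod[symmetric] cong: measurable_cong_sets)

lemma segment_0_eq_image:
  fixes s :: real
  shows "closed_segment 0 s = (\<lambda>r. r * s) ` {0..1}"
  by (auto simp: closed_segment_def)

lemma borel_measurable_fst_comp[measurable (raw)]:
  fixes f :: "'m \<Rightarrow> 'b::topological_space \<times> 'c::topological_space"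
  assumes "f \<in> borel_measurable M"
  shows "(\<lambda>x. fst (f x)) \<in> borel_measurable M"
  by (rule borel_measurable_continuous_on[OF _ assms]) (intro continuous_intros)

lemma borel_measurable_snd_comp[measurable (raw)]:
  fixes f :: "'m \<Rightarrow> 'b::topological_space \<times> 'c::topological_space"
  assumes "f \<in> borel_measurable M"
  shows "(\<lambda>x. snd (f x)) \<in> borel_measurable M"
  by (rule borel_measurable_continuous_on[OF _ assms]) (intro continuous_intros)

locale level_lines =
  fixes \<rho> :: "'a::euclidean_space \<Rightarrow> real" and e :: 'a
  assumes cont: "continuous_on UNIV \<rho>" and nonneg: "\<And>x. 0 \<le> \<rho> x"
    and integrable_rho: "integrable lborel \<rho>" and norm_e: "norm e = 1"
begin

text \<open>
  A pair \<open>(x, h)\<close> in the subgraph stands for the point \<open>x\<close> in the layer \<open>{\<rho> > h}\<close>.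
\<close>

definition subgraph :: "('a \<times> real) set" where
  "subgraph = {p. 0 < snd p \<and> snd p < \<rho> (fst p)}"

definition slide :: "'a \<times> real \<Rightarrow> real \<Rightarrow> 'a \<times> real" where
  "slide p s = (fst p + s *\<^sub>R e, snd p)"

text \<open>
  The chord through \<open>(x, h)\<close> is the component of \<open>{\<rho> > h}\<close> on the line through \<open>x\<close> in direction
  \<open>e\<close>, parametrised by the displacement from \<open>x\<close>. It is empty off the subgraph.
\<close>

definition chord :: "'a \<times> real \<Rightarrow> real set" where
  "chord p = {s. 0 < snd p \<and> (\<forall>q\<in>closed_segment 0 s. snd p < \<rho> (fst p + q *\<^sub>R e))}"

definition chord_length :: "'a \<times> real \<Rightarrow> real" where
  "chord_length p = measure lborel (chord p)"

text \<open>
  The \<open>e\<close>-coordinate of the midpoint of the chord. Writing the midpoint as a mean makes its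
  measurability in \<open>p\<close> a consequence of Fubini's theorem.
\<close>

definition chord_center :: "'a \<times> real \<Rightarrow> real" where
  "chord_center p = fst p \<bullet> e + (LBINT s. indicator (chord p) s * s) / chord_length p"

definition bounded_chord :: "'a \<times> real \<Rightarrow> bool" where
  "bounded_chord p \<longleftrightarrow> (\<exists>a b. a < 0 \<and> 0 < b \<and> chord p = {a<..<b})"

text \<open>
  The density of the uniform probability distribution on the chord.
\<close>

definition chord_density :: "'a \<times> real \<Rightarrow> real \<Rightarrow> real" where
  "chord_density p s = indicator (chord p) s / chord_length p"

lemma rho_measurable[measurable]: "\<rho> \<in> borel_measurable borel"
  using cont by (rule borel_measurable_continuous_onI)

lemma cont_compose: "continuous_on A f \<Longrightarrow> continuous_on A (\<lambda>x. \<rho> (f x))"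
  by (rule continuous_on_compose2[OF cont]) auto

lemma open_subgraph: "open subgraph"
  unfolding subgraph_def
  by (intro open_Collect_conj open_Collect_less cont_compose continuous_intros)

text \<open>
  The complement is a projection of a closed set along the compact interval of the segment
  parameter.
\<close>

lemma open_chords: "open {(p, s). s \<in> chord p}"
proof -
  define T where "T = {(r :: real, p :: 'a \<times> real, s). \<rho> (fst p + (r * s) *\<^sub>R e) \<le> snd p}"
  have "closed T"
    unfolding T_def case_prod_unfold
    by (intro closed_Collect_le cont_compose continuous_intros)
  then have "closed {y. \<exists>r. r \<in> {0..1} \<and> (r, y) \<in> T}"
    by (intro closed_compact_projection) auto
  moreover have "closed {y :: ('a \<times> real) \<times> real. snd (fst y) \<le> 0}"
    by (intro closed_Collect_le continuous_intros)
  moreover have "{(p, s). s \<in> chord p} = - ({y. snd (fst y) \<le> 0} \<union> {y. \<exists>r. r \<in> {0..1} \<and> (r, y) \<in> T})"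
  proof (rule set_eqI)
    fix y :: "('a \<times> real) \<times> real"
    obtain p s where y: "y = (p, s)" by (cases y)
    show "y \<in> {(p, s). s \<in> chord p} \<longleftrightarrow> y \<in> - ({y. snd (fst y) \<le> 0} \<union> {y. \<exists>r. r \<in> {0..1} \<and> (r, y) \<in> T})"
      unfolding y chord_def T_def segment_0_eq_image by (simp add: not_less[symmetric]) (metis atLeastAtMost_iff not_less)
  qed
  ultimately show ?thesis
    by (simp only: open_Compl closed_Un)
qed

lemma open_chord: "open (chord p)"
proof -
  have "open ((\<lambda>s. (p, s)) -` {(p, s). s \<in> chord p})"
    by (intro continuous_open_vimage open_chords) (auto intro!: continuous_intros)
  then show ?thesis by (simp add: vimage_def)
qed

lemma chord_indicator_measurable[measurable]:
  "(\<lambda>(p, s). indicator (chord p) s :: real) \<in> borel_measurable borel"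
proof -
  have "(\<lambda>(p, s). indicator (chord p) s :: real) = indicator {(p, s). s \<in> chord p}"
    by (auto simp: indicator_def fun_eq_iff)
  then show ?thesis
    using open_chords by simp
qed

lemma chord_indicator_measurable'[measurable (raw)]:
  assumes "f \<in> borel_measurable M" "g \<in> borel_measurable M"
  shows "(\<lambda>x. indicator (chord (f x)) (g x) :: real) \<in> borel_measurable M"
proof -
  have "(\<lambda>x. (f x, g x)) \<in> M \<rightarrow>\<^sub>M borel"
    using assms by (simp add: borel_prod[symmetric])
  from measurable_compose[OF this chord_indicator_measurable] show ?thesis by simp
qed

lemma zero_in_chord_iff: "0 \<in> chord p \<longleftrightarrow> p \<in> subgraph"
  by (auto simp: chord_def subgraph_def)

lemma chord_subgraph: "s \<in> chord p \<Longrightarrow> p \<in> subgraph"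
  by (auto simp: chord_def subgraph_def dest: bspec[of _ _ 0])

lemma chord_segment: "s \<in> chord p \<Longrightarrow> q \<in> closed_segment 0 s \<Longrightarrow> q \<in> chord p"
  unfolding chord_def using closed_segment_subset[of 0 "closed_segment 0 s" q] by auto

text \<open>
  Sliding the base point along its own chord only shifts the parametrisation. This is why length and
  center are functions of the chord and not of the point on it.
\<close>

lemma chord_slide: "s \<in> chord p \<Longrightarrow> r \<in> chord (slide p s) \<longleftrightarrow> s + r \<in> chord p"
proof -
  assume s: "s \<in> chord p"
  have eq: "fst (slide p s) + q *\<^sub>R e = fst p + (s + q) *\<^sub>R e" for q
    by (simp add: slide_def algebra_simps)
  have seg: "closed_segment 0 (s + r) \<subseteq> closed_segment 0 s \<union> (\<lambda>q. s + q) ` closed_segment 0 r"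
    "(\<lambda>q. s + q) ` closed_segment 0 r \<subseteq> closed_segment 0 s \<union> closed_segment 0 (s + r)"
    by (auto simp: closed_segment_eq_real_ivl image_iff split: if_splits
          intro: bexI[of _ "x - s" for x])
  show ?thesis
    using s seg unfolding chord_def mem_Collect_eq eq by (auto simp: slide_def subset_iff)
qed

lemma slide_slide: "slide (slide p s) r = slide p (s + r)"
  by (simp add: slide_def algebra_simps)

lemma slide_0[simp]: "slide p 0 = p"
  by (simp add: slide_def)

lemma chord_reverse: "s \<in> chord (slide p (- s)) \<longleftrightarrow> - s \<in> chord p"
proof
  assume "- s \<in> chord p"
  then show "s \<in> chord (slide p (- s))"
    using chord_slide[of "- s" p s] by (simp add: zero_in_chord_iff chord_subgraph)
next
  assume s: "s \<in> chord (slide p (- s))"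
  then show "- s \<in> chord p"
    using chord_slide[OF s, of "- s"] by (simp add: slide_slide zero_in_chord_iff chord_subgraph)
qed

lemma chord_length_slide:
  assumes "s \<in> chord p"
  shows "chord_length (slide p s) = chord_length p"
proof -
  have [measurable]: "chord p \<in> sets borel" "chord (slide p s) \<in> sets borel"
    by (simp_all add: open_chord)
  have "emeasure lborel (chord (slide p s)) = (\<integral>\<^sup>+r. indicator (chord (slide p s)) r \<partial>lborel)"
    by simp
  also have "\<dots> = (\<integral>\<^sup>+r. indicator (chord p) (r + s) \<partial>lborel)"
    using chord_slide[OF assms] by (intro nn_integral_cong) (simp add: indicator_def add.commute)
  also have "\<dots> = emeasure lborel (chord p)"
    by (subst lborel_nn_translate) auto
  finally show ?thesis by (simp add: chord_length_def measure_def)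
qed

text \<open>
  At an end point \<open>\<rho> \<ge> h\<close> holds by continuity, and \<open>\<rho> > h\<close> would put the end point into the open
  chord.
\<close>

lemma bounded_chord_bounds:
  assumes "a < 0" "0 < b" "chord p = {a<..<b}"
  shows "chord_length p = b - a" "chord_center p = fst p \<bullet> e + (a + b) / 2"
    "\<rho> (fst p + a *\<^sub>R e) = snd p" "\<rho> (fst p + b *\<^sub>R e) = snd p"
    "\<And>s. s \<in> {a..b} \<Longrightarrow> snd p \<le> \<rho> (fst p + s *\<^sub>R e)"
proof -
  show len: "chord_length p = b - a"
    using assms by (simp add: chord_length_def)
  have "(LBINT s. indicator (chord p) s * s) = (LBINT s. s * indicator {a..b} s)"
  proof (rule integral_cong_AE)
    have "AE s in lborel. s \<noteq> a" "AE s in lborel. s \<noteq> b" by (rule AE_lborel_singleton)+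
    then show "AE s in lborel. indicator (chord p) s * s = s * indicator {a..b} s"
      by eventually_elim (auto simp: assms indicator_def)
  qed (simp_all add: assms)
  also have "\<dots> = b\<^sup>2 / 2 - a\<^sup>2 / 2"
    by (rule integral_FTC_Icc_real) (use assms in \<open>auto intro!: derivative_eq_intros\<close>)
  also have "\<dots> = (a + b) / 2 * (b - a)"
    by (simp add: power2_eq_square field_simps)
  finally show "chord_center p = fst p \<bullet> e + (a + b) / 2"
    using assms by (simp add: chord_center_def len)
  have h: "0 < snd p" using assms by (force simp: chord_def)
  have inside: "snd p < \<rho> (fst p + s *\<^sub>R e)" if "s \<in> {a<..<b}" for s
    using that assms(3) by (auto simp: chord_def)
  have cl: "closed {s. snd p \<le> \<rho> (fst p + s *\<^sub>R e)}"
    by (intro closed_Collect_le cont_compose continuous_intros)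
  have "closure {a<..<b} \<subseteq> {s. snd p \<le> \<rho> (fst p + s *\<^sub>R e)}"
    by (rule closure_minimal[OF _ cl]) (use inside in \<open>auto intro: less_imp_le\<close>)
  then show ge: "snd p \<le> \<rho> (fst p + s *\<^sub>R e)" if "s \<in> {a..b}" for s
    using that assms by auto
  have le: "\<rho> (fst p + s *\<^sub>R e) \<le> snd p" if "s = a \<or> s = b" for s
  proof -
    have "s \<notin> chord p" using that assms by auto
    then obtain q where q: "q \<in> closed_segment 0 s" "\<rho> (fst p + q *\<^sub>R e) \<le> snd p"
      using h by (auto simp: chord_def not_less)
    moreover have "q \<notin> {a<..<b}" using inside[of q] q(2) by force
    ultimately have "q = s"
      using that assms by (auto simp: closed_segment_eq_real_ivl split: if_splits)
    with q show ?thesis by simp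
  qed
  show "\<rho> (fst p + a *\<^sub>R e) = snd p" "\<rho> (fst p + b *\<^sub>R e) = snd p"
    using le[of a] le[of b] ge[of a] ge[of b] assms by auto
qed

lemma bounded_chord_slide:
  assumes "bounded_chord p" "s \<in> chord p"
  shows "chord_center (slide p s) = chord_center p"
proof -
  obtain a b where ab: "a < 0" "0 < b" "chord p = {a<..<b}"
    using assms by (auto simp: bounded_chord_def)
  have s: "a < s" "s < b" using assms ab by auto
  have "chord (slide p s) = {a - s<..<b - s}"
    using chord_slide[OF assms(2)] unfolding ab(3)
    by (intro set_eqI) (simp only: greaterThanLessThan_iff, linarith)
  from bounded_chord_bounds(2)[OF _ _ this] bounded_chord_bounds(2)[OF ab] s show ?thesis
    using norm_e by (simp add: slide_def inner_add_left field_simps norm_eq_1)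
qed

lemma bounded_chordI:
  assumes p: "p \<in> subgraph" and fin: "emeasure lborel (chord p) < \<infinity>"
  shows "bounded_chord p"
proof -
  define B where "B = measure lborel (chord p)"
  have [measurable]: "chord p \<in> sets borel" by (simp add: open_chord)
  have le: "\<bar>s\<bar> \<le> B" if "s \<in> chord p" for s
  proof -
    have "closed_segment 0 s \<subseteq> chord p"
      using that chord_segment by blast
    then have "emeasure lborel (closed_segment 0 s) \<le> emeasure lborel (chord p)"
      by (intro emeasure_mono) auto
    moreover have "emeasure lborel (closed_segment 0 s) = ennreal \<bar>s\<bar>"
      by (auto simp: closed_segment_eq_real_ivl)
    ultimately show ?thesis
      using fin by (simp add: B_def emeasure_eq_ennreal_measure ennreal_le_iff measure_nonneg less_top)
  qed
  have bdd: "bdd_above (chord p)" "bdd_below (chord p)"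
    using le by (auto intro!: bdd_aboveI[of _ B] bdd_belowI[of _ "- B"] simp: abs_le_iff minus_le_iff)
  have 0: "0 \<in> chord p" using p by (simp add: zero_in_chord_iff)
  define a where "a = Inf (chord p)"
  define b where "b = Sup (chord p)"
  have strict: "a < s" "s < b" if s: "s \<in> chord p" for s
  proof -
    obtain d where d: "d > 0" "ball s d \<subseteq> chord p"
      using open_chord s by (meson open_contains_ball)
    have "s + d / 2 \<in> ball s d" "s - d / 2 \<in> ball s d" using d(1) by (auto simp: dist_real_def)
    with d(2) have "s + d / 2 \<in> chord p" "s - d / 2 \<in> chord p" by blast+
    then have "s + d / 2 \<le> b" "a \<le> s - d / 2"
      unfolding a_def b_def using bdd by (auto intro: cSup_upper cInf_lower)
    then show "a < s" "s < b" using d(1) by auto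
  qed
  have "s \<in> chord p" if s: "a < s" "s < b" for s
  proof (cases "0 \<le> s")
    case True
    obtain t where "t \<in> chord p" "s < t"
      using less_cSupD[of "chord p" s] s(2) 0 unfolding b_def by blast
    then show ?thesis
      using chord_segment[of t p s] True by (auto simp: closed_segment_eq_real_ivl)
  next
    case False
    obtain t where "t \<in> chord p" "t < s"
      using cInf_lessD[of "chord p" s] s(1) 0 unfolding a_def by blast
    then show ?thesis
      using chord_segment[of t p s] False by (auto simp: closed_segment_eq_real_ivl)
  qed
  with strict have "chord p = {a<..<b}" by auto
  then show ?thesis using strict[OF 0] by (auto simp: bounded_chord_def)
qed

text \<open>
  Tonelli's theorem on the slab \<open>\<bar>x \<bullet> e\<bar> \<le> n\<close>: each point \<open>y\<close> is hit by the points of the slab on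
  its line with total weight \<open>2 n\<close>, so the integral over the slab is \<open>2 n\<close> times the mass of \<open>\<rho>\<close>.
\<close>

lemma AE_line_integral_finite:
  "AE x in lborel. (\<integral>\<^sup>+s. ennreal (\<rho> (x + s *\<^sub>R e)) \<partial>lborel) < \<infinity>"
proof -
  have ee: "e \<bullet> e = 1" using norm_e by (simp add: norm_eq_1)
  have "AE x in lborel. indicator {x. \<bar>x \<bullet> e\<bar> \<le> real n} x * (\<integral>\<^sup>+s. ennreal (\<rho> (x + s *\<^sub>R e)) \<partial>lborel) \<noteq> \<infinity>" for n
  proof (rule nn_integral_PInf_AE)
    have "(\<integral>\<^sup>+x. indicator {x. \<bar>x \<bullet> e\<bar> \<le> real n} x * (\<integral>\<^sup>+s. ennreal (\<rho> (x + s *\<^sub>R e)) \<partial>lborel) \<partial>lborel)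
        = (\<integral>\<^sup>+x. \<integral>\<^sup>+s. indicator {x. \<bar>x \<bullet> e\<bar> \<le> real n} x * ennreal (\<rho> (x + s *\<^sub>R e)) \<partial>lborel \<partial>lborel)"
      by (intro nn_integral_cong) (simp add: nn_integral_cmult)
    also have "\<dots> = (\<integral>\<^sup>+s. \<integral>\<^sup>+x. indicator {x. \<bar>x \<bullet> e\<bar> \<le> real n} x * ennreal (\<rho> (x + s *\<^sub>R e)) \<partial>lborel \<partial>lborel)"
      by (rule nn_integral_lborel_swap) (simp add: borel_prod[symmetric])
    also have "\<dots> = (\<integral>\<^sup>+s. \<integral>\<^sup>+x. indicator {x. \<bar>x \<bullet> e - s\<bar> \<le> real n} x * ennreal (\<rho> x) \<partial>lborel \<partial>lborel)"
    proof (rule nn_integral_cong)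
      fix s
      show "(\<integral>\<^sup>+x. indicator {x. \<bar>x \<bullet> e\<bar> \<le> real n} x * ennreal (\<rho> (x + s *\<^sub>R e)) \<partial>lborel)
        = (\<integral>\<^sup>+x. indicator {x. \<bar>x \<bullet> e - s\<bar> \<le> real n} x * ennreal (\<rho> x) \<partial>lborel)"
        using lborel_nn_translate[of "\<lambda>x. indicator {x. \<bar>x \<bullet> e - s\<bar> \<le> real n} x * ennreal (\<rho> x)" "s *\<^sub>R e"]
        by (simp add: inner_add_left ee indicator_def)
    qed
    also have "\<dots> = (\<integral>\<^sup>+x. \<integral>\<^sup>+s. indicator {x. \<bar>x \<bullet> e - s\<bar> \<le> real n} x * ennreal (\<rho> x) \<partial>lborel \<partial>lborel)"
      by (rule nn_integral_lborel_swap) (simp add: borel_prod[symmetric])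
    also have "\<dots> = (\<integral>\<^sup>+x. ennreal (\<rho> x) * ennreal (2 * real n) \<partial>lborel)"
    proof (rule nn_integral_cong)
      fix x
      have "(\<integral>\<^sup>+s. indicator {x. \<bar>x \<bullet> e - s\<bar> \<le> real n} x * ennreal (\<rho> x) \<partial>lborel)
         = (\<integral>\<^sup>+s. ennreal (\<rho> x) * indicator {x \<bullet> e - real n..x \<bullet> e + real n} s \<partial>lborel)"
        by (intro nn_integral_cong) (auto simp: indicator_def)
      also have "\<dots> = ennreal (\<rho> x) * ennreal (2 * real n)"
        by (subst nn_integral_cmult_indicator) auto
      finally show "(\<integral>\<^sup>+s. indicator {x. \<bar>x \<bullet> e - s\<bar> \<le> real n} x * ennreal (\<rho> x) \<partial>lborel)
         = ennreal (\<rho> x) * ennreal (2 * real n)" .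
    qed
    also have "\<dots> < \<infinity>"
      using integrable_rho nonneg
      by (simp add: nn_integral_multc integrable_iff_bounded ennreal_mult_less_top)
    finally show "(\<integral>\<^sup>+x. indicator {x. \<bar>x \<bullet> e\<bar> \<le> real n} x * (\<integral>\<^sup>+s. ennreal (\<rho> (x + s *\<^sub>R e)) \<partial>lborel) \<partial>lborel) \<noteq> \<infinity>"
      by simp
  qed measurable
  then have "AE x in lborel. \<forall>n. indicator {x. \<bar>x \<bullet> e\<bar> \<le> real n} x * (\<integral>\<^sup>+s. ennreal (\<rho> (x + s *\<^sub>R e)) \<partial>lborel) \<noteq> \<infinity>"
    by (simp add: AE_all_countable)
  then show ?thesis
  proof eventually_elim
    case (elim x)
    obtain n where "\<bar>x \<bullet> e\<bar> \<le> real n" using real_arch_simple by blast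
    with elim[rule_format, of n] show ?case by (simp add: less_top)
  qed
qed

text \<open>
  A chord at height \<open>h\<close> has length at most \<open>1 / h\<close> times the integral of \<open>\<rho>\<close> over its line.
\<close>

lemma AE_bounded_chord: "AE p in lborel. p \<in> subgraph \<longrightarrow> bounded_chord p"
  using AE_fst_lborel[OF AE_line_integral_finite]
proof eventually_elim
  case (elim p)
  show ?case
  proof
    assume p: "p \<in> subgraph"
    then have h: "0 < snd p" by (simp add: subgraph_def)
    have [measurable]: "chord p \<in> sets borel" by (simp add: open_chord)
    have "ennreal (snd p) * emeasure lborel (chord p) = (\<integral>\<^sup>+s. ennreal (snd p) * indicator (chord p) s \<partial>lborel)"
      by (simp add: nn_integral_cmult_indicator)
    also have "\<dots> \<le> (\<integral>\<^sup>+s. ennreal (\<rho> (fst p + s *\<^sub>R e)) \<partial>lborel)"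
    proof (rule nn_integral_mono)
      fix s
      have "snd p \<le> \<rho> (fst p + s *\<^sub>R e)" if "s \<in> chord p"
        using that ends_in_segment(2)[of s 0] by (auto simp: chord_def intro: less_imp_le)
      then show "ennreal (snd p) * indicator (chord p) s \<le> ennreal (\<rho> (fst p + s *\<^sub>R e))"
        by (cases "s \<in> chord p") (auto intro: ennreal_leI)
    qed
    also have "\<dots> < \<infinity>" by (rule elim)
    finally have "emeasure lborel (chord p) < \<infinity>"
      using h by (auto simp: ennreal_mult_less_top)
    with p show "bounded_chord p" by (rule bounded_chordI)
  qed
qed

lemma chord_length_measurable[measurable]: "chord_length \<in> borel_measurable borel"
proof -
  have "chord_length = (\<lambda>p. enn2real (\<integral>\<^sup>+s. ennreal (indicator (chord p) s) \<partial>lborel))"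
    using open_chord by (simp add: fun_eq_iff chord_length_def measure_def ennreal_indicator)
  also have "\<dots> \<in> borel_measurable borel"
    by measurable
  finally show ?thesis .
qed

lemma chord_center_measurable[measurable]: "chord_center \<in> borel_measurable borel"
  unfolding chord_center_def[abs_def] by measurable

lemma chord_density_measurable[measurable (raw)]:
  assumes [measurable]: "f \<in> borel_measurable M" "g \<in> borel_measurable M"
  shows "(\<lambda>x. chord_density (f x) (g x)) \<in> borel_measurable M"
  unfolding chord_density_def by measurable

lemma slide_measurable[measurable (raw)]:
  assumes [measurable]: "f \<in> borel_measurable M" "g \<in> borel_measurable M"
  shows "(\<lambda>x. slide (f x) (g x)) \<in> borel_measurable M"
  unfolding slide_def by (intro borel_measurable_Pair) measurable

lemma chord_density_nonneg: "0 \<le> chord_density p s"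
  by (simp add: chord_density_def chord_length_def)

lemma chord_density_reverse: "chord_density (slide p (- s)) s = chord_density p (- s)"
  using chord_reverse[of s p] chord_length_slide[of "- s" p]
  by (auto simp: chord_density_def indicator_def)

lemma chord_density_integral:
  assumes "p \<in> subgraph \<longrightarrow> bounded_chord p"
  shows "(\<integral>\<^sup>+s. ennreal (chord_density p (- s)) \<partial>lborel) = indicator subgraph p"
proof (cases "p \<in> subgraph")
  case True
  then obtain a b where ab: "a < 0" "0 < b" "chord p = {a<..<b}"
    using assms by (auto simp: bounded_chord_def)
  have "(\<integral>\<^sup>+s. ennreal (chord_density p (- s)) \<partial>lborel) = (\<integral>\<^sup>+s. ennreal (1 / (b - a)) * indicator {- b<..<- a} s \<partial>lborel)"
    using bounded_chord_bounds(1)[OF ab]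
    by (intro nn_integral_cong) (auto simp: chord_density_def ab indicator_def)
  also have "\<dots> = ennreal (1 / (b - a)) * ennreal (b - a)"
    using ab by (subst nn_integral_cmult_indicator) auto
  also have "\<dots> = 1"
    using ab by (simp flip: ennreal_mult'')
  finally show ?thesis using True by simp
next
  case False
  then have "chord p = {}" using chord_subgraph by blast
  then show ?thesis using False by (simp add: chord_density_def)
qed

text \<open>
  Averaging over chords preserves integrals over the subgraph. The kernel is symmetric: the weight
  that \<open>p\<close> gives to \<open>slide p s\<close> is the weight that \<open>slide p s\<close> gives to \<open>p\<close>, because both lie on
  the same chord. Translating the base point by \<open>s e\<close> thus turns the left-hand side into the integral of
  \<open>f p\<close> times the total weight of the chord through \<open>p\<close>, which is \<open>1\<close>.
\<close>

lemma nn_integral_chord_average: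
  fixes f :: "'a \<times> real \<Rightarrow> ennreal"
  assumes [measurable]: "f \<in> borel_measurable borel"
  shows "(\<integral>\<^sup>+p. \<integral>\<^sup>+s. ennreal (chord_density p s) * f (slide p s) \<partial>lborel \<partial>lborel)
       = (\<integral>\<^sup>+p. indicator subgraph p * f p \<partial>lborel)"
proof -
  have "(\<integral>\<^sup>+p. \<integral>\<^sup>+s. ennreal (chord_density p s) * f (slide p s) \<partial>lborel \<partial>lborel)
      = (\<integral>\<^sup>+s. \<integral>\<^sup>+p. ennreal (chord_density p s) * f (slide p s) \<partial>lborel \<partial>lborel)"
    by (rule nn_integral_lborel_swap) (simp add: borel_prod[symmetric, where 'a = "'a \<times> real"])
  also have "\<dots> = (\<integral>\<^sup>+s. \<integral>\<^sup>+p. ennreal (chord_density p (- s)) * f p \<partial>lborel \<partial>lborel)"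
  proof (rule nn_integral_cong)
    fix s
    have shift: "p + (s *\<^sub>R e, 0) = slide p s" "slide (slide p s) (- s) = p" for p
      by (simp_all add: slide_def prod_eq_iff)
    show "(\<integral>\<^sup>+p. ennreal (chord_density p s) * f (slide p s) \<partial>lborel)
        = (\<integral>\<^sup>+p. ennreal (chord_density p (- s)) * f p \<partial>lborel)"
      using lborel_nn_translate[of "\<lambda>p. ennreal (chord_density (slide p (- s)) s) * f p" "(s *\<^sub>R e, 0)"]
      by (simp only: shift chord_density_reverse) simp
  qed
  also have "\<dots> = (\<integral>\<^sup>+p. \<integral>\<^sup>+s. ennreal (chord_density p (- s)) * f p \<partial>lborel \<partial>lborel)"
    by (rule nn_integral_lborel_swap) (simp add: borel_prod[symmetric, where 'b = "'a \<times> real"])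
  also have "\<dots> = (\<integral>\<^sup>+p. indicator subgraph p * f p \<partial>lborel)"
  proof (rule nn_integral_cong_AE)
    show "AE p in lborel. (\<integral>\<^sup>+s. ennreal (chord_density p (- s)) * f p \<partial>lborel) = indicator subgraph p * f p"
      using AE_bounded_chord
      by eventually_elim (simp add: nn_integral_multc chord_density_integral)
  qed
  finally show ?thesis .
qed

lemma integral_chord_average:
  fixes f :: "'a \<times> real \<Rightarrow> real"
  assumes [measurable]: "f \<in> borel_measurable borel"
    and int: "integrable lborel (\<lambda>p. indicator subgraph p * f p)"
  shows "integrable lborel (\<lambda>p. LBINT s. chord_density p s * f (slide p s))"
    and "(LBINT p. LBINT s. chord_density p s * f (slide p s)) = (LBINT p. indicator subgraph p * f p)"
proof -
  have [measurable]: "subgraph \<in> sets borel" using open_subgraph by simp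
  define g where "g = (\<lambda>(p, s). chord_density p s * f (slide p s))"
  have [measurable]: "g \<in> borel_measurable (lborel \<Otimes>\<^sub>M lborel)"
    unfolding g_def by measurable
  have nn: "(\<integral>\<^sup>+z. ennreal (\<phi> (g z)) \<partial>(lborel \<Otimes>\<^sub>M lborel)) = (\<integral>\<^sup>+p. ennreal (\<phi> (indicator subgraph p * f p)) \<partial>lborel)"
    if [measurable]: "\<phi> \<in> borel_measurable borel" and \<phi>: "\<And>c x. 0 \<le> c \<Longrightarrow> \<phi> (c * x) = c * \<phi> x" for \<phi> :: "real \<Rightarrow> real"
  proof -
    have "(\<integral>\<^sup>+z. ennreal (\<phi> (g z)) \<partial>(lborel \<Otimes>\<^sub>M lborel)) = (\<integral>\<^sup>+p. \<integral>\<^sup>+s. ennreal (\<phi> (g (p, s))) \<partial>lborel \<partial>lborel)"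
      by (rule lborel.nn_integral_fst[symmetric]) measurable
    also have "\<dots> = (\<integral>\<^sup>+p. \<integral>\<^sup>+s. ennreal (chord_density p s) * ennreal (\<phi> (f (slide p s))) \<partial>lborel \<partial>lborel)"
      by (simp add: g_def \<phi> chord_density_nonneg ennreal_mult')
    also have "\<dots> = (\<integral>\<^sup>+p. indicator subgraph p * ennreal (\<phi> (f p)) \<partial>lborel)"
      by (rule nn_integral_chord_average) measurable
    also have "\<dots> = (\<integral>\<^sup>+p. ennreal (\<phi> (indicator subgraph p * f p)) \<partial>lborel)"
      by (intro nn_integral_cong) (simp add: \<phi> ennreal_mult' ennreal_indicator)
    finally show ?thesis .
  qed
  have gi: "integrable (lborel \<Otimes>\<^sub>M lborel) g"
    using int nn[of abs] by (simp add: integrable_iff_bounded abs_mult)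
  then show "integrable lborel (\<lambda>p. LBINT s. chord_density p s * f (slide p s))"
    using lborel_pair.integrable_fst'[of g] by (simp add: g_def)
  have "(LBINT p. LBINT s. chord_density p s * f (slide p s)) = (\<integral>z. g z \<partial>(lborel \<Otimes>\<^sub>M lborel))"
    using lborel_pair.integral_fst'[OF gi] by (simp add: g_def)
  also have "\<dots> = (LBINT p. indicator subgraph p * f p)"
    using nn[of "\<lambda>x. x"] nn[of uminus] gi int by (simp add: real_lebesgue_integral_def)
  finally show "(LBINT p. LBINT s. chord_density p s * f (slide p s)) = (LBINT p. indicator subgraph p * f p)" .
qed

end

section \<open>All chords in one direction have the same center\<close>

context level_lines
begin

lemma subgraph_sets[measurable]: "subgraph \<in> sets borel"
  using open_subgraph by simp

lemma nn_integral_subgraph: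
  fixes g :: "'a \<Rightarrow> ennreal"
  assumes [measurable]: "g \<in> borel_measurable borel"
  shows "(\<integral>\<^sup>+p. indicator subgraph p * g (fst p) \<partial>lborel) = (\<integral>\<^sup>+x. ennreal (\<rho> x) * g x \<partial>lborel)"
proof -
  have "(\<integral>\<^sup>+p. indicator subgraph p * g (fst p) \<partial>lborel)
      = (\<integral>\<^sup>+x. \<integral>\<^sup>+h. indicator subgraph (x, h) * g x \<partial>lborel \<partial>lborel)"
    using nn_integral_lborel_fst[of "\<lambda>x h. indicator subgraph (x, h) * g x"] by (simp add: case_prod_unfold)
  also have "\<dots> = (\<integral>\<^sup>+x. ennreal (\<rho> x) * g x \<partial>lborel)"
  proof (rule nn_integral_cong)
    fix x
    have "(\<integral>\<^sup>+h. indicator subgraph (x, h) * g x \<partial>lborel) = (\<integral>\<^sup>+h. g x * indicator {0<..<\<rho> x} h \<partial>lborel)"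
      by (intro nn_integral_cong) (auto simp: subgraph_def indicator_def)
    also have "\<dots> = g x * ennreal (\<rho> x)"
      using nonneg[of x] by (subst nn_integral_cmult_indicator) auto
    finally show "(\<integral>\<^sup>+h. indicator subgraph (x, h) * g x \<partial>lborel) = ennreal (\<rho> x) * g x"
      by (simp add: mult.commute)
  qed
  finally show ?thesis .
qed

text \<open>
  Both parts reduce to \<open>nn_integral_subgraph\<close> applied to the absolute value and to the positive and negative
  parts, all of which are positively homogeneous functions \<open>\<phi>\<close>.
\<close>

lemma integral_subgraph:
  fixes g :: "'a \<Rightarrow> real"
  assumes [measurable]: "g \<in> borel_measurable borel" and int: "integrable lborel (\<lambda>x. \<rho> x * g x)"
  shows "integrable lborel (\<lambda>p. indicator subgraph p * g (fst p))"
    and "(LBINT p. indicator subgraph p * g (fst p)) = (LBINT x. \<rho> x * g x)"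
proof -
  have nn: "(\<integral>\<^sup>+p. ennreal (\<phi> (indicator subgraph p * g (fst p))) \<partial>lborel) = (\<integral>\<^sup>+x. ennreal (\<phi> (\<rho> x * g x)) \<partial>lborel)"
    if [measurable]: "\<phi> \<in> borel_measurable borel" and \<phi>: "\<And>c x. 0 \<le> c \<Longrightarrow> \<phi> (c * x) = c * \<phi> x" for \<phi> :: "real \<Rightarrow> real"
    using nn_integral_subgraph[of "\<lambda>x. ennreal (\<phi> (g x))"]
    by (simp add: \<phi> nonneg ennreal_mult' ennreal_indicator)
  show i: "integrable lborel (\<lambda>p. indicator subgraph p * g (fst p))"
    using int nn[of abs] by (simp add: integrable_iff_bounded abs_mult)
  show "(LBINT p. indicator subgraph p * g (fst p)) = (LBINT x. \<rho> x * g x)"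
    using nn[of "\<lambda>x. x"] nn[of uminus] i int by (simp add: real_lebesgue_integral_def)
qed

lemma chord_density_eq_0: "s \<notin> chord p \<Longrightarrow> chord_density p s = 0"
  by (simp add: chord_density_def)

text \<open>
  Only the component of \<open>fst p - fst q\<close> along \<open>e\<close> matters for the order of the centers; the
  orthogonal component \<open>z\<close> is a parameter of the one-dimensional kernel \<open>\<kappa>\<close>. That kernel is locally
  bounded when the two lines are distinct. When they coincide the bound has to come from \<open>k\<close>
  itself, as in dimension one.
\<close>

lemma mutual_force_sign:
  fixes k :: "'a \<Rightarrow> real"
  assumes [measurable]: "k \<in> borel_measurable borel"
    and reflect: "\<And>z. k (z - (2 * (z \<bullet> e)) *\<^sub>R e) = - k z"
    and pos: "\<And>z. 0 < z \<bullet> e \<Longrightarrow> 0 < k z"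
    and kcont: "continuous_on (- {0}) k"
    and adm: "(\<forall>t. fst p - fst q + t *\<^sub>R e \<noteq> 0) \<or> (\<exists>B. \<forall>z. \<bar>k z\<bar> \<le> B)"
    and p: "bounded_chord p" and q: "bounded_chord q"
  defines "\<Gamma> \<equiv> (LBINT s. chord_density p s * (LBINT t. chord_density q t * k (fst p + s *\<^sub>R e - (fst q + t *\<^sub>R e))))"
  shows "chord_center q < chord_center p \<Longrightarrow> 0 < \<Gamma>" and "chord_center p < chord_center q \<Longrightarrow> \<Gamma> < 0"
proof -
  obtain a b where ab: "a < 0" "0 < b" "chord p = {a<..<b}"
    using p by (auto simp: bounded_chord_def)
  obtain a' b' where ab': "a' < 0" "0 < b'" "chord q = {a'<..<b'}"
    using q by (auto simp: bounded_chord_def)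
  have ee: "e \<bullet> e = 1" using norm_e by (simp add: norm_eq_1)
  define \<zeta> where "\<zeta> = (fst p - fst q) \<bullet> e"
  define z where "z = fst p - fst q - \<zeta> *\<^sub>R e"
  have ze: "z \<bullet> e = 0" by (simp add: z_def \<zeta>_def inner_diff_left ee)
  define \<kappa> where "\<kappa> u = k (z + u *\<^sub>R e)" for u
  have [measurable]: "\<kappa> \<in> borel_measurable borel" unfolding \<kappa>_def by measurable
  have \<kappa>_odd: "\<kappa> (- u) = - \<kappa> u" for u
  proof -
    have "z + u *\<^sub>R e - (2 * ((z + u *\<^sub>R e) \<bullet> e)) *\<^sub>R e = z + (- u) *\<^sub>R e"
      by (simp add: inner_add_left ze ee algebra_simps) (simp flip: scaleR_left_distrib)
    with reflect[of "z + u *\<^sub>R e"] show ?thesis by (simp add: \<kappa>_def)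
  qed
  have \<kappa>_pos: "0 < \<kappa> u" if "0 < u" for u
    using that by (auto simp: \<kappa>_def inner_add_left ze ee intro!: pos)
  have line_cont: "continuous_on A \<kappa>" if "\<And>u. u \<in> A \<Longrightarrow> z + u *\<^sub>R e \<noteq> 0" for A
    unfolding \<kappa>_def by (rule continuous_on_compose2[OF kcont]) (use that in \<open>auto intro!: continuous_intros\<close>)
  have \<kappa>_cont: "continuous_on {0<..} \<kappa>"
  proof (rule line_cont)
    fix u :: real assume "u \<in> {0<..}"
    then have "(z + u *\<^sub>R e) \<bullet> e \<noteq> 0" by (simp add: inner_add_left ze ee)
    then show "z + u *\<^sub>R e \<noteq> 0" by auto
  qed
  have \<kappa>_bd: "\<exists>B. \<forall>u. \<bar>u\<bar> \<le> R \<longrightarrow> \<bar>\<kappa> u\<bar> \<le> B" for R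
    using adm
  proof
    assume *: "\<forall>t. fst p - fst q + t *\<^sub>R e \<noteq> 0"
    have "continuous_on {- R..R} \<kappa>"
    proof (rule line_cont)
      fix u
      show "z + u *\<^sub>R e \<noteq> 0"
        using *[rule_format, of "u - \<zeta>"] by (simp add: z_def algebra_simps)
    qed
    then have "bounded (\<kappa> ` {- R..R})"
      by (intro compact_imp_bounded compact_continuous_image) auto
    then obtain B where "\<forall>v\<in>\<kappa> ` {- R..R}. norm v \<le> B" unfolding bounded_iff by blast
    then show ?thesis by (intro exI[of _ B]) (auto simp: abs_le_iff minus_le_iff)
  qed (auto simp: \<kappa>_def)
  have len: "chord_length p = b - a" "chord_length q = b' - a'"
    by (simp_all add: bounded_chord_bounds(1)[OF ab] bounded_chord_bounds(1)[OF ab'])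
  define Q where "Q = (LBINT s. indicator {a + \<zeta><..<b + \<zeta>} s * (LBINT t. indicator {a'<..<b'} t * \<kappa> (s - t)))"
  have \<Gamma>: "\<Gamma> = Q / ((b - a) * (b' - a'))"
  proof -
    have arg: "k (fst p + s *\<^sub>R e - (fst q + t *\<^sub>R e)) = \<kappa> (s + \<zeta> - t)" for s t
      by (simp add: \<kappa>_def z_def algebra_simps)
    have "\<Gamma> = (LBINT s. indicator {a<..<b} s / (b - a) * (LBINT t. indicator {a'<..<b'} t / (b' - a') * \<kappa> (s + \<zeta> - t)))"
      unfolding \<Gamma>_def by (simp add: chord_density_def len ab ab' arg)
    also have "\<dots> = (LBINT s. indicator {a<..<b} s * (LBINT t. indicator {a'<..<b'} t * \<kappa> (s + \<zeta> - t))) / ((b - a) * (b' - a'))"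
      by (simp add: mult_ac)
    also have "(LBINT s. indicator {a<..<b} s * (LBINT t. indicator {a'<..<b'} t * \<kappa> (s + \<zeta> - t))) = Q"
      unfolding Q_def
      using lborel_translate(1)[of "\<lambda>s. indicator {a + \<zeta><..<b + \<zeta>} s * (LBINT t. indicator {a'<..<b'} t * \<kappa> (s - t))" \<zeta>]
      by (simp add: indicator_def)
    finally show ?thesis .
  qed
  have d: "0 < (b - a) * (b' - a')" using ab ab' by simp
  have cc: "chord_center p - chord_center q = ((a + \<zeta>) + (b + \<zeta>) - (a' + b')) / 2"
    by (simp add: bounded_chord_bounds(2)[OF ab] bounded_chord_bounds(2)[OF ab'] \<zeta>_def inner_diff_left field_simps)
  note force = interval_pair_force[OF _ \<kappa>_odd \<kappa>_pos \<kappa>_cont \<kappa>_bd, of "a + \<zeta>" "b + \<zeta>" a' b', folded Q_def]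
  show "0 < \<Gamma>" if "chord_center q < chord_center p"
    using force(1) that cc d ab ab' by (simp add: \<Gamma>)
  show "\<Gamma> < 0" if "chord_center p < chord_center q"
    using force(2) that cc d ab ab' by (simp add: \<Gamma> divide_neg_pos)
qed

text \<open>
  The exceptional points lie in a hyperplane that contains the line through \<open>y\<close> in direction \<open>e\<close>.
\<close>

lemma AE_not_collinear:
  assumes "2 \<le> DIM('a)"
  shows "AE p in lborel. \<forall>t. fst (p :: 'a \<times> real) - y + t *\<^sub>R e \<noteq> 0"
proof -
  obtain n :: 'a where n: "n \<noteq> 0" "e \<bullet> n = 0"
    using orthogonal_to_vector_exists[OF assms, of e] by (auto simp: orthogonal_def)
  have "negligible {p :: 'a \<times> real. (n, 0) \<bullet> p = n \<bullet> y}"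
    using n by (intro negligible_hyperplane) (simp add: zero_prod_def)
  then have "AE p in lborel. p \<notin> {p :: 'a \<times> real. (n, 0) \<bullet> p = n \<bullet> y}"
    by (intro AE_not_in) (simp add: negligible_iff_null_sets null_sets_completion_iff)
  then show ?thesis
  proof eventually_elim
    case (elim p)
    have "(fst p - y + t *\<^sub>R e) \<bullet> n \<noteq> 0" for t
      using elim n by (cases p) (auto simp: inner_add_left inner_diff_left inner_commute[of n])
    then show ?case by (metis inner_zero_left)
  qed
qed

text \<open>
  The function \<open>C\<close> plays the role of \<open>V\<close> in the introduction: the arctangent is strictly increasing,
  and bounded so that all integrals converge absolutely. Averaging the skew-symmetric
  double integral of \<open>F\<close> first over the chord of \<open>q\<close> (giving \<open>F1\<close>) and then over the chord of \<open>p\<close>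
  (giving \<open>\<Gamma>\<close>) leaves its value \<open>0\<close> unchanged and produces an integrand of constant sign.
\<close>

lemma chord_centers_agree:
  fixes k :: "'a \<Rightarrow> real"
  assumes [measurable]: "k \<in> borel_measurable borel"
    and odd: "\<And>z. k (- z) = - k z"
    and reflect: "\<And>z. k (z - (2 * (z \<bullet> e)) *\<^sub>R e) = - k z"
    and pos: "\<And>z. 0 < z \<bullet> e \<Longrightarrow> 0 < k z"
    and kcont: "continuous_on (- {0}) k"
    and kbd: "DIM('a) = 1 \<Longrightarrow> \<exists>B. \<forall>z. \<bar>k z\<bar> \<le> B"
    and conv: "\<And>x. (\<integral>\<^sup>+y. ennreal (\<rho> y * \<bar>k (x - y)\<bar>) \<partial>lborel) \<le> ennreal B" and "0 \<le> B"
    and balance: "AE p in lborel. p \<in> subgraph \<longrightarrow>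
       (LBINT s. chord_density p s * (LBINT y. \<rho> y * k (fst p + s *\<^sub>R e - y))) = 0"
  shows "\<exists>c. AE p in lborel. p \<in> subgraph \<longrightarrow> chord_center p = c"
proof -
  define i where "i = (indicator subgraph :: 'a \<times> real \<Rightarrow> real)"
  define C where "C p = arctan (chord_center p)" for p
  have [measurable]: "i \<in> borel_measurable borel" "C \<in> borel_measurable borel"
    unfolding i_def C_def by measurable
  have i01: "0 \<le> i p" "i p \<le> 1" for p by (simp_all add: i_def indicator_def)
  have C2: "\<bar>C p\<bar> \<le> 2" for p
    using arctan_bounded[of "chord_center p"] pi_less_4 by (simp add: C_def abs_le_iff)
  define G where "G x = (LBINT y. \<rho> y * k (x - y))" for x
  have [measurable]: "G \<in> borel_measurable borel" unfolding G_def by measurable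
  have rk_int: "integrable lborel (\<lambda>y. \<rho> y * k (x - y))" for x
  proof -
    have "(\<integral>\<^sup>+y. ennreal (norm (\<rho> y * k (x - y))) \<partial>lborel) \<le> ennreal B"
      using conv[of x] by (simp add: abs_mult nonneg)
    then show ?thesis by (intro integrableI_bounded) (auto intro: le_less_trans)
  qed
  have G_bd: "\<bar>G x\<bar> \<le> B" for x
  proof -
    have "ennreal (norm (G x)) \<le> (\<integral>\<^sup>+y. ennreal (norm (\<rho> y * k (x - y))) \<partial>lborel)"
      unfolding G_def by (rule integral_norm_bound_ennreal[OF rk_int])
    also have "\<dots> \<le> ennreal B" using conv[of x] by (simp add: abs_mult nonneg)
    finally show ?thesis using \<open>0 \<le> B\<close> by simp
  qed
  have ik: "integrable lborel (\<lambda>q. i q * k (x - fst q))" "(LBINT q. i q * k (x - fst q)) = G x" for x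
    using integral_subgraph[of "\<lambda>y. k (x - y)", OF _ rk_int] by (simp_all add: i_def G_def)
  have i_int: "integrable lborel i"
    using integral_subgraph(1)[of "\<lambda>x. 1"] integrable_rho by (simp add: i_def)
  have i_nn: "(\<integral>\<^sup>+p. ennreal (i p) \<partial>lborel) < \<infinity>"
    using i_int i01 by (simp add: integrable_iff_bounded)
  have ik_nn: "(\<integral>\<^sup>+q. ennreal (i q * \<bar>k (x - fst q)\<bar>) \<partial>lborel) \<le> ennreal B" for x
  proof -
    have "(\<integral>\<^sup>+q. ennreal (i q * \<bar>k (x - fst q)\<bar>) \<partial>lborel) = (\<integral>\<^sup>+q. indicator subgraph q * ennreal \<bar>k (x - fst q)\<bar> \<partial>lborel)"
      by (simp add: i_def ennreal_mult' ennreal_indicator)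
    also have "\<dots> = (\<integral>\<^sup>+y. ennreal (\<rho> y) * ennreal \<bar>k (x - y)\<bar> \<partial>lborel)"
      by (rule nn_integral_subgraph) measurable
    finally show ?thesis using conv[of x] by (simp add: ennreal_mult' nonneg)
  qed
  have center_const: "C (slide p s) = C p" if "bounded_chord p" "s \<in> chord p" for p s
    using bounded_chord_slide[OF that] by (simp add: C_def)
  \<comment> \<open>The force on each chord has mean zero and \<open>C\<close> is constant on the chord, so the weighted sum of
    all forces vanishes.\<close>
  have work: "(LBINT p. i p * (C p * G (fst p))) = 0"
  proof -
    have int: "integrable lborel (\<lambda>p. indicator subgraph p * (C p * G (fst p)))"
    proof (rule Bochner_Integration.integrable_bound[OF integrable_mult_left[OF i_int, of "2 * B"]])
      show "AE p in lborel. norm (indicator subgraph p * (C p * G (fst p))) \<le> norm (i p * (2 * B))"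
        using mult_mono[OF C2 G_bd] \<open>0 \<le> B\<close> by (auto simp: i_def abs_mult indicator_def intro!: AE_I2)
    qed measurable
    have "(LBINT p. LBINT s. chord_density p s * (C (slide p s) * G (fst (slide p s))))
        = (\<integral>p. 0 \<partial>(lborel :: ('a \<times> real) measure))"
    proof (rule integral_cong_AE)
      show "AE p in lborel. (LBINT s. chord_density p s * (C (slide p s) * G (fst (slide p s)))) = 0"
        using balance AE_bounded_chord
      proof eventually_elim
        case (elim p)
        have "(LBINT s. chord_density p s * (C (slide p s) * G (fst (slide p s))))
            = (LBINT s. C p * (chord_density p s * G (fst p + s *\<^sub>R e)))"
        proof (rule Bochner_Integration.integral_cong)
          fix s
          show "chord_density p s * (C (slide p s) * G (fst (slide p s))) = C p * (chord_density p s * G (fst p + s *\<^sub>R e))"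
            using elim(2) center_const[of p s] chord_subgraph[of s p] chord_density_eq_0[of s p]
            by (cases "s \<in> chord p") (auto simp: slide_def)
        qed simp
        also have "\<dots> = 0"
        proof (cases "p \<in> subgraph")
          case False
          then have "chord_density p s = 0" for s using chord_subgraph chord_density_eq_0 by blast
          then show ?thesis by simp
        qed (use elim(1) in \<open>simp add: G_def\<close>)
        finally show ?case .
      qed
    qed measurable
    then show ?thesis
      using integral_chord_average(2)[OF _ int] by (simp add: i_def)
  qed
  define F where "F p q = (C p - C q) * k (fst p - fst q)" for p q
  have F_le: "\<bar>F p q\<bar> \<le> 4 * \<bar>k (fst p - fst q)\<bar>" for p q
  proof -
    have "\<bar>C p - C q\<bar> \<le> 4" using C2[of p] C2[of q] by linarith
    then show ?thesis by (simp add: F_def abs_mult mult_right_mono)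
  qed
  have F_meas[measurable]: "(\<lambda>x. F (f x) (g x)) \<in> borel_measurable M"
    if [measurable]: "f \<in> borel_measurable M" "g \<in> borel_measurable M" for f g and M :: "'m measure"
    unfolding F_def by measurable
  have double_nn: "(\<integral>\<^sup>+p. \<integral>\<^sup>+q. ennreal (i p * (i q * \<bar>k (fst p - fst q)\<bar>)) \<partial>lborel \<partial>lborel) < \<infinity>"
  proof -
    have "(\<integral>\<^sup>+p. \<integral>\<^sup>+q. ennreal (i p * (i q * \<bar>k (fst p - fst q)\<bar>)) \<partial>lborel \<partial>lborel)
        = (\<integral>\<^sup>+p. ennreal (i p) * (\<integral>\<^sup>+q. ennreal (i q * \<bar>k (fst p - fst q)\<bar>) \<partial>lborel) \<partial>lborel)"
      using i01 by (simp add: ennreal_mult' nn_integral_cmult)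
    also have "\<dots> \<le> (\<integral>\<^sup>+p. ennreal (i p) * ennreal B \<partial>lborel)"
      by (intro nn_integral_mono mult_left_mono ik_nn) simp
    also have "\<dots> < \<infinity>"
      using i_nn by (simp add: nn_integral_multc ennreal_mult_less_top)
    finally show ?thesis .
  qed
  have pair_int: "integrable (lborel \<Otimes>\<^sub>M lborel) (case_prod h)"
    if [measurable]: "case_prod h \<in> borel_measurable (lborel \<Otimes>\<^sub>M lborel)"
      and fin: "(\<integral>\<^sup>+p. \<integral>\<^sup>+q. ennreal \<bar>h p q\<bar> \<partial>lborel \<partial>lborel) < \<infinity>" for h :: "'a \<times> real \<Rightarrow> 'a \<times> real \<Rightarrow> real"
  proof (rule integrableI_bounded)
    show "(\<integral>\<^sup>+z. ennreal (norm (case_prod h z)) \<partial>(lborel \<Otimes>\<^sub>M lborel)) < \<infinity>"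
      using fin by (subst lborel.nn_integral_fst[symmetric]) auto
  qed measurable
  \<comment> \<open>exchanging \<open>p\<close> and \<open>q\<close> changes the sign of \<open>k\<close>, so both halves of \<open>F\<close> reduce to \<open>work\<close>\<close>
  have skew_zero: "(LBINT p. LBINT q. i p * (i q * F p q)) = 0"
  proof -
    have fin: "(\<integral>\<^sup>+p. \<integral>\<^sup>+q. ennreal \<bar>i p * (i q * (c p q * k (fst p - fst q)))\<bar> \<partial>lborel \<partial>lborel) < \<infinity>"
      if "\<And>p q. \<bar>c p q\<bar> \<le> 2" for c
    proof -
      have "(\<integral>\<^sup>+p. \<integral>\<^sup>+q. ennreal \<bar>i p * (i q * (c p q * k (fst p - fst q)))\<bar> \<partial>lborel \<partial>lborel)
         \<le> (\<integral>\<^sup>+p. \<integral>\<^sup>+q. ennreal 2 * ennreal (i p * (i q * \<bar>k (fst p - fst q)\<bar>)) \<partial>lborel \<partial>lborel)"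
      proof (intro nn_integral_mono)
        fix p q
        have "\<bar>c p q\<bar> * (i p * (i q * \<bar>k (fst p - fst q)\<bar>)) \<le> 2 * (i p * (i q * \<bar>k (fst p - fst q)\<bar>))"
          using that i01 by (intro mult_right_mono) auto
        then show "ennreal \<bar>i p * (i q * (c p q * k (fst p - fst q)))\<bar> \<le> ennreal 2 * ennreal (i p * (i q * \<bar>k (fst p - fst q)\<bar>))"
          using i01 by (subst ennreal_mult'[symmetric]) (auto simp: abs_mult mult_ac intro!: ennreal_leI)
      qed
      also have "\<dots> < \<infinity>"
        using double_nn by (simp add: nn_integral_cmult ennreal_mult_less_top)
      finally show ?thesis .
    qed
    have i1: "integrable (lborel \<Otimes>\<^sub>M lborel) (\<lambda>(p, q). i p * (i q * (C p * k (fst p - fst q))))"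
      by (rule pair_int[OF _ fin]) (auto simp: C2)
    have i2: "integrable (lborel \<Otimes>\<^sub>M lborel) (\<lambda>(p, q). i p * (i q * (C q * k (fst p - fst q))))"
      by (rule pair_int[OF _ fin]) (auto simp: C2)
    have "(LBINT p. LBINT q. i p * (i q * (C p * k (fst p - fst q)))) = (LBINT p. i p * (C p * G (fst p)))"
    proof (rule Bochner_Integration.integral_cong)
      fix p
      have "(LBINT q. i p * (i q * (C p * k (fst p - fst q)))) = (LBINT q. (i p * C p) * (i q * k (fst p - fst q)))"
        by (simp add: mult_ac)
      then show "(LBINT q. i p * (i q * (C p * k (fst p - fst q)))) = i p * (C p * G (fst p))"
        by (simp add: ik)
    qed simp
    moreover have "(LBINT p. LBINT q. i p * (i q * (C q * k (fst p - fst q))))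
        = (LBINT q. - (i q * (C q * G (fst q))))"
    proof -
      have "(LBINT p. LBINT q. i p * (i q * (C q * k (fst p - fst q))))
         = (LBINT q. LBINT p. i p * (i q * (C q * k (fst p - fst q))))"
        using lborel_pair.Fubini_integral[OF i2] by simp
      also have "\<dots> = (LBINT q. - (i q * (C q * G (fst q))))"
      proof (rule Bochner_Integration.integral_cong)
        fix q
        have "i p * (i q * (C q * k (fst p - fst q))) = (- (i q * C q)) * (i p * k (fst q - fst p))" for p
          using odd[of "fst q - fst p"] by simp
        then show "(LBINT p. i p * (i q * (C q * k (fst p - fst q)))) = - (i q * (C q * G (fst q)))"
          by (simp add: ik del: minus_mult_minus)
      qed simp
      finally show ?thesis .
    qed
    moreover have "(LBINT p. LBINT q. i p * (i q * F p q))
        = (LBINT p. LBINT q. i p * (i q * (C p * k (fst p - fst q))))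
        - (LBINT p. LBINT q. i p * (i q * (C q * k (fst p - fst q))))"
    proof -
      have "(LBINT p. LBINT q. i p * (i q * F p q))
         = (\<integral>z. (case z of (p, q) \<Rightarrow> i p * (i q * (C p * k (fst p - fst q)))) - (case z of (p, q) \<Rightarrow> i p * (i q * (C q * k (fst p - fst q)))) \<partial>(lborel \<Otimes>\<^sub>M lborel))"
        using lborel_pair.integral_fst'[OF Bochner_Integration.integrable_diff[OF i1 i2]]
        by (simp add: F_def algebra_simps)
      also have "\<dots> = (\<integral>z. (case z of (p, q) \<Rightarrow> i p * (i q * (C p * k (fst p - fst q)))) \<partial>(lborel \<Otimes>\<^sub>M lborel))
          - (\<integral>z. (case z of (p, q) \<Rightarrow> i p * (i q * (C q * k (fst p - fst q)))) \<partial>(lborel \<Otimes>\<^sub>M lborel))"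
        by (rule Bochner_Integration.integral_diff[OF i1 i2])
      finally show ?thesis
        using lborel_pair.integral_fst'[OF i1] lborel_pair.integral_fst'[OF i2] by simp
    qed
    ultimately show ?thesis using work by simp
  qed
  define F1 where "F1 p q = (LBINT t. chord_density q t * F p (slide q t))" for p q
  have F1_meas[measurable]: "(\<lambda>x. F1 (f x) (g x)) \<in> borel_measurable M"
    if [measurable]: "f \<in> borel_measurable M" "g \<in> borel_measurable M" for f g and M :: "'m measure"
    unfolding F1_def by measurable
  have iF_int: "integrable lborel (\<lambda>q. indicator subgraph q * F p q)" for p
  proof (rule Bochner_Integration.integrable_bound[OF integrable_mult_right[OF ik(1)[of "fst p"], of 4]])
    show "AE q in lborel. norm (indicator subgraph q * F p q) \<le> norm (4 * (i q * k (fst p - fst q)))"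
      using F_le[of p] by (auto simp: i_def abs_mult indicator_def intro!: AE_I2)
  qed measurable
  have F1_avg: "(LBINT q. F1 p q) = (LBINT q. i q * F p q)" for p
    unfolding F1_def i_def by (rule integral_chord_average(2)[OF _ iF_int]) measurable
  have F1_int: "integrable (lborel \<Otimes>\<^sub>M lborel) (\<lambda>(p, q). i p * F1 p q)"
  proof (rule pair_int)
    have "(\<integral>\<^sup>+p. \<integral>\<^sup>+q. ennreal \<bar>i p * F1 p q\<bar> \<partial>lborel \<partial>lborel)
        \<le> (\<integral>\<^sup>+p. ennreal (i p) * (\<integral>\<^sup>+q. ennreal \<bar>F1 p q\<bar> \<partial>lborel) \<partial>lborel)"
      using i01 by (simp add: abs_mult ennreal_mult' nn_integral_cmult)
    also have "\<dots> \<le> (\<integral>\<^sup>+p. ennreal (i p) * (\<integral>\<^sup>+q. indicator subgraph q * ennreal \<bar>F p q\<bar> \<partial>lborel) \<partial>lborel)"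
    proof (rule nn_integral_mono, rule mult_left_mono)
      fix p
      have "(\<integral>\<^sup>+q. ennreal \<bar>F1 p q\<bar> \<partial>lborel)
          \<le> (\<integral>\<^sup>+q. \<integral>\<^sup>+t. ennreal (chord_density q t) * ennreal \<bar>F p (slide q t)\<bar> \<partial>lborel \<partial>lborel)"
      proof (rule nn_integral_mono)
        fix q
        show "ennreal \<bar>F1 p q\<bar> \<le> (\<integral>\<^sup>+t. ennreal (chord_density q t) * ennreal \<bar>F p (slide q t)\<bar> \<partial>lborel)"
        proof (cases "integrable lborel (\<lambda>t. chord_density q t * F p (slide q t))")
          case True
          from integral_norm_bound_ennreal[OF True] show ?thesis
            by (simp add: F1_def abs_mult chord_density_nonneg ennreal_mult')
        qed (simp add: F1_def not_integrable_integral_eq)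
      qed
      also have "\<dots> = (\<integral>\<^sup>+q. indicator subgraph q * ennreal \<bar>F p q\<bar> \<partial>lborel)"
        by (rule nn_integral_chord_average) measurable
      finally show "(\<integral>\<^sup>+q. ennreal \<bar>F1 p q\<bar> \<partial>lborel) \<le> (\<integral>\<^sup>+q. indicator subgraph q * ennreal \<bar>F p q\<bar> \<partial>lborel)" .
    qed simp
    also have "\<dots> \<le> (\<integral>\<^sup>+p. ennreal (i p) * (ennreal 4 * ennreal B) \<partial>lborel)"
    proof (rule nn_integral_mono, rule mult_left_mono)
      fix p
      have "(\<integral>\<^sup>+q. indicator subgraph q * ennreal \<bar>F p q\<bar> \<partial>lborel)
         \<le> (\<integral>\<^sup>+q. ennreal 4 * ennreal (i q * \<bar>k (fst p - fst q)\<bar>) \<partial>lborel)"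
      proof (rule nn_integral_mono)
        fix q
        show "indicator subgraph q * ennreal \<bar>F p q\<bar> \<le> ennreal 4 * ennreal (i q * \<bar>k (fst p - fst q)\<bar>)"
        proof -
          have "ennreal \<bar>F p q\<bar> \<le> ennreal (4 * \<bar>k (fst p - fst q)\<bar>)"
            using F_le[of p q] by (rule ennreal_leI)
          also have "\<dots> = ennreal 4 * ennreal \<bar>k (fst p - fst q)\<bar>"
            by (rule ennreal_mult') simp
          finally show ?thesis by (simp add: i_def indicator_def)
        qed
      qed
      also have "\<dots> \<le> ennreal 4 * ennreal B"
        using ik_nn[of "fst p"] by (simp add: nn_integral_cmult mult_left_mono)
      finally show "(\<integral>\<^sup>+q. indicator subgraph q * ennreal \<bar>F p q\<bar> \<partial>lborel) \<le> ennreal 4 * ennreal B" .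
    qed simp
    also have "\<dots> < \<infinity>"
      using i_nn by (simp add: nn_integral_multc ennreal_mult_less_top)
    finally show "(\<integral>\<^sup>+p. \<integral>\<^sup>+q. ennreal \<bar>i p * F1 p q\<bar> \<partial>lborel \<partial>lborel) < \<infinity>" .
  qed measurable
  define \<Gamma> where "\<Gamma> p q = (LBINT s. chord_density p s * F1 (slide p s) q)" for p q
  have F1_swap: "(LBINT q. LBINT p. i p * F1 p q) = 0"
  proof -
    have "(LBINT q. LBINT p. i p * F1 p q) = (LBINT p. LBINT q. i p * F1 p q)"
      using lborel_pair.Fubini_integral[OF F1_int] by simp
    also have "\<dots> = (LBINT p. LBINT q. i p * (i q * F p q))"
      by (simp add: F1_avg)
    finally show ?thesis using skew_zero by simp
  qed
  have \<Gamma>_eq: "\<Gamma> p q = (C p - C q) * (LBINT s. chord_density p s * (LBINT t. chord_density q t * k (fst p + s *\<^sub>R e - (fst q + t *\<^sub>R e))))"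
    if pq: "bounded_chord p" "bounded_chord q" for p q
  proof -
    have F1_eq: "F1 (slide p s) q = (C p - C q) * (LBINT t. chord_density q t * k (fst p + s *\<^sub>R e - (fst q + t *\<^sub>R e)))"
      if "s \<in> chord p" for s
    proof -
      have "F1 (slide p s) q = (LBINT t. (C p - C q) * (chord_density q t * k (fst p + s *\<^sub>R e - (fst q + t *\<^sub>R e))))"
        unfolding F1_def
      proof (rule Bochner_Integration.integral_cong)
        fix t
        show "chord_density q t * F (slide p s) (slide q t) = (C p - C q) * (chord_density q t * k (fst p + s *\<^sub>R e - (fst q + t *\<^sub>R e)))"
          using center_const[OF pq(1) that] center_const[OF pq(2), of t] chord_density_eq_0[of t q]
          by (cases "t \<in> chord q") (simp_all add: F_def slide_def)
      qed simp
      then show ?thesis by simp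
    qed
    have "\<Gamma> p q = (LBINT s. (C p - C q) * (chord_density p s * (LBINT t. chord_density q t * k (fst p + s *\<^sub>R e - (fst q + t *\<^sub>R e)))))"
      unfolding \<Gamma>_def
    proof (rule Bochner_Integration.integral_cong)
      fix s
      show "chord_density p s * F1 (slide p s) q = (C p - C q) * (chord_density p s * (LBINT t. chord_density q t * k (fst p + s *\<^sub>R e - (fst q + t *\<^sub>R e))))"
        using F1_eq[of s] chord_density_eq_0[of s p] by (cases "s \<in> chord p") simp_all
    qed simp
    then show ?thesis by simp
  qed
  have \<Gamma>_sign: "0 \<le> \<Gamma> p q" "\<Gamma> p q = 0 \<Longrightarrow> chord_center p = chord_center q"
    if pq: "bounded_chord p" "bounded_chord q"
      and adm: "(\<forall>t. fst p - fst q + t *\<^sub>R e \<noteq> 0) \<or> (\<exists>B. \<forall>z. \<bar>k z\<bar> \<le> B)" for p q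
  proof -
    note sign = mutual_force_sign[OF assms(1) reflect _ kcont adm pq]
    consider "chord_center p = chord_center q" | "chord_center q < chord_center p" | "chord_center p < chord_center q"
      by linarith
    then have "0 \<le> \<Gamma> p q \<and> (\<Gamma> p q = 0 \<longrightarrow> chord_center p = chord_center q)"
    proof cases
      case 2
      then have "0 < C p - C q" by (simp add: C_def arctan_less_iff)
      moreover note sign(1)[OF pos 2]
      ultimately show ?thesis by (simp add: \<Gamma>_eq[OF pq])
    next
      case 3
      then have "C p - C q < 0" by (simp add: C_def arctan_less_iff)
      moreover note sign(2)[OF pos 3]
      ultimately show ?thesis by (simp add: \<Gamma>_eq[OF pq] zero_le_mult_iff)
    qed (simp add: \<Gamma>_eq[OF pq] C_def)
    then show "0 \<le> \<Gamma> p q" "\<Gamma> p q = 0 \<Longrightarrow> chord_center p = chord_center q" by auto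
  qed
  have \<Gamma>_outside: "\<Gamma> p q = 0" if "p \<notin> subgraph \<or> q \<notin> subgraph" for p q
  proof -
    have density_zero: "chord_density p' s = 0" if "p' \<notin> subgraph" for p' s
      using that chord_subgraph chord_density_eq_0 by blast
    have force_zero: "chord_density p s * F1 (slide p s) q = 0" for s
      using that density_zero[of p s] density_zero[of q] by (auto simp: F1_def)
    show ?thesis unfolding \<Gamma>_def force_zero by simp
  qed
  have AE_adm: "AE p :: 'a \<times> real in lborel. (\<forall>t. fst p - fst q + t *\<^sub>R e \<noteq> 0) \<or> (\<exists>B. \<forall>z. \<bar>k z\<bar> \<le> B)" for q :: "'a \<times> real"
  proof (cases "DIM('a) = 1")
    case True
    then show ?thesis using kbd by simp
  next
    case False
    then have "2 \<le> DIM('a)" using DIM_positive[where 'a = 'a] by linarith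
    from AE_not_collinear[OF this, of "fst q"] show ?thesis
      by eventually_elim simp
  qed
  have \<Gamma>_AE_nonneg: "AE p in lborel. 0 \<le> \<Gamma> p q" if "q \<in> subgraph \<longrightarrow> bounded_chord q" for q
    using AE_adm[of q] AE_bounded_chord
  proof eventually_elim
    case (elim p)
    show ?case
    proof (cases "p \<in> subgraph \<and> q \<in> subgraph")
      case True
      with elim that show ?thesis by (intro \<Gamma>_sign(1)) auto
    qed (use \<Gamma>_outside[of p q] in auto)
  qed
  have F1_int_q: "AE q in lborel. integrable lborel (\<lambda>p. i p * F1 p q)"
    using lborel_pair.AE_integrable_snd[OF F1_int] by simp
  have \<Gamma>_int: "integrable lborel (\<lambda>p. \<Gamma> p q)" "(LBINT p. \<Gamma> p q) = (LBINT p. i p * F1 p q)"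
    if "integrable lborel (\<lambda>p. i p * F1 p q)" for q
    using integral_chord_average[of "\<lambda>p. F1 p q"] that by (simp_all add: \<Gamma>_def i_def)
  have "AE q in lborel. (LBINT p. i p * F1 p q) = 0"
  proof (subst integral_nonneg_eq_0_iff_AE[symmetric])
    show "integrable lborel (\<lambda>q. LBINT p. i p * F1 p q)"
      using lborel_pair.integrable_snd[OF F1_int] by simp
    show "AE q in lborel. 0 \<le> (LBINT p. i p * F1 p q)"
      using F1_int_q AE_bounded_chord
    proof eventually_elim
      case (elim q)
      then show ?case
        using \<Gamma>_int(2)[OF elim(1)] integral_nonneg_AE[OF \<Gamma>_AE_nonneg[OF elim(2)]] by simp
    qed
  qed (rule F1_swap)
  then have agree: "AE q in lborel. q \<in> subgraph \<longrightarrow> (AE p in lborel. p \<in> subgraph \<longrightarrow> chord_center p = chord_center q)"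
    using F1_int_q AE_bounded_chord
  proof eventually_elim
    case (elim q)
    show ?case
    proof
      assume q: "q \<in> subgraph"
      have "AE p in lborel. \<Gamma> p q = 0"
        using elim \<Gamma>_int[of q] \<Gamma>_AE_nonneg[of q] by (subst integral_nonneg_eq_0_iff_AE[symmetric]) auto
      then show "AE p in lborel. p \<in> subgraph \<longrightarrow> chord_center p = chord_center q"
        using AE_adm[of q] AE_bounded_chord
        by eventually_elim (use q elim(3) \<Gamma>_sign(2)[of _ q] in blast)
    qed
  qed
  show ?thesis
  proof (cases "subgraph = {}")
    case False
    from AE_imp_ex_in_open[OF agree open_subgraph this] show ?thesis by blast
  qed simp
qed

end

section \<open>From symmetry in every direction to radial symmetry\<close>

context level_lines
begin

text \<open>
  The values of \<open>\<rho>\<close> at both ends of a chord are equal to its height, so \<open>integral_log_derivative_zero\<close>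
  applies on every chord of every line on which the integrated equation holds.
\<close>

lemma mean_force_zero:
  fixes G :: "'a \<Rightarrow> real"
  assumes [measurable]: "G \<in> borel_measurable borel" and bd: "\<And>x. \<bar>G x\<bar> \<le> B"
    and \<rho>M: "\<And>x. \<rho> x \<le> M" and "0 < m"
    and line: "AE x in lborel. \<forall>a b. a \<le> b \<longrightarrow> \<rho> (x + b *\<^sub>R e) powr m - \<rho> (x + a *\<^sub>R e) powr m
        = - integral {a..b} (\<lambda>s. \<rho> (x + s *\<^sub>R e) * G (x + s *\<^sub>R e))"
  shows "AE p in lborel. p \<in> subgraph \<longrightarrow> (LBINT s. chord_density p s * G (fst p + s *\<^sub>R e)) = 0"
  using AE_fst_lborel[OF line] AE_bounded_chord
proof eventually_elim
  case (elim p)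
  show ?case
  proof
    assume p: "p \<in> subgraph"
    then have h: "0 < snd p" by (simp add: subgraph_def)
    obtain a b where ab: "a < 0" "0 < b" "chord p = {a<..<b}"
      using elim(2) p by (auto simp: bounded_chord_def)
    note ends = bounded_chord_bounds[OF ab]
    have MB: "\<bar>\<rho> x * G x\<bar> \<le> M * B" for x
      using mult_mono[OF \<rho>M bd] nonneg[of x] order_trans[OF nonneg \<rho>M] by (simp add: abs_mult)
    have zero: "integral {a..b} (\<lambda>s. G (fst p + s *\<^sub>R e)) = 0"
    proof (rule integral_log_derivative_zero[where f = "\<lambda>s. \<rho> (fst p + s *\<^sub>R e)" and h = "snd p" and m = m])
      show "continuous_on {a..b} (\<lambda>s. \<rho> (fst p + s *\<^sub>R e))"
        by (intro cont_compose continuous_intros)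
      show "(\<lambda>s. \<rho> (fst p + s *\<^sub>R e) * G (fst p + s *\<^sub>R e)) integrable_on {a..b}"
        by (rule bounded_borel_line_integral(1)[OF _ MB]) measurable
    qed (use ab h ends \<open>0 < m\<close> bd elim(1) in auto)
    have "(LBINT s. chord_density p s * G (fst p + s *\<^sub>R e))
        = (LBINT s. indicator {a..b} s * G (fst p + s *\<^sub>R e) / (b - a))"
    proof (rule integral_cong_AE)
      have "AE s in lborel. s \<noteq> a" "AE s in lborel. s \<noteq> b" by (rule AE_lborel_singleton)+
      then show "AE s in lborel. chord_density p s * G (fst p + s *\<^sub>R e) = indicator {a..b} s * G (fst p + s *\<^sub>R e) / (b - a)"
        by eventually_elim (auto simp: chord_density_def ends(1) ab(3) indicator_def)
    qed measurable
    also have "\<dots> = (LBINT s. indicator {a..b} s * G (fst p + s *\<^sub>R e)) / (b - a)"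
      by simp
    also have "(LBINT s. indicator {a..b} s * G (fst p + s *\<^sub>R e)) = integral {a..b} (\<lambda>s. G (fst p + s *\<^sub>R e))"
      by (rule bounded_borel_line_integral(3)[symmetric, OF _ bd]) measurable
    finally show "(LBINT s. chord_density p s * G (fst p + s *\<^sub>R e)) = 0"
      using zero by simp
  qed
qed

text \<open>
  The point on the right lies on the segment from \<open>x\<close> to its mirror image about the chord's
  center. This segment is part of every chord through \<open>x\<close> whose center is \<open>c\<close>. Pairs with another
  center form a null set, so they cannot fill the open set on which the inequality would fail.
\<close>

lemma decreasing_about_hyperplane:
  assumes center: "AE p in lborel. p \<in> subgraph \<longrightarrow> chord_center p = c" and \<theta>: "\<theta> \<in> {0..1}"
  shows "\<rho> x \<le> \<rho> (x + (\<theta> * (2 * (c - x \<bullet> e))) *\<^sub>R e)"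
proof (rule ccontr)
  define y where "y x = x + (\<theta> * (2 * (c - x \<bullet> e))) *\<^sub>R e" for x
  define U where "U = {p :: 'a \<times> real. \<rho> (y (fst p)) < snd p \<and> snd p < \<rho> (fst p)}"
  assume "\<not> ?thesis"
  then have "\<rho> (y x) < \<rho> x" by (simp add: y_def)
  then have "(x, (\<rho> (y x) + \<rho> x) / 2) \<in> U" by (simp add: U_def)
  then have "U \<noteq> {}" by blast
  moreover have "open U"
    unfolding U_def y_def by (intro open_Collect_conj open_Collect_less cont_compose continuous_intros)
  moreover have "AE p in lborel. p \<in> subgraph \<longrightarrow> chord_center p = c \<and> bounded_chord p"
    using center AE_bounded_chord by eventually_elim simp
  ultimately obtain p where p: "p \<in> U" "p \<in> subgraph \<longrightarrow> chord_center p = c \<and> bounded_chord p"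
    using AE_imp_ex_in_open by blast
  have "p \<in> subgraph"
    using p(1) nonneg[of "y (fst p)"] by (auto simp: U_def subgraph_def intro: le_less_trans)
  with p(2) obtain a b where ab: "a < 0" "0 < b" "chord p = {a<..<b}" and c: "chord_center p = c"
    by (auto simp: bounded_chord_def)
  have "2 * (c - fst p \<bullet> e) = a + b"
    using bounded_chord_bounds(2)[OF ab] c by (simp add: field_simps)
  moreover have "a + b \<in> chord p" using ab by simp
  moreover have "\<theta> * (a + b) \<in> closed_segment 0 (a + b)"
    using \<theta> by (auto simp: segment_0_eq_image)
  ultimately have "\<theta> * (2 * (c - fst p \<bullet> e)) \<in> chord p"
    using chord_segment[of "a + b" p "\<theta> * (a + b)"] by simp
  then have "snd p < \<rho> (y (fst p))"
    unfolding chord_def y_def using ends_in_segment(2) by blast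
  with p(1) show False by (simp add: U_def)
qed

end

text \<open>
  The half-space \<open>{x. s < x \<bullet> v}\<close> and its translate carry the same finite mass, so the slab between
  them carries none. Every point is interior to such a slab.
\<close>

lemma not_periodic_if_integrable:
  fixes \<rho> :: "'a::euclidean_space \<Rightarrow> real"
  assumes cont: "continuous_on UNIV \<rho>" and nonneg: "\<And>x. 0 \<le> \<rho> x" and int: "integrable lborel \<rho>"
    and period: "\<And>x. \<rho> (x + v) = \<rho> x" and "v \<noteq> 0"
  shows "\<rho> z = 0"
proof (rule ccontr)
  have [measurable]: "\<rho> \<in> borel_measurable borel" using cont by (rule borel_measurable_continuous_onI)
  assume "\<rho> z \<noteq> 0"
  then have z: "0 < \<rho> z" using nonneg[of z] by linarith
  define \<tau> where "\<tau> = v \<bullet> v"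
  have "0 < \<tau>" using \<open>v \<noteq> 0\<close> by (simp add: \<tau>_def)
  \<comment> \<open>the slab between \<open>s - \<tau>\<close> and \<open>s\<close> has \<open>z\<close> in its middle\<close>
  define s where "s = z \<bullet> v + \<tau> / 2"
  define h where "h r x = indicator {x. r < x \<bullet> v} x * \<rho> x" for r :: real and x
  have [measurable]: "h r \<in> borel_measurable borel" for r unfolding h_def by measurable
  have h_int: "integrable lborel (h r)" for r
    by (rule Bochner_Integration.integrable_bound[OF int]) (auto simp: h_def indicator_def intro!: AE_I2)
  have "(LBINT x. h s x) = (LBINT x. h s (x + v))"
    by (rule lborel_translate(1)[symmetric]) measurable
  also have "\<dots> = (LBINT x. h (s - \<tau>) x)"
    by (rule Bochner_Integration.integral_cong)
       (auto simp: h_def period inner_add_left \<tau>_def indicator_def)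
  finally have "(LBINT x. h (s - \<tau>) x - h s x) = 0"
    using h_int by simp
  moreover have "0 \<le> h (s - \<tau>) x - h s x" for x
    using nonneg[of x] \<open>0 < \<tau>\<close> by (auto simp: h_def indicator_def)
  ultimately have "AE x in lborel. h (s - \<tau>) x - h s x = 0"
    using h_int by (subst integral_nonneg_eq_0_iff_AE[symmetric]) auto
  moreover have "open {x. s - \<tau> < x \<bullet> v \<and> x \<bullet> v < s \<and> 0 < \<rho> x}"
    by (intro open_Collect_conj open_Collect_less continuous_intros cont)
  moreover have "z \<in> {x. s - \<tau> < x \<bullet> v \<and> x \<bullet> v < s \<and> 0 < \<rho> x}"
    using z \<open>0 < \<tau>\<close> by (simp add: s_def)
  ultimately obtain x where "s - \<tau> < x \<bullet> v" "x \<bullet> v < s" "0 < \<rho> x" "h (s - \<tau>) x - h s x = 0"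
    using AE_imp_ex_in_open by blast
  then show False by (simp add: h_def)
qed

text \<open>
  Let \<open>r\<close> be the translate for which the coordinate hyperplanes are mirrors. Their composition is
  \<open>x \<mapsto> - x\<close>. A mirror at signed distance \<open>d e\<close> from the origin, composed with its image under this
  central symmetry, is a translation by \<open>4 d e\<close>. Periodicity being excluded, all mirrors pass through
  the origin, and any two points of equal norm are mirror images of each other.
\<close>

lemma radial_if_decreasing_in_all_directions:
  fixes \<rho> :: "'a::euclidean_space \<Rightarrow> real"
  assumes cont: "continuous_on UNIV \<rho>" and nonneg: "\<And>x. 0 \<le> \<rho> x" and int: "integrable lborel \<rho>"
    and dirs: "\<And>e. norm e = 1 \<Longrightarrow>
      \<exists>c. \<forall>x. \<forall>\<theta>\<in>{0..1}. \<rho> x \<le> \<rho> (x + (\<theta> * (2 * (c - x \<bullet> e))) *\<^sub>R e)"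
  shows "\<exists>x\<^sub>1 g. antimono_on {0..} g \<and> (\<forall>x. \<rho> (x + x\<^sub>1) = g (norm x))"
proof -
  obtain c where c: "\<And>e x \<theta>. norm e = 1 \<Longrightarrow> \<theta> \<in> {0..1} \<Longrightarrow> \<rho> x \<le> \<rho> (x + (\<theta> * (2 * (c e - x \<bullet> e))) *\<^sub>R e)"
    using dirs by metis
  define x1 where "x1 = (\<Sum>b\<in>Basis. c b *\<^sub>R b)"
  define r where "r x = \<rho> (x + x1)" for x
  define d where "d e = c e - x1 \<bullet> e" for e
  have r_le: "r x \<le> r (x + (\<theta> * (2 * (d e - x \<bullet> e))) *\<^sub>R e)" if "norm e = 1" "\<theta> \<in> {0..1}" for e x \<theta>
    using c[OF that, of "x + x1"] by (simp add: r_def d_def inner_add_left algebra_simps)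
  have r_refl: "r (x + (2 * (d e - x \<bullet> e)) *\<^sub>R e) = r x" if e: "norm e = 1" for e x
  proof -
    have ee: "e \<bullet> e = 1" using e by (simp add: norm_eq_1)
    define y where "y = x + (2 * (d e - x \<bullet> e)) *\<^sub>R e"
    have "y \<bullet> e = 2 * d e - x \<bullet> e" by (simp add: y_def inner_add_left ee algebra_simps)
    then have "y + (2 * (d e - y \<bullet> e)) *\<^sub>R e = x + ((2 * (d e - x \<bullet> e)) + 2 * (x \<bullet> e - d e)) *\<^sub>R e"
      by (simp only: scaleR_left_distrib) (simp add: y_def)
    then have "y + (2 * (d e - y \<bullet> e)) *\<^sub>R e = x" by simp
    then have "r y \<le> r x" using r_le[OF e, of 1 y] by simp
    moreover have "r x \<le> r y" using r_le[OF e, of 1 x] by (simp add: y_def)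
    ultimately show ?thesis by (simp add: y_def)
  qed
  have d_basis: "d b = 0" if "b \<in> Basis" for b
    using that by (simp add: d_def x1_def)
  have flips: "r (x - (\<Sum>b\<in>A. (2 * (x \<bullet> b)) *\<^sub>R b)) = r x" if "finite A" "A \<subseteq> Basis" for A x
    using that
  proof (induction A rule: finite_induct)
    case (insert b A)
    define y where "y = x - (\<Sum>b\<in>A. (2 * (x \<bullet> b)) *\<^sub>R b)"
    have b: "b \<in> Basis" using insert by auto
    have "(\<Sum>b'\<in>A. (2 * (x \<bullet> b')) *\<^sub>R b') \<bullet> b = (\<Sum>b'\<in>A. 0)"
      unfolding inner_sum_left
    proof (rule sum.cong)
      fix b' assume "b' \<in> A"
      then have "b' \<bullet> b = 0"
        using insert b by (intro inner_not_same_Basis) auto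
      then show "((2 * (x \<bullet> b')) *\<^sub>R b') \<bullet> b = 0" by simp
    qed simp
    then have "y \<bullet> b = x \<bullet> b" by (simp add: y_def inner_diff_left)
    then have "y + (2 * (d b - y \<bullet> b)) *\<^sub>R b = x - (\<Sum>b\<in>insert b A. (2 * (x \<bullet> b)) *\<^sub>R b)"
      using insert by (simp add: y_def d_basis[OF b])
    then have "r (x - (\<Sum>b\<in>insert b A. (2 * (x \<bullet> b)) *\<^sub>R b)) = r y"
      using r_refl[of b y] b by simp
    with insert show ?case by (simp add: y_def)
  qed simp
  have even: "r (- x) = r x" for x
  proof -
    have "(\<Sum>b\<in>Basis. (2 * (x \<bullet> b)) *\<^sub>R b) = 2 *\<^sub>R x"
      by (simp add: euclidean_representation flip: scaleR_scaleR scaleR_sum_right)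
    then have "x - (\<Sum>b\<in>Basis. (2 * (x \<bullet> b)) *\<^sub>R b) = - x" by (simp add: scaleR_2)
    with flips[of Basis x] show ?thesis by simp
  qed
  \<comment> \<open>\<open>y\<close> is the image of \<open>x\<close> under the mirror reflected through the origin\<close>
  have period: "r (x + (4 * d e) *\<^sub>R e) = r x" if e: "norm e = 1" for e x
  proof -
    have ee: "e \<bullet> e = 1" using e by (simp add: norm_eq_1)
    define y where "y = x - (2 * (d e + x \<bullet> e)) *\<^sub>R e"
    have "- x + (2 * (d e - (- x) \<bullet> e)) *\<^sub>R e = - y" by (simp add: y_def)
    then have "r (- y) = r (- x)" using r_refl[OF e, of "- x"] by simp
    then have "r y = r x" by (simp add: even)
    moreover have "y + (2 * (d e - y \<bullet> e)) *\<^sub>R e = x + (4 * d e) *\<^sub>R e"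
    proof -
      have "y \<bullet> e = - 2 * d e - x \<bullet> e" by (simp add: y_def inner_diff_left ee algebra_simps)
      then have "y + (2 * (d e - y \<bullet> e)) *\<^sub>R e = x + (- (2 * (d e + x \<bullet> e)) + 2 * (3 * d e + x \<bullet> e)) *\<^sub>R e"
        by (simp only: scaleR_left_distrib scaleR_minus_left) (simp add: y_def algebra_simps)
      then show ?thesis by (simp add: algebra_simps)
    qed
    ultimately show ?thesis using r_refl[OF e, of y] by simp
  qed
  have [measurable]: "\<rho> \<in> borel_measurable borel" using cont by (rule borel_measurable_continuous_onI)
  have r_cont: "continuous_on UNIV r"
    unfolding r_def by (rule continuous_on_compose2[OF cont]) (auto intro!: continuous_intros)
  have r_int: "integrable lborel r"
    using lborel_translate(2)[of \<rho> x1] int by (simp add: r_def[abs_def])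
  obtain b :: 'a where b: "b \<in> Basis" using nonempty_Basis by blast
  show ?thesis
  proof (cases "\<forall>x. r x = 0")
    case True
    then show ?thesis
      by (intro exI[of _ x1] exI[of _ "\<lambda>t. 0"]) (auto simp: r_def monotone_on_def)
  next
    case False
    have d0: "d e = 0" if e: "norm e = 1" for e
    proof (rule ccontr)
      assume "d e \<noteq> 0"
      moreover have "e \<noteq> 0" using e by auto
      ultimately have "(4 * d e) *\<^sub>R e \<noteq> 0" by simp
      then have "r x = 0" for x
        by (intro not_periodic_if_integrable[OF r_cont _ r_int period[OF e]]) (simp_all add: r_def nonneg)
      with False show False by blast
    qed
    have same: "r x \<le> r y" if xy: "norm x = norm y" for x y
    proof (cases "x = y")
      case False
      define e where "e = (x - y) /\<^sub>R norm (x - y)"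
      have e: "norm e = 1" using False by (simp add: e_def)
      have "x \<bullet> x = y \<bullet> y" using xy by (simp add: dot_square_norm)
      then have "2 * (x \<bullet> (x - y)) = (x - y) \<bullet> (x - y)"
        by (simp add: inner_diff_left inner_diff_right inner_commute)
      moreover have "x \<bullet> e = (x \<bullet> (x - y)) / norm (x - y)"
        unfolding e_def inner_scaleR_right by (simp add: divide_inverse mult.commute)
      ultimately have "2 * (x \<bullet> e) = (norm (x - y) * norm (x - y)) / norm (x - y)"
        by (simp add: dot_square_norm power2_eq_square)
      then have "2 * (x \<bullet> e) = norm (x - y)" by simp
      then have "(2 * (x \<bullet> e)) *\<^sub>R e = x - y"
        using False by (simp add: e_def)
      then show ?thesis
        using r_le[OF e, of 1 x] by (simp add: d0[OF e])
    qed simp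
    have "antimono_on {0..} (\<lambda>t. r (t *\<^sub>R b))"
    proof (rule monotone_onI)
      fix t s :: real assume ts: "t \<in> {0..}" "s \<in> {0..}" "t \<le> s"
      show "r (s *\<^sub>R b) \<le> r (t *\<^sub>R b)"
      proof (cases "s = 0")
        case False
        define \<theta> where "\<theta> = (s - t) / (2 * s)"
        have "\<theta> \<in> {0..1}" using ts False by (simp add: \<theta>_def field_simps)
        moreover have "s *\<^sub>R b + (\<theta> * (2 * (d b - s *\<^sub>R b \<bullet> b))) *\<^sub>R b = t *\<^sub>R b"
        proof -
          have "\<theta> * (2 * s) = s - t" using False by (simp add: \<theta>_def)
          then have "s *\<^sub>R b + (\<theta> * (2 * (d b - s *\<^sub>R b \<bullet> b))) *\<^sub>R b = s *\<^sub>R b + (- (s - t)) *\<^sub>R b"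
            using b by (simp add: d_basis mult.assoc)
          then show ?thesis by (simp flip: scaleR_left_distrib)
        qed
        ultimately show ?thesis
          using r_le[of b \<theta> "s *\<^sub>R b"] b by simp
      qed (use ts in auto)
    qed
    moreover have "r x = r (norm x *\<^sub>R b)" for x
      using same[of x "norm x *\<^sub>R b"] same[of "norm x *\<^sub>R b" x] b by simp
    ultimately show ?thesis
      by (intro exI[of _ x1] exI[of _ "\<lambda>t. r (t *\<^sub>R b)"]) (auto simp: r_def)
  qed
qed

section \<open>Stationary states\<close>

lemma integral_lebesgue_eq_lborel:
  fixes f g :: "'a::euclidean_space \<Rightarrow> 'b::euclidean_space"
  assumes "f \<in> borel_measurable lebesgue" "g \<in> borel_measurable borel" "AE x in lborel. f x = g x"
  shows "(LINT x|lebesgue. f x) = (LINT x|lborel. g x)"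
proof -
  have "(LINT x|lebesgue. f x) = (LINT x|lebesgue. g x)"
    by (rule integral_cong_AE) (use assms in \<open>auto intro: AE_completion measurable_completion\<close>)
  also have "\<dots> = (LINT x|lborel. g x)"
    using assms(2) by (intro integral_completion) simp
  finally show ?thesis .
qed

text \<open>
  The identity for basis vectors extends to every \<open>w\<close> by linearity, and from the given functions to
  Borel representatives because the integrals do not see null sets.
\<close>

lemma distributional_gradient_box_bump:
  fixes u :: "'a::euclidean_space \<Rightarrow> real" and v :: "'a \<Rightarrow> 'a"
  assumes dist: "has_distributional_gradient u\<^sub>0 v\<^sub>0"
    and meas0: "u\<^sub>0 \<in> borel_measurable lebesgue" "v\<^sub>0 \<in> borel_measurable lebesgue"
    and [measurable]: "u \<in> borel_measurable borel" "v \<in> borel_measurable borel"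
    and AE: "AE x in lborel. u\<^sub>0 x = u x" "AE x in lborel. v\<^sub>0 x = v x"
    and bd: "\<And>x. \<bar>u x\<bar> \<le> B" "\<And>x. norm (v x) \<le> C"
  shows "(LBINT x. u x * frechet_derivative (box_bump a c n) (at x) w)
       = - (LBINT x. (v x \<bullet> w) * box_bump a c n x)"
proof -
  obtain \<phi>' D where d: "\<And>x. (box_bump a c n has_derivative \<phi>' x) (at x)"
    and cont: "\<And>w. continuous_on UNIV (\<lambda>x. \<phi>' x w)"
    and out: "\<And>x w. x \<notin> cbox a c \<Longrightarrow> \<phi>' x w = 0"
    and D: "\<And>x w. \<bar>\<phi>' x w\<bar> \<le> D w"
    using box_bump_derivative by blast
  have fd: "frechet_derivative (box_bump a c n) (at x) = \<phi>' x" for x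
    using frechet_derivative_at[OF d] by simp
  have [measurable]: "(\<lambda>x. \<phi>' x w) \<in> borel_measurable borel" for w
    using cont by (rule borel_measurable_continuous_onI)
  have B: "0 \<le> B" using bd(1)[of 0] by linarith
  have C: "0 \<le> C" using bd(2)[of 0] norm_ge_zero[of "v 0"] by linarith
  have basis: "(LBINT x. u x * \<phi>' x b) = - (LBINT x. (v x \<bullet> b) * box_bump a c n x)" if b: "b \<in> Basis" for b
  proof -
    have "(LINT x|lebesgue. u\<^sub>0 x * frechet_derivative (box_bump a c n) (at x) b)
        = - (LINT x|lebesgue. (v\<^sub>0 x \<bullet> b) * box_bump a c n x)"
      using dist test_function_box_bump b unfolding has_distributional_gradient_def by blast
    moreover have "(LINT x|lebesgue. u\<^sub>0 x * frechet_derivative (box_bump a c n) (at x) b) = (LBINT x. u x * \<phi>' x b)"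
      unfolding fd
    proof (rule integral_lebesgue_eq_lborel)
      show "AE x in lborel. u\<^sub>0 x * \<phi>' x b = u x * \<phi>' x b"
        using AE(1) by eventually_elim simp
      show "(\<lambda>x. u\<^sub>0 x * \<phi>' x b) \<in> borel_measurable lebesgue"
        by (intro borel_measurable_times meas0 measurable_completion) simp
    qed measurable
    moreover have "(LINT x|lebesgue. (v\<^sub>0 x \<bullet> b) * box_bump a c n x) = (LBINT x. (v x \<bullet> b) * box_bump a c n x)"
    proof (rule integral_lebesgue_eq_lborel)
      show "AE x in lborel. (v\<^sub>0 x \<bullet> b) * box_bump a c n x = (v x \<bullet> b) * box_bump a c n x"
        using AE(2) by eventually_elim simp
      show "(\<lambda>x. (v\<^sub>0 x \<bullet> b) * box_bump a c n x) \<in> borel_measurable lebesgue"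
        by (intro borel_measurable_times borel_measurable_inner meas0 measurable_completion) simp_all
    qed measurable
    ultimately show ?thesis by simp
  qed
  have bump0: "box_bump a c n x = 0" if "x \<notin> cbox a c" for x
    using that box_subset_cbox[of a c] by (intro box_bump_outside) blast
  have int_u: "integrable lborel (\<lambda>x. u x * \<phi>' x b)" for b
  proof (rule integrable_bounded_support[where B = "B * D b" and A = "cbox a c"])
    show "\<bar>u x * \<phi>' x b\<bar> \<le> B * D b" for x
      using mult_mono[OF bd(1) D B] by (simp add: abs_mult)
  qed (simp_all add: out)
  have int_v: "integrable lborel (\<lambda>x. (v x \<bullet> b) * box_bump a c n x)" for b
  proof (rule integrable_bounded_support[where B = "C * norm b * 1" and A = "cbox a c"])
    show "\<bar>(v x \<bullet> b) * box_bump a c n x\<bar> \<le> C * norm b * 1" for x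
    proof -
      have "\<bar>v x \<bullet> b\<bar> \<le> C * norm b"
        using Cauchy_Schwarz_ineq2[of "v x" b] mult_right_mono[OF bd(2) norm_ge_zero[of b]] by (rule order_trans)
      then show ?thesis
        unfolding abs_mult using box_bump_bounds[of a c n x] C by (intro mult_mono) auto
    qed
  qed (simp_all add: bump0)
  have "(LBINT x. u x * \<phi>' x w) = (\<integral>x. (\<Sum>b\<in>Basis. (w \<bullet> b) * (u x * \<phi>' x b)) \<partial>lborel)"
  proof (rule Bochner_Integration.integral_cong)
    fix x
    have lin: "linear (\<phi>' x)" using d by (rule has_derivative_linear)
    have "\<phi>' x w = \<phi>' x (\<Sum>b\<in>Basis. (w \<bullet> b) *\<^sub>R b)" by (simp add: euclidean_representation)
    also have "\<dots> = (\<Sum>b\<in>Basis. (w \<bullet> b) * \<phi>' x b)"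
      by (simp add: linear_sum[OF lin] linear_scale[OF lin])
    finally show "u x * \<phi>' x w = (\<Sum>b\<in>Basis. (w \<bullet> b) * (u x * \<phi>' x b))"
      by (simp add: sum_distrib_left mult.left_commute)
  qed simp
  also have "\<dots> = (\<Sum>b\<in>Basis. (w \<bullet> b) * (LBINT x. u x * \<phi>' x b))"
    using int_u by (subst Bochner_Integration.integral_sum) auto
  also have "\<dots> = - (\<Sum>b\<in>Basis. (w \<bullet> b) * (LBINT x. (v x \<bullet> b) * box_bump a c n x))"
    by (simp add: basis sum_negf)
  also have "(\<Sum>b\<in>Basis. (w \<bullet> b) * (LBINT x. (v x \<bullet> b) * box_bump a c n x))
      = (\<integral>x. (\<Sum>b\<in>Basis. (w \<bullet> b) * ((v x \<bullet> b) * box_bump a c n x)) \<partial>lborel)"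
    using int_v by (subst Bochner_Integration.integral_sum) auto
  also have "\<dots> = (LBINT x. (v x \<bullet> w) * box_bump a c n x)"
    by (simp add: euclidean_inner[of "v _" w] sum_distrib_right sum_distrib_left mult_ac)
  finally show ?thesis unfolding fd .
qed

lemma bounded_borel_representative:
  fixes \<rho> :: "'a::euclidean_space \<Rightarrow> real"
  assumes "\<rho> \<in> L1_plus \<inter> L_infinity"
  obtains \<rho>\<^sub>0 M where "\<rho>\<^sub>0 \<in> borel_measurable borel" "\<And>x. 0 \<le> \<rho>\<^sub>0 x" "\<And>x. \<rho>\<^sub>0 x \<le> M"
    "integrable lborel \<rho>\<^sub>0" "AE x in lborel. \<rho> x = \<rho>\<^sub>0 x"
proof -
  have \<rho>: "integrable lebesgue \<rho>" "AE x in lborel. 0 \<le> \<rho> x" "\<rho> \<in> borel_measurable lebesgue"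
    using assms by (auto simp: L1_plus_def L_infinity_def AE_completion_iff)
  obtain M where M: "AE x in lborel. \<bar>\<rho> x\<bar> \<le> M"
    using assms by (auto simp: L_infinity_def AE_completion_iff)
  obtain r where r[measurable]: "r \<in> borel_measurable lborel" and AE_r: "AE x in lborel. \<rho> x = r x"
    using completion_ex_borel_measurable_real[OF \<rho>(3)] by blast
  define \<rho>0 where "\<rho>0 x = min \<bar>M\<bar> (max 0 (r x))" for x
  have meas[measurable]: "\<rho>0 \<in> borel_measurable borel" unfolding \<rho>0_def using r by simp
  have AE0: "AE x in lborel. \<rho> x = \<rho>0 x"
    using AE_r M \<rho>(2) by eventually_elim (auto simp: \<rho>0_def)
  have "integrable lebesgue \<rho>0"
    by (rule Bochner_Integration.integrable_cong_AE_imp[OF \<rho>(1)])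
       (use AE0 in \<open>auto intro: AE_completion measurable_completion\<close>)
  then have "integrable lborel \<rho>0"
    by (subst (asm) integrable_completion) simp_all
  then show ?thesis
    using that[of \<rho>0 "\<bar>M\<bar>"] AE0 meas by (auto simp: \<rho>0_def)
qed

theorem theorem2p2:
  fixes m :: real
    and W :: "'a::euclidean_space \<Rightarrow> real"
    and \<omega> :: "real \<Rightarrow> real"
    and \<rho> :: "'a \<Rightarrow> real"
  assumes "m > 0"
    and K1_C1: "\<And>x. x \<noteq> 0 \<Longrightarrow> W differentiable (at x)"
               "continuous_on (- {0}) (gradient W)"
    and K1_radial: "\<And>x. x \<noteq> 0 \<Longrightarrow> W x = \<omega> (norm x)"
    and K1_omega: "\<And>r. r > 0 \<Longrightarrow> deriv \<omega> r > 0" "\<omega> 1 = 0"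
    and K2: "\<exists>C>0. \<forall>r. 0 < r \<and> r \<le> 1 \<longrightarrow> deriv \<omega> r \<le> C * r powi (1 - int DIM('a))"
    and K3: "\<exists>C>0. \<forall>r>1. deriv \<omega> r \<le> C"
    and K4: "bounded (\<omega> ` {1..}) \<or>
             (\<exists>C>0. \<forall>a\<ge>0. \<forall>b\<ge>0. max (\<omega> (a + b)) 0 \<le> C * (1 + \<omega> (1 + a) + \<omega> (1 + b)))"
    and "\<rho> \<in> L1_plus \<inter> L_infinity"
    and "integrable lebesgue (\<lambda>x. \<omega> (1 + norm x) * \<rho> x)"
    and "stationary_state m W \<rho>"
  shows "\<exists>x0. radially_decreasing (\<lambda>x. \<rho> (x - x0))"
proof -
  obtain \<rho>\<^sub>0 M where [measurable]: "\<rho>\<^sub>0 \<in> borel_measurable borel"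
    and \<rho>0: "\<And>x. 0 \<le> \<rho>\<^sub>0 x" "\<And>x. \<rho>\<^sub>0 x \<le> M" and \<rho>0_int: "integrable lborel \<rho>\<^sub>0"
    and AE_\<rho>0: "AE x in lborel. \<rho> x = \<rho>\<^sub>0 x"
    using bounded_borel_representative[OF \<open>\<rho> \<in> L1_plus \<inter> L_infinity\<close>] by blast
  have \<rho>_meas: "\<rho> \<in> borel_measurable lebesgue"
    using \<open>\<rho> \<in> L1_plus \<inter> L_infinity\<close> by (simp add: L_infinity_def)
  have M: "0 \<le> M" using \<rho>0[of 0] by linarith

  define F :: "'a \<Rightarrow> 'a" where "F = radial_field (deriv \<omega>)"
  have grad: "gradient W z = F z" if "z \<noteq> 0" for z
    unfolding F_def by (rule gradient_radial[OF K1_C1(1) K1_radial that])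
  have F_cont: "continuous_on (- {0}) F"
    using K1_C1(2) by (rule continuous_on_eq) (simp add: grad)
  have [measurable]: "F \<in> borel_measurable borel"
  proof -
    have "(\<lambda>z. if z \<in> {0} then 0 else F z) \<in> borel_measurable borel"
      by (rule borel_measurable_continuous_on_if) (simp_all add: F_cont)
    also have "(\<lambda>z. if z \<in> {0} then 0 else F z) = F"
      by (auto simp: F_def radial_field_def)
    finally show ?thesis .
  qed
  have [measurable]: "gradient W \<in> borel_measurable borel"
  proof -
    have "(\<lambda>z. if z \<in> {0} then gradient W 0 else F z) \<in> borel_measurable borel"
      by (rule borel_measurable_continuous_on_if) (simp_all add: F_cont)
    also have "(\<lambda>z. if z \<in> {0} then gradient W 0 else F z) = gradient W"
      by (auto simp: grad)
    finally show ?thesis .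
  qed
  obtain C where "0 \<le> C"
    and F_le: "\<And>z. norm (F z) \<le> C * (1 + indicator (cball 0 1) z * norm z powi (1 - int DIM('a)))"
  proof -
    obtain C2 where C2: "C2 > 0" "\<And>r. 0 < r \<Longrightarrow> r \<le> 1 \<Longrightarrow> deriv \<omega> r \<le> C2 * r powi (1 - int DIM('a))"
      using K2 by blast
    obtain C3 where C3: "C3 > 0" "\<And>r. 1 < r \<Longrightarrow> deriv \<omega> r \<le> C3"
      using K3 by blast
    have "norm (F z) \<le> max C2 C3 * (1 + indicator (cball 0 1) z * norm z powi (1 - int DIM('a)))" for z
    proof (cases "z = 0")
      case False
      then have nF: "norm (F z) = deriv \<omega> (norm z)"
        using K1_omega(1)[of "norm z"] by (simp add: F_def norm_radial_field)
      show ?thesis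
      proof (cases "norm z \<le> 1")
        case True
        have "C2 * norm z powi (1 - int DIM('a)) \<le> max C2 C3 * (1 + norm z powi (1 - int DIM('a)))"
          using C2(1) by (intro mult_mono) auto
        with C2(2)[of "norm z"] True False nF show ?thesis by simp
      next
        case outside: False
        then show ?thesis using C3(2)[of "norm z"] nF by simp
      qed
    qed (use C2(1) in \<open>simp add: F_def radial_field_def\<close>)
    then show ?thesis using that[of "max C2 C3"] C2(1) by simp
  qed

  define G where "G x = (LBINT y. \<rho>\<^sub>0 y *\<^sub>R F (x - y))" for x
  have [measurable]: "G \<in> borel_measurable borel" unfolding G_def by measurable
  obtain B where B: "0 \<le> B" "\<And>x. (\<integral>\<^sup>+y. ennreal (\<rho>\<^sub>0 y * norm (F (x - y))) \<partial>lborel) \<le> ennreal B"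
    using convolution_bound[of F \<rho>\<^sub>0, OF _ _ \<rho>0 \<rho>0_int F_le \<open>0 \<le> C\<close>] by auto
  have conv_int: "integrable lborel (\<lambda>y. \<rho>\<^sub>0 y *\<^sub>R F (x - y))" for x
    using B(2)[of x] by (intro integrableI_bounded) (auto simp: \<rho>0 intro: le_less_trans)
  have G_le: "norm (G x) \<le> B" for x
  proof -
    have "ennreal (norm (G x)) \<le> (\<integral>\<^sup>+y. ennreal (norm (\<rho>\<^sub>0 y *\<^sub>R F (x - y))) \<partial>lborel)"
      unfolding G_def by (rule integral_norm_bound_ennreal[OF conv_int])
    also have "\<dots> \<le> ennreal B" using B(2)[of x] by (simp add: \<rho>0)
    finally show ?thesis using B(1) by simp
  qed
  have convolve_eq: "convolve (gradient W) \<rho> x = G x" for x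
    unfolding convolve_def G_def
  proof (rule integral_lebesgue_eq_lborel)
    have "AE y in lborel. y \<noteq> x" by (rule AE_lborel_singleton)
    with AE_\<rho>0 show "AE y in lborel. \<rho> y *\<^sub>R gradient W (x - y) = \<rho>\<^sub>0 y *\<^sub>R F (x - y)"
      by eventually_elim (simp add: grad)
    show "(\<lambda>y. \<rho> y *\<^sub>R gradient W (x - y)) \<in> borel_measurable lebesgue"
      by (intro borel_measurable_scaleR \<rho>_meas measurable_completion) measurable
  qed measurable

  have weak: "(LBINT x. \<rho>\<^sub>0 x powr m * frechet_derivative (box_bump a c n) (at x) w)
      = (LBINT x. \<rho>\<^sub>0 x * (G x \<bullet> w) * box_bump a c n x)" for a c n w
  proof -
    have "(LBINT x. \<rho>\<^sub>0 x powr m * frechet_derivative (box_bump a c n) (at x) w)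
        = - (LBINT x. (- (\<rho>\<^sub>0 x *\<^sub>R G x) \<bullet> w) * box_bump a c n x)"
    proof (rule distributional_gradient_box_bump[where B = "M powr m" and C = "M * B"])
      show "has_distributional_gradient (\<lambda>x. \<rho> x powr m) (\<lambda>x. - (\<rho> x *\<^sub>R G x))"
        using \<open>stationary_state m W \<rho>\<close> by (simp add: stationary_state_def convolve_eq[abs_def])
      show "(\<lambda>x. \<rho> x powr m) \<in> borel_measurable lebesgue"
        using \<rho>_meas by measurable
      show "(\<lambda>x. - (\<rho> x *\<^sub>R G x)) \<in> borel_measurable lebesgue"
        by (intro borel_measurable_uminus borel_measurable_scaleR \<rho>_meas measurable_completion) simp
      show "AE x in lborel. \<rho> x powr m = \<rho>\<^sub>0 x powr m" "AE x in lborel. - (\<rho> x *\<^sub>R G x) = - (\<rho>\<^sub>0 x *\<^sub>R G x)"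
        using AE_\<rho>0 by (eventually_elim, simp)+
      show "\<bar>\<rho>\<^sub>0 x powr m\<bar> \<le> M powr m" for x
        using \<rho>0 \<open>m > 0\<close> by (simp add: powr_mono2)
      show "norm (- (\<rho>\<^sub>0 x *\<^sub>R G x)) \<le> M * B" for x
        using \<rho>0[of x] G_le[of x] M by (simp add: mult_mono)
    qed measurable
    then show ?thesis by simp
  qed
  obtain r where r_cont: "continuous_on UNIV r" and r: "\<And>x. 0 \<le> r x" "\<And>x. r x \<le> M"
    and AE_r: "AE x in lborel. \<rho>\<^sub>0 x = r x"
    and lines: "\<And>e. AE x in lborel. \<forall>a b. a \<le> b \<longrightarrow> r (x + b *\<^sub>R e) powr m - r (x + a *\<^sub>R e) powr m
        = - integral {a..b} (\<lambda>s. r (x + s *\<^sub>R e) * (G (x + s *\<^sub>R e) \<bullet> e))"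
    using stationary_representative[OF _ _ \<rho>0 G_le \<open>m > 0\<close> weak] by auto
  have [measurable]: "r \<in> borel_measurable borel"
    using r_cont by (rule borel_measurable_continuous_onI)
  have r_int: "integrable lborel r"
    using \<rho>0_int by (rule Bochner_Integration.integrable_cong_AE_imp) (use AE_r in auto)

  have "\<exists>c. \<forall>x. \<forall>\<theta>\<in>{0..1}. r x \<le> r (x + (\<theta> * (2 * (c - x \<bullet> e))) *\<^sub>R e)" if e: "norm e = 1" for e
  proof -
    interpret level_lines r e
      by unfold_locales (use r_cont r r_int e in auto)
    define k where "k z = F z \<bullet> e" for z
    have k_le: "\<bar>k z\<bar> \<le> norm (F z)" for z
      using Cauchy_Schwarz_ineq2[of "F z" e] e by (simp add: k_def)
    have [measurable]: "k \<in> borel_measurable borel" unfolding k_def by measurable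
    have G_k: "(LBINT y. r y * k (x - y)) = G x \<bullet> e" for x
    proof -
      have "G x \<bullet> e = (LBINT y. (\<rho>\<^sub>0 y *\<^sub>R F (x - y)) \<bullet> e)"
        unfolding G_def by (rule integral_inner_left[symmetric]) (use conv_int in simp)
      also have "\<dots> = (LBINT y. r y * k (x - y))"
      proof (rule integral_cong_AE)
        show "AE y in lborel. (\<rho>\<^sub>0 y *\<^sub>R F (x - y)) \<bullet> e = r y * k (x - y)"
          using AE_r by eventually_elim (simp add: k_def)
      qed measurable
      finally show ?thesis by simp
    qed
    have conv_k: "(\<integral>\<^sup>+y. ennreal (r y * \<bar>k (x - y)\<bar>) \<partial>lborel) \<le> ennreal B" for x
    proof -
      have "(\<integral>\<^sup>+y. ennreal (r y * \<bar>k (x - y)\<bar>) \<partial>lborel) \<le> (\<integral>\<^sup>+y. ennreal (\<rho>\<^sub>0 y * norm (F (x - y))) \<partial>lborel)"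
      proof (rule nn_integral_mono_AE)
        show "AE y in lborel. ennreal (r y * \<bar>k (x - y)\<bar>) \<le> ennreal (\<rho>\<^sub>0 y * norm (F (x - y)))"
          using AE_r by eventually_elim (auto intro!: ennreal_leI mult_left_mono k_le r)
      qed
      then show ?thesis using B(2)[of x] by (rule order_trans)
    qed
    have Ge: "\<bar>G x \<bullet> e\<bar> \<le> B" for x
      using Cauchy_Schwarz_ineq2[of "G x" e] G_le[of x] e by simp
    have "\<exists>c. AE p in lborel. p \<in> subgraph \<longrightarrow> chord_center p = c"
    proof (rule chord_centers_agree[where k = k and B = B])
      show "k (- z) = - k z" for z
        by (simp add: k_def F_def radial_field_minus)
      show "k (z - (2 * (z \<bullet> e)) *\<^sub>R e) = - k z" for z
      proof -
        have ee: "e \<bullet> e = 1" using e by (simp add: norm_eq_1)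
        have "norm (z - (2 * (z \<bullet> e)) *\<^sub>R e) = norm z"
          unfolding norm_eq_sqrt_inner
          by (simp add: inner_diff_left inner_diff_right ee inner_commute[of e z] algebra_simps)
        then show ?thesis
          by (simp add: k_def F_def radial_field_def inner_diff_left ee algebra_simps)
      qed
      show "0 < k z" if "0 < z \<bullet> e" for z
      proof -
        have "z \<noteq> 0" using that by auto
        then show ?thesis using that K1_omega(1)[of "norm z"] by (simp add: k_def F_def radial_field_def)
      qed
      show "continuous_on (- {0}) k"
        unfolding k_def by (intro continuous_intros F_cont)
      show "\<exists>B. \<forall>z. \<bar>k z\<bar> \<le> B" if "DIM('a) = 1"
      proof (intro exI allI)
        fix z :: 'a
        have "C * (1 + indicator (cball 0 1) z * norm z powi (1 - int DIM('a))) \<le> C * 2"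
          using \<open>0 \<le> C\<close> that by (intro mult_left_mono) (auto simp: indicator_def)
        then show "\<bar>k z\<bar> \<le> C * 2" using k_le[of z] F_le[of z] by linarith
      qed
      show "AE p in lborel. p \<in> subgraph \<longrightarrow>
         (LBINT s. chord_density p s * (LBINT y. r y * k (fst p + s *\<^sub>R e - y))) = 0"
        unfolding G_k by (rule mean_force_zero[where B = B and M = M, OF _ Ge r(2) \<open>m > 0\<close> lines]) measurable
    qed (simp_all add: conv_k B(1))
    then show ?thesis using decreasing_about_hyperplane by blast
  qed
  then obtain x\<^sub>1 g where g: "antimono_on {0..} g" "\<And>x. r (x + x\<^sub>1) = g (norm x)"
    using radial_if_decreasing_in_all_directions[OF r_cont r(1) r_int] by blast
  have "AE x in lborel. \<rho> x = r x"
    using AE_\<rho>0 AE_r by eventually_elim simp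
  then have "AE x in lborel. \<rho> (x + x\<^sub>1) = r (x + x\<^sub>1)"
    by (rule AE_lborel_translate)
  then have "AE x in lebesgue. \<rho> (x - (- x\<^sub>1)) = g (norm x)"
    by (intro AE_completion) (simp add: g(2))
  with g(1) show ?thesis
    unfolding radially_decreasing_def by blast
qed

end
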